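(* Let $1<q<p<\infty$ and set $\frac1r:=\frac1q-\frac1p$. Let $b\in L^1_{\mathrm{loc}}(\mathbb{R}^d)$ and let $K$ be a non-degenerate $\omega$-Calderón–Zygmund kernel. Assume the following. (Weights) $\mu$ and $\lambda$ are weights, $\lambda':=\lambda^{-q'/q}$ and $\nu^{\frac1p+\frac1{q'}}:=\mu^{\frac1p}\lambda^{-\frac1q}$; the weights $\mu,\lambda',\nu$ are doubling and $(\mu,\lambda')\in B_{p,q'}(\nu)$. (Boundedness) $U_b:L^p(\mu)\to L^q(\lambda)$ is a bounded linear operator. (Off-support bilinear integral form representation) $$\int_{\mathbb{R}^d}g\,U_bf\,dx=\int_{\mathbb{R}^d}\int_{\mathbb{R}^d}(b(y)-b(x))K(y,x)f(x)g(y)\,dx\,dy$$ whenever $f,g\in L^\infty_c$ have supports separated by a positive distance. Then $$\|M^{\#}_\nu b\|_{L^r(\nu)}\le C\,[\mu,\lambda']_{B_{p,q'}(\nu)}\,[\mu]_{A_\infty(\nu)}^{1/p'}\,[\lambda']_{A_\infty(\nu)}^{1/q}\,\|U_b\|_{L^p(\mu)\to L^q(\lambda)},$$ where $C$ depends only on $p,q,d$, on $K$ (including $\omega$ and the constants in the kernel and non-degeneracy conditions) and on the doubling constants of $\mu,\lambda',\nu$.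
   Context: Cubes in $\mathbb{R}^d$ have sides parallel to the axes; all suprema are over all cubes; $\langle f\rangle_Q:=\frac1{|Q|}\int_Qf\,dx$; $p'$ is the conjugate exponent of $p$. $L^\infty_c$: bounded, compactly supported functions. A weight is a locally integrable function $w:\mathbb{R}^d\to(0,\infty)$, with $w(E):=\int_Ew\,dx$, $\|f\|_{L^p(w)}:=(\int|f|^pw\,dx)^{1/p}$; it is doubling if $w(2Q)\le C_w w(Q)$ for all cubes $Q$ ($2Q$ concentric with twice the side length). For weights $w,\nu$, $$[w]_{A_\infty(\nu)}:=\sup_Q\frac1{w(Q)}\int_Q\sup_{R\ni x}\frac{w(Q\cap R)}{\nu(R)}\,d\nu(x),$$ $$[\mu,\lambda']_{B_{p,q'}(\nu)}:=\sup_Q\Big(\frac{\mu(Q)}{\nu(Q)}\Big)^{1/p}\Big(\frac{\lambda'(Q)}{\nu(Q)}\Big)^{1/q'},$$ and $(\mu,\lambda')\in B_{p,q'}(\nu)$ means the latter is finite. $M^{\#}_\nu b:=\sup_Q\frac{\mathbf 1_Q}{\nu(Q)}\int_Q|b-\langle b\rangle_Q|\,dx$. A modulus of continuity is an increasing $\omega:[0,\infty)\to[0,\infty)$ with $\lim_{t\to0}\omega(t)=0$. An $\omega$-Calderón–Zygmund kernel (with $\omega$ a modulus of continuity) is a function $K:\{(x,y)\in\mathbb{R}^d\times\mathbb{R}^d:x\ne y\}\to\mathbb{C}$ such that, for some constant $C_K$, $|K(x,y)|\le C_K|x-y|^{-d}$ for $x\ne y$, and $|K(x,y)-K(x',y)|+|K(y,x)-K(y,x')|\le\frac1{|x-y|^d}\omega\big(\frac{|x-x'|}{|x-y|}\big)$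 whenever $|x-x'|\le\frac12|x-y|$. It is non-degenerate if there is $c_K>0$ such that for each $x\in\mathbb{R}^d$ and $\rho>0$ there is $y\in\mathbb{R}^d$ with $|x-y|\ge c_K\rho$ and $|K(y,x)|\ge c_K\rho^{-d}$. *)

theory Defs
  imports "HOL-Analysis.Analysis"
begin

text \<open>
  Euclidean space is \<^typ>\<open>real ^ 'd\<close>, so the dimension is \<open>CARD('d)\<close>. All functions are
  Lebesgue measurable and, apart from weights, complex-valued. Quantities that may be infinite
  are of type \<^typ>\<open>ennreal\<close>.
\<close>

text \<open>
  Only meant for exponents \<open>a > 0\<close>; then \<open>0\<close> is mapped to \<open>0\<close> and \<open>\<infinity>\<close> to \<open>\<infinity>\<close>.
\<close>
definition epowr :: "ennreal \<Rightarrow> real \<Rightarrow> ennreal" where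
  "epowr x a = (if x = \<infinity> then \<infinity> else ennreal (enn2real x powr a))"


subsection \<open>Cubes, weights, oscillations\<close>

text \<open>
  A cube is given by its center \<open>c\<close> and \<^emph>\<open>half\<close> its side length, so that
  \<open>cube c (2 * h)\<close> is the concentric cube of twice the side length.
  Cubes are closed; the suprema below are the same for open or half-open cubes.
\<close>
definition cube :: "real ^ 'd \<Rightarrow> real \<Rightarrow> (real ^ 'd) set" where
  "cube c h = cbox (c - vec h) (c + vec h)"

definition cubes :: "(real ^ 'd) set set" where
  "cubes = {cube c h | c h. h > 0}"

definition locally_integrable :: "(real ^ 'd \<Rightarrow> 'b::euclidean_space) \<Rightarrow> bool" where
  "locally_integrable f \<longleftrightarrow> (\<forall>S. compact S \<longrightarrow> f absolutely_integrable_on S)"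

definition weight :: "(real ^ 'd \<Rightarrow> real) \<Rightarrow> bool" where
  "weight w \<longleftrightarrow> locally_integrable w \<and> (\<forall>x. w x > 0)"

definition weight_measure :: "(real ^ 'd \<Rightarrow> real) \<Rightarrow> (real ^ 'd) measure" where
  "weight_measure w = density lebesgue (\<lambda>x. ennreal (w x))"

definition doubling_with :: "real \<Rightarrow> (real ^ 'd \<Rightarrow> real) \<Rightarrow> bool" where
  "doubling_with D w \<longleftrightarrow> (\<forall>c h. h > 0 \<longrightarrow>
     emeasure (weight_measure w) (cube c (2 * h)) \<le> ennreal D * emeasure (weight_measure w) (cube c h))"

definition A_inf_const :: "(real ^ 'd \<Rightarrow> real) \<Rightarrow> (real ^ 'd \<Rightarrow> real) \<Rightarrow> ennreal" where
  "A_inf_const w \<nu> =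
     (SUP Q\<in>cubes. 1 / emeasure (weight_measure w) Q *
        (\<integral>\<^sup>+x\<in>Q. (SUP R\<in>{R \<in> cubes. x \<in> R}.
             emeasure (weight_measure w) (Q \<inter> R) / emeasure (weight_measure \<nu>) R)
           \<partial>weight_measure \<nu>))"

text \<open>
  \<open>B_const s t \<mu> \<sigma> \<nu>\<close> is the constant with exponents \<open>1/s\<close> and \<open>1/t\<close>;
  it is used with \<open>s = p\<close>, \<open>t = q'\<close> and \<open>\<sigma> = \<lambda>'\<close>.
\<close>
definition B_const ::
    "real \<Rightarrow> real \<Rightarrow> (real ^ 'd \<Rightarrow> real) \<Rightarrow> (real ^ 'd \<Rightarrow> real) \<Rightarrow> (real ^ 'd \<Rightarrow> real) \<Rightarrow> ennreal" where
  "B_const s t \<mu> \<sigma> \<nu> =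
     (SUP Q\<in>cubes.
        epowr (emeasure (weight_measure \<mu>) Q / emeasure (weight_measure \<nu>) Q) (1 / s) *
        epowr (emeasure (weight_measure \<sigma>) Q / emeasure (weight_measure \<nu>) Q) (1 / t))"

definition average :: "(real ^ 'd) set \<Rightarrow> (real ^ 'd \<Rightarrow> complex) \<Rightarrow> complex" where
  "average Q f = (1 / measure lebesgue Q) *\<^sub>R (LINT x:Q|lebesgue. f x)"

definition sharp_maximal ::
    "(real ^ 'd \<Rightarrow> real) \<Rightarrow> (real ^ 'd \<Rightarrow> complex) \<Rightarrow> real ^ 'd \<Rightarrow> ennreal" where
  "sharp_maximal \<nu> b x =
     (SUP Q\<in>cubes. indicator Q x / emeasure (weight_measure \<nu>) Q *
        (\<integral>\<^sup>+y\<in>Q. ennreal (cmod (b y - average Q b)) \<partial>lebesgue))"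


subsection \<open>Weighted Lebesgue spaces and operators between them\<close>

definition wnorm :: "real \<Rightarrow> (real ^ 'd \<Rightarrow> real) \<Rightarrow> (real ^ 'd \<Rightarrow> ennreal) \<Rightarrow> ennreal" where
  "wnorm s w F = epowr (\<integral>\<^sup>+x. epowr (F x) s \<partial>weight_measure w) (1 / s)"

abbreviation Lp_norm :: "real \<Rightarrow> (real ^ 'd \<Rightarrow> real) \<Rightarrow> (real ^ 'd \<Rightarrow> complex) \<Rightarrow> ennreal" where
  "Lp_norm s w f \<equiv> wnorm s w (\<lambda>x. ennreal (cmod (f x)))"

definition Lp :: "real \<Rightarrow> (real ^ 'd \<Rightarrow> real) \<Rightarrow> (real ^ 'd \<Rightarrow> complex) set" where
  "Lp s w = {f \<in> borel_measurable lebesgue. Lp_norm s w f < \<infinity>}"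

text \<open>
  An operator acts on representatives, and linearity is required almost everywhere.
  Linearity and boundedness together imply that functions which agree almost everywhere have
  images which agree almost everywhere, so \<open>U\<close> induces a bounded linear operator on
  equivalence classes; conversely every such operator arises in this way.
\<close>
definition bounded_linear_Lp ::
    "real \<Rightarrow> (real ^ 'd \<Rightarrow> real) \<Rightarrow> real \<Rightarrow> (real ^ 'd \<Rightarrow> real) \<Rightarrow>
     ((real ^ 'd \<Rightarrow> complex) \<Rightarrow> (real ^ 'd \<Rightarrow> complex)) \<Rightarrow> bool" where
  "bounded_linear_Lp p \<mu> q lam U \<longleftrightarrow>
     (\<forall>f\<in>Lp p \<mu>. U f \<in> Lp q lam) \<and>
     (\<forall>f\<in>Lp p \<mu>. \<forall>g\<in>Lp p \<mu>. AE x in lebesgue. U (\<lambda>x. f x + g x) x = U f x + U g x) \<and>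
     (\<forall>a. \<forall>f\<in>Lp p \<mu>. AE x in lebesgue. U (\<lambda>x. a * f x) x = a * U f x) \<and>
     (\<exists>B::real. \<forall>f\<in>Lp p \<mu>. Lp_norm q lam (U f) \<le> ennreal B * Lp_norm p \<mu> f)"

definition op_norm ::
    "real \<Rightarrow> (real ^ 'd \<Rightarrow> real) \<Rightarrow> real \<Rightarrow> (real ^ 'd \<Rightarrow> real) \<Rightarrow>
     ((real ^ 'd \<Rightarrow> complex) \<Rightarrow> (real ^ 'd \<Rightarrow> complex)) \<Rightarrow> ennreal" where
  "op_norm p \<mu> q lam U = (SUP f\<in>{f \<in> Lp p \<mu>. Lp_norm p \<mu> f \<le> 1}. Lp_norm q lam (U f))"

definition L_infty_c :: "(real ^ 'd \<Rightarrow> complex) set" where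
  "L_infty_c = {f \<in> borel_measurable lebesgue.
     bounded (range f) \<and> compact (closure {x. f x \<noteq> 0})}"

text \<open>
  Stated with an explicit lower bound for the distance, since \<^const>\<open>setdist\<close> from the empty set
  is \<open>0\<close>.
\<close>
definition separated_supports :: "(real ^ 'd \<Rightarrow> complex) \<Rightarrow> (real ^ 'd \<Rightarrow> complex) \<Rightarrow> bool" where
  "separated_supports f g \<longleftrightarrow>
     (\<exists>\<delta>>0. \<forall>x\<in>closure {x. f x \<noteq> 0}. \<forall>y\<in>closure {y. g y \<noteq> 0}. \<delta> \<le> dist x y)"


subsection \<open>Kernels\<close>

definition modulus_of_continuity :: "(real \<Rightarrow> real) \<Rightarrow> bool" where
  "modulus_of_continuity \<omega> \<longleftrightarrow>
     mono_on {0..} \<omega> \<and> (\<forall>t\<ge>0. \<omega> t \<ge> 0) \<and> (\<omega> \<longlongrightarrow> 0) (at 0 within {0..})"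

text \<open>The values of a kernel on the diagonal are irrelevant.\<close>
definition CZ_kernel :: "(real \<Rightarrow> real) \<Rightarrow> (real ^ 'd \<Rightarrow> real ^ 'd \<Rightarrow> complex) \<Rightarrow> bool" where
  "CZ_kernel \<omega> K \<longleftrightarrow>
     modulus_of_continuity \<omega> \<and>
     (\<exists>C\<^sub>K::real. \<forall>x y. x \<noteq> y \<longrightarrow> cmod (K x y) \<le> C\<^sub>K / norm (x - y) ^ CARD('d)) \<and>
     (\<forall>x x' y. x \<noteq> y \<longrightarrow> norm (x - x') \<le> 1/2 * norm (x - y) \<longrightarrow>
        cmod (K x y - K x' y) + cmod (K y x - K y x')
          \<le> 1 / norm (x - y) ^ CARD('d) * \<omega> (norm (x - x') / norm (x - y)))"

definition nondegenerate_kernel :: "(real ^ 'd \<Rightarrow> real ^ 'd \<Rightarrow> complex) \<Rightarrow> bool" where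
  "nondegenerate_kernel K \<longleftrightarrow>
     (\<exists>c\<^sub>K>0. \<forall>x. \<forall>\<rho>>0. \<exists>y.
        norm (x - y) \<ge> c\<^sub>K * \<rho> \<and> cmod (K y x) \<ge> c\<^sub>K / \<rho> ^ CARD('d))"

definition off_support_representation ::
    "(real ^ 'd \<Rightarrow> complex) \<Rightarrow> (real ^ 'd \<Rightarrow> real ^ 'd \<Rightarrow> complex) \<Rightarrow>
     ((real ^ 'd \<Rightarrow> complex) \<Rightarrow> (real ^ 'd \<Rightarrow> complex)) \<Rightarrow> bool" where
  "off_support_representation b K U \<longleftrightarrow>
     (\<forall>f\<in>L_infty_c. \<forall>g\<in>L_infty_c. separated_supports f g \<longrightarrow>
        (LINT x|lebesgue. g x * U f x) =
        (LINT y|lebesgue. LINT x|lebesgue. (b y - b x) * K y x * f x * g y))"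

end

theory Submission
  imports Defs
begin

text \<open>
  For a cube \<open>Q\<close>, non-degeneracy gives a cube \<open>P\<close> at distance comparable to the side of \<open>Q\<close> such that
  \<open>K\<close> is nearly constant on \<open>P \<times> Q\<close>. Testing the off-support bilinear form with functions carried by
  \<open>Q\<close> and \<open>P\<close> then bounds \<open>\<integral>\<^sub>Q |b - \<langle>b\<rangle>\<^sub>Q|\<close> by \<open>|\<integral> g U f|\<close>. The \<open>L\<^sup>r(\<nu>)\<close> norm of the sharp maximal function
  is controlled by the sum of \<open>\<Omega>\<^sub>Q\<^sup>r \<nu>(Q)\<close> over a finite \<open>\<nu>\<close>-sparse family, where
  \<open>\<Omega>\<^sub>Q = \<nu>(Q)\<^sup>-\<^sup>1 \<integral>\<^sub>Q |b - \<langle>b\<rangle>\<^sub>Q|\<close>. Choosing signs, the sum of the diagonal terms \<open>a\<^sub>Q c\<^sub>Q |\<integral> g\<^sub>Q U f\<^sub>Q|\<close> is at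
  most one bilinear form of \<open>U\<close> in the sums of \<open>\<plusminus> a\<^sub>Q f\<^sub>Q\<close> and \<open>\<plusminus> c\<^sub>Q g\<^sub>Q\<close>. The norms of these sums are
  estimated by duality and a Carleson embedding, whose packing condition on sparse families is exactly
  what the \<open>A\<^sub>\<infinity>(\<nu>)\<close> constants provide. No dyadic cubes are needed: finite Vitali covering and doubling suffice.
\<close>

subsection \<open>Powers and Hoelder's inequality\<close>

text \<open>The exponents come from r - 1 = r/p + r/q'. Since \<Omega>^r \<nu>(Q) is \<Omega>^(r-1)
  times the unnormalised oscillation, the power is shared out: a_Q is \<Omega>^(r/p)
  (\<nu>(Q)/\<mu>(Q))^(1/p) and c_Q is \<Omega>^(r/q') (\<nu>(Q)/\<lambda>'(Q))^(1/q'). The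
  B-constant enters exactly here, as a bound for the inverse of the product of the two weight
  ratios. Both norms of sums are then governed by the single quantity T, the sum of \<Omega>^r
  \<nu>(Q), through T^(1/p) and T^(1/q'). This gives T <= const T^(1 - 1/r), and dividing leaves
  T^(1/r). The division needs T finite, which is why finite families with uniform constants are
  treated before any limit.

  The embedding is applied with the conjugate exponents p' and q, whence the powers 1/p' and 1/q of
  the A_infinity constants.

  Two obstacles shape the details. The companion cube P differs from Q but lies in a fixed dilate of
  Q, so the embedding must average over dilates while packing the undilated cubes. And a kernel is
  not assumed measurable, so measurability of the iterated integrals is drawn from its continuity
  off the diagonal.\<close>

lemma epowr_ennreal: "0 \<le> x \<Longrightarrow> epowr (ennreal x) a = ennreal (x powr a)"
  by (simp add: epowr_def)

lemma epowr_top [simp]: "epowr top a = top"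
  by (simp add: epowr_def)

lemma epowr_zero [simp]: "epowr 0 a = 0"
  by (simp add: epowr_def)

lemma epowr_mono: "\<lbrakk>x \<le> y; 0 \<le> a\<rbrakk> \<Longrightarrow> epowr x a \<le> epowr y a"
  by (cases x; cases y) (auto simp: epowr_ennreal ennreal_leI powr_mono2 top_unique)

lemma epowr_epowr: "epowr (epowr x a) c = epowr x (a * c)"
  by (cases x) (auto simp: epowr_ennreal powr_powr)

lemma epowr_one [simp]: "epowr x 1 = x"
  by (cases x) (auto simp: epowr_ennreal)

lemma epowr_le_iff:
  assumes "0 < a"
  shows "epowr x a \<le> y \<longleftrightarrow> x \<le> epowr y (1 / a)"
proof
  assume "epowr x a \<le> y"
  then have "epowr (epowr x a) (1 / a) \<le> epowr y (1 / a)"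
    using assms by (intro epowr_mono) auto
  then show "x \<le> epowr y (1 / a)"
    using assms by (simp add: epowr_epowr)
next
  assume "x \<le> epowr y (1 / a)"
  then have "epowr x a \<le> epowr (epowr y (1 / a)) a"
    using assms by (intro epowr_mono) auto
  then show "epowr x a \<le> y"
    using assms by (simp add: epowr_epowr)
qed

lemma epowr_eq_0_iff [simp]: "epowr x a = 0 \<longleftrightarrow> x = 0"
  by (cases x) (auto simp: epowr_ennreal)

lemma epowr_mult: "epowr (x * y) a = epowr x a * epowr y a"
proof (cases "x = 0 \<or> y = 0 \<or> x = top \<or> y = top")
  case True
  then show ?thesis
    by (auto simp: ennreal_mult_eq_top_iff ennreal_top_mult ennreal_mult_top)
next
  case False
  then obtain u v where "x = ennreal u" "y = ennreal v" "u \<ge> 0" "v \<ge> 0"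
    by (cases x; cases y) auto
  then show ?thesis
    by (simp add: epowr_ennreal ennreal_mult[symmetric] powr_mult)
qed

text \<open>Young's inequality is applied pointwise to the two functions divided by their norms.
  Norms equal to 0 or infinity cannot be divided by and are treated first; as 0 times infinity is 0,
  a vanishing norm requires the left-hand side to vanish as well.\<close>

lemma nn_integral_Hoelder:
  fixes f g :: "'a \<Rightarrow> real"
  assumes [measurable]: "f \<in> borel_measurable M" "g \<in> borel_measurable M"
    and nonneg: "\<And>x. 0 \<le> f x" "\<And>x. 0 \<le> g x"
    and p: "1 < p" "1 < q" "1 / p + 1 / q = 1"
  shows "(\<integral>\<^sup>+x. ennreal (f x * g x) \<partial>M) \<le>
    epowr (\<integral>\<^sup>+x. ennreal (f x powr p) \<partial>M) (1 / p) * epowr (\<integral>\<^sup>+x. ennreal (g x powr q) \<partial>M) (1 / q)"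
    (is "?L \<le> epowr ?A _ * epowr ?B _")
proof -
  consider "?A = 0" | "?B = 0" | "?A = top" "?B \<noteq> 0" | "?B = top" "?A \<noteq> 0"
    | "?A \<noteq> 0" "?A \<noteq> top" "?B \<noteq> 0" "?B \<noteq> top" by blast
  then show ?thesis
  proof cases
    case 1
    then have "AE x in M. f x = 0"
      by (subst (asm) nn_integral_0_iff_AE) (auto simp: powr_def ennreal_eq_0_iff)
    then have "AE x in M. ennreal (f x * g x) = 0" by eventually_elim simp
    then have "?L = 0" by (subst nn_integral_0_iff_AE) auto
    then show ?thesis by simp
  next
    case 2
    then have "AE x in M. g x = 0"
      by (subst (asm) nn_integral_0_iff_AE) (auto simp: powr_def ennreal_eq_0_iff)
    then have "AE x in M. ennreal (f x * g x) = 0" by eventually_elim simp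
    then have "?L = 0" by (subst nn_integral_0_iff_AE) auto
    then show ?thesis by simp
  next
    case 3
    then show ?thesis by (simp add: ennreal_top_mult)
  next
    case 4
    then show ?thesis by (simp add: ennreal_mult_top)
  next
    case 5
    obtain \<alpha> \<beta> where ab: "?A = ennreal \<alpha>" "?B = ennreal \<beta>" "\<alpha> > 0" "\<beta> > 0"
      using 5 by (cases ?A; cases ?B) (auto simp: less_le)
    \<comment> \<open>\<open>c\<close> is the product of the two norms. After multiplication by
      \<open>c\<close> the two terms of Young's inequality integrate to \<open>c / p\<close> and
      \<open>c / q\<close>, which add up to \<open>c\<close>.\<close>
    define c where "c = \<alpha> powr (1 / p) * \<beta> powr (1 / q)"
    have c: "c > 0" using ab by (simp add: c_def)
    have pw: "f x * g x \<le> c / (p * \<alpha>) * f x powr p + c / (q * \<beta>) * g x powr q" for x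
    proof -
      have "(f x / \<alpha> powr (1 / p)) * (g x / \<beta> powr (1 / q)) \<le>
          (f x / \<alpha> powr (1 / p)) powr p / p + (g x / \<beta> powr (1 / q)) powr q / q"
        using p ab nonneg by (intro Youngs_inequality) auto
      also have "\<dots> = f x powr p / (p * \<alpha>) + g x powr q / (q * \<beta>)"
        using p ab nonneg by (simp add: powr_divide powr_powr field_simps)
      finally have "c * ((f x / \<alpha> powr (1 / p)) * (g x / \<beta> powr (1 / q))) \<le>
          c * (f x powr p / (p * \<alpha>) + g x powr q / (q * \<beta>))"
        using c by (intro mult_left_mono) auto
      moreover have "c * ((f x / \<alpha> powr (1 / p)) * (g x / \<beta> powr (1 / q))) = f x * g x"
        using ab by (simp add: c_def)
      ultimately show ?thesis by (simp add: algebra_simps)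
    qed
    have "?L \<le> (\<integral>\<^sup>+x. ennreal (c / (p * \<alpha>)) * ennreal (f x powr p) + ennreal (c / (q * \<beta>)) * ennreal (g x powr q) \<partial>M)"
      using pw p ab c by (intro nn_integral_mono) (simp add: ennreal_mult[symmetric] ennreal_plus[symmetric] ennreal_leI del: ennreal_plus)
    also have "\<dots> = ennreal (c / (p * \<alpha>)) * ?A + ennreal (c / (q * \<beta>)) * ?B"
      by (simp add: nn_integral_add nn_integral_cmult)
    also have "\<dots> = ennreal (c / p + c / q)"
      using p ab c by (simp add: ennreal_mult[symmetric] ennreal_plus[symmetric] del: ennreal_plus)
    also have "c / p + c / q = c * (1 / p + 1 / q)" by (simp add: algebra_simps)
    also have "\<dots> = c" using p by simp
    also have "ennreal c = epowr ?A (1 / p) * epowr ?B (1 / q)"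
      using ab by (simp add: epowr_ennreal c_def ennreal_mult)
    finally show ?thesis .
  qed
qed

text \<open>Integration against counting measure reduces this to the previous inequality. The
  absolute values in the proof supply nonnegativity at every index, as that inequality
  demands.\<close>

lemma sum_Hoelder:
  fixes f g :: "'a \<Rightarrow> real"
  assumes "finite S" and nonneg: "\<And>i. i \<in> S \<Longrightarrow> 0 \<le> f i" "\<And>i. i \<in> S \<Longrightarrow> 0 \<le> g i"
    and p: "1 < p" "1 < q" "1 / p + 1 / q = 1"
  shows "(\<Sum>i\<in>S. f i * g i) \<le> (\<Sum>i\<in>S. f i powr p) powr (1 / p) * (\<Sum>i\<in>S. g i powr q) powr (1 / q)"
proof -
  have *: "(\<integral>\<^sup>+i. ennreal (h i) \<partial>count_space S) = ennreal (\<Sum>i\<in>S. h i)" if "\<And>i. i \<in> S \<Longrightarrow> 0 \<le> h i" for h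
    using that assms(1) by (simp add: nn_integral_count_space_finite sum_ennreal)
  have "(\<integral>\<^sup>+i. ennreal (\<bar>f i\<bar> * \<bar>g i\<bar>) \<partial>count_space S) \<le>
    epowr (\<integral>\<^sup>+i. ennreal (\<bar>f i\<bar> powr p) \<partial>count_space S) (1 / p) * epowr (\<integral>\<^sup>+i. ennreal (\<bar>g i\<bar> powr q) \<partial>count_space S) (1 / q)"
    using p by (intro nn_integral_Hoelder) auto
  also have "(\<integral>\<^sup>+i. ennreal (\<bar>f i\<bar> * \<bar>g i\<bar>) \<partial>count_space S) = ennreal (\<Sum>i\<in>S. f i * g i)"
    using nonneg by (subst *) (auto intro!: sum.cong)
  also have "(\<integral>\<^sup>+i. ennreal (\<bar>f i\<bar> powr p) \<partial>count_space S) = ennreal (\<Sum>i\<in>S. f i powr p)"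
    using nonneg by (subst *) (auto intro!: sum.cong)
  also have "(\<integral>\<^sup>+i. ennreal (\<bar>g i\<bar> powr q) \<partial>count_space S) = ennreal (\<Sum>i\<in>S. g i powr q)"
    using nonneg by (subst *) (auto intro!: sum.cong)
  finally show ?thesis
    by (simp add: epowr_ennreal sum_nonneg ennreal_mult[symmetric])
qed

subsection \<open>Cubes and weighted measures\<close>

lemma mem_cube: "x \<in> cube c h \<longleftrightarrow> (\<forall>i. \<bar>x $ i - c $ i\<bar> \<le> h)"
  by (auto simp: cube_def mem_box_cart abs_le_iff algebra_simps)

lemma compact_cube [simp]: "compact (cube c h)"
  by (simp add: cube_def)

lemma sets_cube [measurable, simp]: "cube c h \<in> sets lebesgue"
  by (simp add: cube_def)

lemma center_in_cube: "0 \<le> h \<Longrightarrow> c \<in> cube c h"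
  by (simp add: mem_cube)

lemma cube_subset_cube:
  assumes "\<And>i. \<bar>c $ i - c' $ i\<bar> + h \<le> h'"
  shows "cube c h \<subseteq> cube c' h'"
  unfolding mem_cube subset_iff
proof (intro allI impI)
  fix x i assume "\<forall>i. \<bar>x $ i - c $ i\<bar> \<le> h"
  then have "\<bar>x $ i - c $ i\<bar> \<le> h" ..
  then show "\<bar>x $ i - c' $ i\<bar> \<le> h'" using assms[of i] by linarith
qed

lemma cube_mono: "h \<le> h' \<Longrightarrow> cube c h \<subseteq> cube c h'"
  by (rule cube_subset_cube) simp

text \<open>The geometry gives the factor 3. It is rounded up to 4 so that the enlargement costs
  exactly two doublings.\<close>

lemma cube_subset_if_meets:
  assumes "cube c h \<inter> cube c' h' \<noteq> {}" "h \<le> h'"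
  shows "cube c h \<subseteq> cube c' (4 * h')"
proof (rule cube_subset_cube)
  fix i
  obtain x where "x \<in> cube c h" "x \<in> cube c' h'" using assms by blast
  then have "\<bar>x $ i - c $ i\<bar> \<le> h" "\<bar>x $ i - c' $ i\<bar> \<le> h'" by (simp_all add: mem_cube)
  then show "\<bar>c $ i - c' $ i\<bar> + h \<le> 4 * h'" using assms(2) by linarith
qed

lemma norm_le_cube:
  assumes "x \<in> cube (c :: real ^ 'd) h"
  shows "norm (x - c) \<le> CARD('d) * (h :: real)"
proof -
  have "norm (x - c) \<le> (\<Sum>i\<in>UNIV. \<bar>(x - c) $ i\<bar>)" by (rule norm_le_l1_cart)
  also have "\<dots> \<le> (\<Sum>i\<in>(UNIV::'d set). h)"
    using assms by (intro sum_mono) (simp add: mem_cube)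
  finally show ?thesis by simp
qed

lemma measure_lebesgue_cube:
  assumes "0 \<le> h"
  shows "measure lebesgue (cube (c :: real ^ 'd) h) = (2 * h) ^ CARD('d)"
proof -
  have "cube c h \<noteq> {}" using center_in_cube[OF assms, of c] by blast
  then have "measure lebesgue (cube c h) = (\<Prod>i\<in>(UNIV::'d set). (c + vec h) $ i - (c - vec h) $ i)"
    by (simp add: cube_def content_cbox_cart)
  also have "\<dots> = (\<Prod>i\<in>(UNIV::'d set). 2 * h)" by (intro prod.cong) auto
  finally show ?thesis by simp
qed

lemma emeasure_lebesgue_cube: 
  assumes "0 \<le> h"
  shows "emeasure lebesgue (cube (c :: real ^ 'd) h) = ennreal ((2 * h) ^ CARD('d))"
proof -
  have "cube c h \<in> lmeasurable" by (simp add: lmeasurable_compact)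
  then show ?thesis
    by (simp add: emeasure_eq_measure2 measure_lebesgue_cube[OF assms])
qed

lemma Union_cubes: "(\<Union>n. cube (c :: real ^ 'd) (real n)) = UNIV"
proof (intro set_eqI iffI UNIV_I)
  fix x :: "real ^ 'd"
  obtain n where n: "norm (x - c) \<le> real n" using real_arch_simple by blast
  have "\<bar>x $ i - c $ i\<bar> \<le> real n" for i
    using component_le_norm_cart[of "x - c" i] n by simp
  then show "x \<in> (\<Union>n. cube c (real n))" by (auto simp: mem_cube)
qed

lemma locally_integrable_measurable:
  fixes f :: "real ^ 'd \<Rightarrow> 'b::euclidean_space"
  assumes "locally_integrable f"
  shows "f \<in> borel_measurable lebesgue"
proof (rule borel_measurable_LIMSEQ_metric)
  show "(\<lambda>x. indicator (cube 0 (real n)) x *\<^sub>R f x) \<in> borel_measurable lebesgue" for n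
    using assms unfolding locally_integrable_def set_integrable_def by (auto dest!: spec[of _ "cube 0 (real n)"])
  fix x :: "real ^ 'd"
  obtain n where n: "x \<in> cube 0 (real n)" using Union_cubes[of 0] by blast
  have "\<forall>\<^sub>F m in sequentially. indicator (cube 0 (real m)) x *\<^sub>R f x = f x"
    using eventually_ge_at_top[of n]
  proof eventually_elim
    case (elim m)
    then have "x \<in> cube 0 (real m)" using n cube_mono[of "real n" "real m" 0] by auto
    then show ?case by simp
  qed
  then show "(\<lambda>n. indicator (cube 0 (real n)) x *\<^sub>R f x) \<longlonglongrightarrow> f x"
    by (rule tendsto_eventually)
qed

lemma sets_weight_measure [simp, measurable_cong]: "sets (weight_measure w) = sets lebesgue"
  by (simp add: weight_measure_def)

lemma space_weight_measure [simp]: "space (weight_measure w) = UNIV"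
  by (simp add: weight_measure_def)

lemma weight_pos: "weight w \<Longrightarrow> 0 < w x"
  by (simp add: weight_def)

lemma weight_measurable [measurable_dest]: "weight w \<Longrightarrow> w \<in> borel_measurable lebesgue"
  by (simp add: weight_def locally_integrable_measurable)

lemma nn_integral_weight_measure:
  assumes "weight w" and [measurable]: "f \<in> borel_measurable lebesgue"
  shows "(\<integral>\<^sup>+x. f x \<partial>weight_measure w) = (\<integral>\<^sup>+x. ennreal (w x) * f x \<partial>lebesgue)"
  unfolding weight_measure_def using weight_measurable[OF assms(1)]
  by (subst nn_integral_density) auto

lemma emeasure_weight_measure:
  assumes "weight w" and [measurable]: "A \<in> sets lebesgue"
  shows "emeasure (weight_measure w) A = (\<integral>\<^sup>+x\<in>A. ennreal (w x) \<partial>lebesgue)"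
  unfolding weight_measure_def using weight_measurable[OF assms(1)]
  by (subst emeasure_density) auto

lemma emeasure_weight_compact:
  assumes "weight w" "compact A"
  shows "emeasure (weight_measure w) A < \<infinity>"
proof -
  have A: "A \<in> sets lebesgue" using assms(2) by (simp add: lmeasurable_compact fmeasurableD)
  have "set_integrable lebesgue A w" using assms by (auto simp: weight_def locally_integrable_def)
  then have "(\<integral>\<^sup>+x. ennreal (norm (indicator A x *\<^sub>R w x)) \<partial>lebesgue) < \<infinity>"
    by (simp add: set_integrable_def integrable_iff_bounded)
  also have "(\<integral>\<^sup>+x. ennreal (norm (indicator A x *\<^sub>R w x)) \<partial>lebesgue) = emeasure (weight_measure w) A"
    unfolding emeasure_weight_measure[OF assms(1) A]
    using weight_pos[OF assms(1)] by (intro nn_integral_cong) (auto simp: indicator_def less_imp_le)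
  finally show ?thesis .
qed

text \<open>\<open>measure\<close> sends an infinite value to 0, so monotonicity may fail for large
  sets; \<open>wmeas_mono\<close> therefore confines its sets to a cube, where local integrability
  gives finiteness.\<close>

abbreviation wmeas :: "(real ^ 'd \<Rightarrow> real) \<Rightarrow> (real ^ 'd) set \<Rightarrow> real" where
  "wmeas w \<equiv> measure (weight_measure w)"

lemma emeasure_weight_cube:
  "weight w \<Longrightarrow> emeasure (weight_measure w) (cube c h) = ennreal (wmeas w (cube c h))"
  using emeasure_weight_compact[of w "cube c h"] by (simp add: emeasure_eq_ennreal_measure top.not_eq_extremum)

lemma emeasure_weight_subset_cube:
  assumes "weight w" "A \<subseteq> cube c h" 
  shows "emeasure (weight_measure w) A = ennreal (wmeas w A)"
proof -
  have "emeasure (weight_measure w) A \<le> emeasure (weight_measure w) (cube c h)"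
    using assms by (intro emeasure_mono) auto
  then show ?thesis using emeasure_weight_compact[OF assms(1), of "cube c h"]
    by (intro emeasure_eq_ennreal_measure) (auto simp: top_unique)
qed

lemma cube_fmeasurable [simp]: "weight w \<Longrightarrow> cube c h \<in> fmeasurable (weight_measure w)"
  by (intro fmeasurableI) (auto simp: emeasure_weight_cube)

text \<open>Strict positivity of the density makes the null sets agree in both directions. This is
  also why cubes have positive weighted measure.\<close>

lemma AE_weight_measure:
  assumes "weight w"
  shows "(AE x in weight_measure w. P x) \<longleftrightarrow> (AE x in lebesgue. P x)"
  unfolding weight_measure_def using weight_measurable[OF assms] weight_pos[OF assms]
  by (subst AE_density) auto

lemma wmeas_cube_pos:
  assumes "weight w" "0 < h"
  shows "0 < wmeas w (cube c h)"
proof (rule ccontr)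
  assume "\<not> ?thesis"
  then have "emeasure (weight_measure w) (cube c h) = 0"
    using emeasure_weight_cube[OF assms(1), of c h] by (simp add: not_less ennreal_neg)
  then have "AE x in weight_measure w. x \<notin> cube c h"
    by (intro AE_I[of _ _ "cube c h"]) auto
  then have "AE x in lebesgue. x \<notin> cube c h" using AE_weight_measure[OF assms(1)] by simp
  then have "emeasure lebesgue (cube c h) = 0"
    by (subst (asm) AE_iff_measurable[of "cube c h"]) auto
  then show False using assms emeasure_lebesgue_cube[of h c] by simp
qed

lemma wmeas_mono: "\<lbrakk>weight w; A \<subseteq> B; A \<in> sets lebesgue; B \<subseteq> cube c h; B \<in> sets lebesgue\<rbrakk> \<Longrightarrow> wmeas w A \<le> wmeas w B"
  using emeasure_weight_subset_cube[of w B c h]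
  by (intro measure_mono_fmeasurable) (auto intro!: fmeasurableI)

lemma doubling_wmeas:
  assumes "doubling_with D w" "weight w" "0 < h"
  shows "wmeas w (cube c (2 * h)) \<le> D * wmeas w (cube c h)" "1 \<le> D"
proof -
  have *: "ennreal (wmeas w (cube c (2 * h))) \<le> ennreal D * ennreal (wmeas w (cube c h))"
    using assms by (auto simp: doubling_with_def emeasure_weight_cube[symmetric])
  have pos: "0 < wmeas w (cube c h)" using assms by (simp add: wmeas_cube_pos)
  have "0 < wmeas w (cube c (2 * h))" using assms by (simp add: wmeas_cube_pos)
  \<comment> \<open>\<open>ennreal D\<close> is 0 for \<open>D <= 0\<close>, contradicting the
    positive measure of the larger cube. Only now may the inequality be read in the reals.\<close>
  then have "0 < D" using * by (cases "0 < D") (auto simp: not_less ennreal_neg)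
  then show 1: "wmeas w (cube c (2 * h)) \<le> D * wmeas w (cube c h)"
    using * by (simp add: ennreal_mult[symmetric])
  have "wmeas w (cube c h) \<le> wmeas w (cube c (2 * h))"
    using assms by (intro wmeas_mono[of _ _ _ c "2 * h"] cube_mono) auto
  then have "1 * wmeas w (cube c h) \<le> D * wmeas w (cube c h)" using 1 by simp
  then show "1 \<le> D" using pos by (simp only: mult_le_cancel_right_pos)
qed

lemma doubling_wmeas_power:
  assumes "doubling_with D w" "weight w" "0 < h"
  shows "wmeas w (cube c (2 ^ m * h)) \<le> D ^ m * wmeas w (cube c h)"
proof (induction m)
  case (Suc m)
  have "wmeas w (cube c (2 ^ Suc m * h)) \<le> D * wmeas w (cube c (2 ^ m * h))"
    using doubling_wmeas(1)[OF assms(1,2), of "2 ^ m * h" c] assms(3) by (simp add: mult.assoc)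
  also have "\<dots> \<le> D * (D ^ m * wmeas w (cube c h))"
    using Suc doubling_wmeas(2)[OF assms] by (intro mult_left_mono) auto
  finally show ?case by (simp add: mult.assoc)
qed simp

subsection \<open>Vitali covering for finitely many cubes\<close>

text \<open>Greedy selection: a set of maximal size is kept, all sets meeting it are charged to it
  and discarded, and induction treats the rest. The size function is unrelated to the sets here;
  geometry enters only for cubes.\<close>

lemma finite_Vitali:
  fixes A :: "'i \<Rightarrow> 'a set" and h :: "'i \<Rightarrow> real"
  assumes "finite S" "\<And>i. i \<in> S \<Longrightarrow> A i \<noteq> {}"
  shows "\<exists>J\<subseteq>S. disjoint_family_on A J \<and> (\<forall>i\<in>S. \<exists>j\<in>J. A i \<inter> A j \<noteq> {} \<and> h i \<le> h j)"
  using assms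
proof (induction S rule: finite_psubset_induct)
  case (psubset S)
  show ?case
  proof (cases "S = {}")
    case True then show ?thesis by (auto simp: disjoint_family_on_def)
  next
    case False
    then obtain m where m: "m \<in> S" "\<And>i. i \<in> S \<Longrightarrow> h i \<le> h m"
      using obtains_MAX[OF psubset.hyps, of h] psubset.hyps by (metis Max_ge finite_imageI imageI)
    define S' where "S' = {i\<in>S. A i \<inter> A m = {}}"
    \<comment> \<open>Nonemptiness makes \<open>A m\<close> meet itself, so \<open>m\<close> drops
      out and the induction applies.\<close>
    have "S' \<subset> S" using m psubset.prems[of m] by (auto simp: S'_def)
    then obtain J where J: "J \<subseteq> S'" "disjoint_family_on A J"
        "\<forall>i\<in>S'. \<exists>j\<in>J. A i \<inter> A j \<noteq> {} \<and> h i \<le> h j"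
      using psubset.IH[of S'] psubset.prems by blast
    have "disjoint_family_on A (insert m J)"
      using J(1,2) by (auto simp: disjoint_family_on_def S'_def)
    moreover have "\<exists>j\<in>insert m J. A i \<inter> A j \<noteq> {} \<and> h i \<le> h j" if "i \<in> S" for i
      using J(3) m(2)[OF that] that by (cases "i \<in> S'") (auto simp: S'_def)
    moreover have "insert m J \<subseteq> S" using J(1) m by (auto simp: S'_def)
    ultimately show ?thesis by blast
  qed
qed

subsection \<open>Sparse subfamilies\<close>

text \<open>Families are made of pairs (centre, half side) rather than of sets, so that every member
  can be dilated about its centre.\<close>

abbreviation dcube :: "real \<Rightarrow> (real ^ 'd) \<times> real \<Rightarrow> (real ^ 'd) set" where
  "dcube N i \<equiv> cube (fst i) (N * snd i)"

lemma Vitali_cubes: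
  fixes S :: "((real ^ 'd) \<times> real) set"
  assumes "finite S" "\<And>i. i \<in> S \<Longrightarrow> 0 < snd i" "0 < N"
  obtains J where "J \<subseteq> S" "disjoint_family_on (dcube N) J"
    "\<And>i. i \<in> S \<Longrightarrow> \<exists>j\<in>J. dcube N i \<subseteq> dcube (4 * N) j"
proof -
  have "dcube N i \<noteq> {}" if "i \<in> S" for i
    using center_in_cube[of "N * snd i" "fst i"] assms(2)[OF that] assms(3) by auto
  then obtain J where J: "J \<subseteq> S" "disjoint_family_on (dcube N) J"
      "\<forall>i\<in>S. \<exists>j\<in>J. dcube N i \<inter> dcube N j \<noteq> {} \<and> N * snd i \<le> N * snd j"
    using finite_Vitali[OF assms(1), of "dcube N" "\<lambda>i. N * snd i"] by auto
  show thesis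
  proof
    fix i assume "i \<in> S"
    then obtain j where j: "j \<in> J" "dcube N i \<inter> dcube N j \<noteq> {}" "N * snd i \<le> N * snd j"
      using J(3) by blast
    then have "dcube N i \<subseteq> dcube (4 * N) j"
      using cube_subset_if_meets[OF j(2,3)] by (simp add: mult.assoc)
    then show "\<exists>j\<in>J. dcube N i \<subseteq> dcube (4 * N) j" using j(1) by blast
  qed (use J in auto)
qed

lemma step_between_levels:
  fixes t :: "nat \<Rightarrow> real"
  assumes "t 0 < u" "u \<le> t n"
  shows "\<exists>k<n. t k < u \<and> u \<le> t (Suc k)"
  using assms(2)
proof (induction n)
  case 0
  then show ?case using assms(1) by simp
next
  case (Suc n)
  then show ?case by (cases "u \<le> t n") (auto simp: less_Suc_eq)
qed

lemma geometric_levels: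
  fixes X :: "real set"
  assumes "finite X" "1 < L"
  obtains \<epsilon> n where "0 < \<epsilon>" "\<And>u. \<lbrakk>u \<in> X; 0 < u\<rbrakk> \<Longrightarrow> \<exists>k<n. \<epsilon> * L ^ k < u \<and> u \<le> \<epsilon> * L ^ Suc k"
    "\<And>u. u \<in> X \<Longrightarrow> u \<le> \<epsilon> * L ^ n"
proof -
  \<comment> \<open>Inserting 1 keeps the minimum defined when no value is positive. Halving makes
    the lowest level lie strictly below every positive value, as the half-open levels
    require.\<close>
  define \<epsilon> where "\<epsilon> = Min (insert 1 {u\<in>X. 0 < u}) / 2"
  have fin: "finite (insert 1 {u\<in>X. 0 < u})" using assms by simp
  have "0 < Min (insert 1 {u\<in>X. 0 < u})" using fin by (subst Min_gr_iff) auto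
  then have eps: "0 < \<epsilon>" by (simp add: \<epsilon>_def)
  have low: "\<epsilon> < u" if "u \<in> X" "0 < u" for u
  proof -
    have "Min (insert 1 {u\<in>X. 0 < u}) \<le> u" using that fin by (intro Min_le) auto
    then show ?thesis using eps by (simp add: \<epsilon>_def)
  qed
  obtain n where n: "Max (insert 1 X) / \<epsilon> < L ^ n" using real_arch_pow[OF assms(2)] by blast
  have up: "u \<le> \<epsilon> * L ^ n" if "u \<in> X" for u
  proof -
    have "u \<le> Max (insert 1 X)" using that assms by (intro Max_ge) auto
    also have "\<dots> \<le> \<epsilon> * L ^ n" using n eps by (simp add: field_simps)
    finally show ?thesis .
  qed
  show thesis
  proof (rule that[OF eps])
    fix u assume "u \<in> X" "0 < u"
    then show "\<exists>k<n. \<epsilon> * L ^ k < u \<and> u \<le> \<epsilon> * L ^ Suc k"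
      using step_between_levels[of "\<lambda>k. \<epsilon> * L ^ k" u n] low up by auto
  qed (rule up)
qed

lemma wmeas_UN_le:
  assumes "weight w" "finite J"
  shows "wmeas w (\<Union>j\<in>J. cube (c j) (h j)) \<le> (\<Sum>j\<in>J. wmeas w (cube (c j) (h j)))"
  using assms by (intro measure_UNION_le) auto

text \<open>
  The values are grouped into geometric levels \<open>t\<^sub>k\<close>. A Vitali cube of level \<open>k\<close> is kept if the next
  level set covers at most half of it; the rest of it is then disjoint from everything selected later.
  The ratio \<open>4 D\<^sup>2\<close> of the levels lets the discarded cubes be absorbed.
\<close>

lemma sparse_selection:
  fixes F :: "((real ^ 'd) \<times> real) set" and u :: "(real ^ 'd) \<times> real \<Rightarrow> real"
  assumes w: "weight w" and D: "doubling_with D w"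
    and F: "finite F" "\<And>i. i \<in> F \<Longrightarrow> 0 < snd i" "\<And>i. i \<in> F \<Longrightarrow> 0 \<le> u i"
  obtains S E where "S \<subseteq> F" "disjoint_family_on E S"
    "\<And>i. i \<in> S \<Longrightarrow> E i \<in> sets lebesgue \<and> E i \<subseteq> dcube 1 i \<and> wmeas w (dcube 1 i) \<le> 2 * wmeas w (E i)"
    "(\<integral>\<^sup>+x. (SUP i\<in>F. ennreal (u i) * indicator (dcube 1 i) x) \<partial>weight_measure w)
       \<le> ennreal (8 * D ^ 4 * (\<Sum>i\<in>S. u i * wmeas w (dcube 1 i)))"
proof -
  have D1: "1 \<le> D" using doubling_wmeas(2)[OF D w, of 1] by simp
  define L where "L = 4 * D\<^sup>2"
  have "1 \<le> D\<^sup>2" using D1 by simp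
  then have L: "1 < L" unfolding L_def by linarith
  obtain \<epsilon> n where eps: "0 < \<epsilon>" and
    lev: "\<And>v. \<lbrakk>v \<in> u ` F; 0 < v\<rbrakk> \<Longrightarrow> \<exists>k<n. \<epsilon> * L ^ k < v \<and> v \<le> \<epsilon> * L ^ Suc k" and
    top: "\<And>v. v \<in> u ` F \<Longrightarrow> v \<le> \<epsilon> * L ^ n"
    using geometric_levels[of "u ` F", OF _ L] F(1) by blast
  define t where "t k = \<epsilon> * L ^ k" for k
  have tpos: "0 < t k" for k using eps L by (simp add: t_def)
  have tmono: "t k \<le> t l" if "k \<le> l" for k l
    using eps L that by (simp add: t_def power_increasing)
  have tSuc: "t (Suc k) = L * t k" for k by (simp add: t_def)
  define Fk where "Fk k = {i\<in>F. t k < u i}" for k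
  define G where "G k = (\<Union>i\<in>Fk k. dcube 1 i)" for k
  have finFk: "finite (Fk k)" for k using F by (simp add: Fk_def)
  have Gsets: "G k \<in> sets lebesgue" for k unfolding G_def using finFk by (intro sets.finite_UN) auto
  have Gfm: "G k \<in> fmeasurable (weight_measure w)" for k unfolding G_def using finFk w
    by (intro fmeasurable.finite_UN) auto
  have Gmono: "G l \<subseteq> G k" if "k \<le> l" for k l
    using tmono[OF that] by (force simp: G_def Fk_def)
  \<comment> \<open>No value exceeds \<open>t n\<close>. This stops the recursion on the level sets:
    the last term disappears in \<open>shift\<close>.\<close>
  have Gn: "G n = {}" using top by (fastforce simp: G_def Fk_def t_def)
  have "\<forall>k. \<exists>J. J \<subseteq> Fk k \<and> disjoint_family_on (dcube 1) J \<and> (\<forall>i\<in>Fk k. \<exists>j\<in>J. dcube 1 i \<subseteq> dcube 4 j)"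
  proof
    fix k
    have pos: "\<And>i. i \<in> Fk k \<Longrightarrow> 0 < snd i" using F(2) by (auto simp: Fk_def)
    show "\<exists>J. J \<subseteq> Fk k \<and> disjoint_family_on (dcube 1) J \<and> (\<forall>i\<in>Fk k. \<exists>j\<in>J. dcube 1 i \<subseteq> dcube 4 j)"
    proof (rule Vitali_cubes[OF finFk[of k] pos zero_less_one])
      fix J assume "J \<subseteq> Fk k" "disjoint_family_on (dcube 1) J"
        "\<And>i. i \<in> Fk k \<Longrightarrow> \<exists>j\<in>J. dcube 1 i \<subseteq> dcube (4 * 1) j"
      then show ?thesis by (intro exI[of _ J]) simp
    qed
  qed
  from choice[OF this] obtain V where
    V': "\<forall>k. V k \<subseteq> Fk k \<and> disjoint_family_on (dcube 1) (V k) \<and> (\<forall>i\<in>Fk k. \<exists>j\<in>V k. dcube 1 i \<subseteq> dcube 4 j)" ..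
  then have V: "\<And>k. V k \<subseteq> Fk k" "\<And>k. disjoint_family_on (dcube 1) (V k)"
      "\<And>k i. i \<in> Fk k \<Longrightarrow> \<exists>j\<in>V k. dcube 1 i \<subseteq> dcube 4 j"
    by auto
  have finV: "finite (V k)" for k using V(1) finFk finite_subset by blast
  define good where "good k = {i\<in>V k. 2 * wmeas w (dcube 1 i \<inter> G (Suc k)) \<le> wmeas w (dcube 1 i)}" for k
  have good: "i \<in> F" "t k < u i" "i \<in> V k" "0 < wmeas w (dcube 1 i)" if "i \<in> good k" for i k
  proof -
    show *: "i \<in> F" "t k < u i" "i \<in> V k" using that V(1)[of k] by (auto simp: good_def Fk_def)
    show "0 < wmeas w (dcube 1 i)" using wmeas_cube_pos[OF w F(2)[OF *(1)]] by simp
  qed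
  \<comment> \<open>If the value also exceeded the next level, the whole cube would lie in
    \<open>G (Suc k)\<close> and goodness would force its measure to be 0. So each selected cube has
    one level and is counted once in \<open>goodsum\<close>.\<close>
  have level_unique: "\<not> k < l" if "i \<in> good k" "i \<in> good l" for i k l
  proof
    assume "k < l"
    then have "t (Suc k) < u i" using tmono[of "Suc k" l] good(2)[OF that(2)] by simp
    then have "dcube 1 i \<subseteq> G (Suc k)" using good(1)[OF that(1)] by (auto simp: G_def Fk_def)
    then have "dcube 1 i \<inter> G (Suc k) = dcube 1 i" by blast
    then show False using that(1) good(4)[OF that(1)] by (simp add: good_def)
  qed
  define S where "S = (\<Union>k<n. good k)"
  have "\<forall>i\<in>S. \<exists>k. i \<in> good k" by (auto simp: S_def)
  then obtain \<kappa> where \<kappa>: "\<And>i. i \<in> S \<Longrightarrow> i \<in> good (\<kappa> i)" by metis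
  define E where "E i = dcube 1 i - G (Suc (\<kappa> i))" for i
  have subGk: "dcube 1 i \<subseteq> G k" if "i \<in> good k" for i k
    using good(1,2)[OF that] by (auto simp: G_def Fk_def)
  have SF: "S \<subseteq> F" using good(1) by (auto simp: S_def)
  have disj: "disjoint_family_on E S"
    unfolding disjoint_family_on_def
  proof (intro ballI impI)
    fix i j assume ij: "i \<in> S" "j \<in> S" "i \<noteq> j"
    have gt: "E a \<inter> E b = {}" if "a \<in> S" "b \<in> S" "\<kappa> a < \<kappa> b" for a b
      using subGk[OF \<kappa>[OF that(2)]] Gmono[of "Suc (\<kappa> a)" "\<kappa> b"] that(3) by (auto simp: E_def)
    consider "\<kappa> i < \<kappa> j" | "\<kappa> j < \<kappa> i" | "\<kappa> i = \<kappa> j" by linarith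
    then show "E i \<inter> E j = {}"
    proof cases
      case 3
      then have "i \<in> V (\<kappa> i)" "j \<in> V (\<kappa> i)" using good(3) \<kappa> ij by metis+
      then have "dcube 1 i \<inter> dcube 1 j = {}" using V(2)[of "\<kappa> i"] ij(3) unfolding disjoint_family_on_def by blast
      then show ?thesis by (auto simp: E_def)
    qed (use gt ij in blast)+
  qed
  have Eprop: "E i \<in> sets lebesgue \<and> E i \<subseteq> dcube 1 i \<and> wmeas w (dcube 1 i) \<le> 2 * wmeas w (E i)" if "i \<in> S" for i
  proof -
    have "wmeas w (E i) = wmeas w (dcube 1 i) - wmeas w (dcube 1 i \<inter> G (Suc (\<kappa> i)))"
      using measure_Diff[of "weight_measure w" "dcube 1 i" "dcube 1 i \<inter> G (Suc (\<kappa> i))"] w Gsets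
      by (simp add: E_def emeasure_weight_cube Diff_Int)
    moreover have "2 * wmeas w (dcube 1 i \<inter> G (Suc (\<kappa> i))) \<le> wmeas w (dcube 1 i)"
      using \<kappa>[OF that] by (simp add: good_def)
    ultimately show ?thesis using Gsets by (auto simp: E_def)
  qed
  define A where "A k = wmeas w (G k)" for k
  have Anonneg: "0 \<le> A k" for k by (simp add: A_def)
  have doub4: "wmeas w (dcube 4 j) \<le> D\<^sup>2 * wmeas w (dcube 1 j)" if "j \<in> F" for j
    using doubling_wmeas_power[OF D w F(2)[OF that], of "fst j" 2] by simp
  \<comment> \<open>The Vitali cubes of level \<open>k\<close>, enlarged four times, cover
    \<open>G k\<close>. Those not kept have more than half of their mass in
    \<open>G (Suc k)\<close>, and being disjoint they contribute at most
    \<open>2 * A (Suc k)\<close>.\<close>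
  have Ak: "A k \<le> D\<^sup>2 * (\<Sum>i\<in>good k. wmeas w (dcube 1 i)) + 2 * D\<^sup>2 * A (Suc k)" for k
  proof -
    have "A k \<le> wmeas w (\<Union>j\<in>V k. dcube 4 j)"
      unfolding A_def using V(3)[of _ k] w finV Gsets
      by (intro measure_mono_fmeasurable fmeasurable.finite_UN) (auto simp: G_def, blast)
    also have "\<dots> \<le> (\<Sum>j\<in>V k. wmeas w (dcube 4 j))" using w finV by (intro wmeas_UN_le) auto
    also have "\<dots> \<le> (\<Sum>j\<in>V k. D\<^sup>2 * wmeas w (dcube 1 j))"
      using doub4 V(1)[of k] by (intro sum_mono) (auto simp: Fk_def)
    also have "\<dots> = D\<^sup>2 * ((\<Sum>j\<in>good k. wmeas w (dcube 1 j)) + (\<Sum>j\<in>V k - good k. wmeas w (dcube 1 j)))"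
      using finV[of k] by (subst sum.subset_diff[of "good k"]) (auto simp: good_def sum_distrib_left algebra_simps)
    also have "(\<Sum>j\<in>V k - good k. wmeas w (dcube 1 j)) \<le> (\<Sum>j\<in>V k - good k. 2 * wmeas w (dcube 1 j \<inter> G (Suc k)))"
      by (intro sum_mono) (auto simp: good_def)
    also have "\<dots> \<le> 2 * A (Suc k)"
    proof -
      have "(\<Sum>j\<in>V k - good k. wmeas w (dcube 1 j \<inter> G (Suc k))) = wmeas w (\<Union>j\<in>V k - good k. dcube 1 j \<inter> G (Suc k))"
      proof (rule measure_finite_Union[symmetric])
        show "disjoint_family_on (\<lambda>j. dcube 1 j \<inter> G (Suc k)) (V k - good k)"
          using V(2)[of k] unfolding disjoint_family_on_def by blast
        show "emeasure (weight_measure w) (dcube 1 j \<inter> G (Suc k)) \<noteq> \<infinity>" for j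
          using emeasure_weight_subset_cube[OF w Int_lower1[of "dcube 1 j" "G (Suc k)"]] by simp
      qed (use finV[of k] Gsets in auto)
      also have "\<dots> \<le> A (Suc k)"
        unfolding A_def using finV[of k] Gsets Gfm by (intro measure_mono_fmeasurable sets.finite_UN) auto
      finally show ?thesis by (simp add: sum_distrib_left[symmetric])
    qed
    finally show ?thesis using D1 by (simp add: algebra_simps)
  qed
  define T where "T = (\<Sum>k<n. t k * A k)"
  have shift: "(\<Sum>k<n. t (Suc k) * A (Suc k)) \<le> T"
  proof -
    have "(\<Sum>k<n. t (Suc k) * A (Suc k)) + t 0 * A 0 = (\<Sum>k<Suc n. t k * A k)"
      by (subst sum.lessThan_Suc_shift) simp
    also have "\<dots> = T" by (simp add: T_def A_def Gn)
    finally show ?thesis using tpos[of 0] Anonneg[of 0] by (smt (verit) mult_nonneg_nonneg)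
  qed
  have goodsum: "(\<Sum>k<n. t k * (\<Sum>i\<in>good k. wmeas w (dcube 1 i))) \<le> (\<Sum>i\<in>S. u i * wmeas w (dcube 1 i))"
  proof -
    have "(\<Sum>k<n. t k * (\<Sum>i\<in>good k. wmeas w (dcube 1 i))) \<le> (\<Sum>k<n. \<Sum>i\<in>good k. u i * wmeas w (dcube 1 i))"
      unfolding sum_distrib_left
      using good(2) by (intro sum_mono mult_right_mono) (auto intro: less_imp_le)
    also have "\<dots> = (\<Sum>i\<in>S. u i * wmeas w (dcube 1 i))"
      unfolding S_def using finV level_unique
      by (intro sum.UNION_disjoint[symmetric]) (auto simp: good_def, (metis linorder_neqE_nat)?)
    finally show ?thesis .
  qed
  have "T \<le> (\<Sum>k<n. t k * (D\<^sup>2 * (\<Sum>i\<in>good k. wmeas w (dcube 1 i)) + 2 * D\<^sup>2 * A (Suc k)))"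
    unfolding T_def using Ak tpos by (intro sum_mono mult_left_mono) (auto intro: less_imp_le)
  \<comment> \<open>With \<open>L = 4 * D\<^sup>2\<close> the error
    \<open>t k * 2 * D\<^sup>2 * A (Suc k)\<close> is half of \<open>t (Suc k) * A (Suc k)\<close>.
    Summed over the levels it is at most \<open>T / 2\<close> and is absorbed, \<open>T\<close>
    being a finite real.\<close>
  also have "\<dots> = D\<^sup>2 * (\<Sum>k<n. t k * (\<Sum>i\<in>good k. wmeas w (dcube 1 i))) + (\<Sum>k<n. t (Suc k) * A (Suc k)) / 2"
    by (simp add: sum_distrib_left sum_divide_distrib sum.distrib[symmetric] tSuc L_def algebra_simps)
  also have "\<dots> \<le> D\<^sup>2 * (\<Sum>i\<in>S. u i * wmeas w (dcube 1 i)) + T / 2"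
    using goodsum shift D1 by (intro add_mono mult_left_mono) auto
  finally have T: "T \<le> 2 * D\<^sup>2 * (\<Sum>i\<in>S. u i * wmeas w (dcube 1 i))" by simp
  \<comment> \<open>Each value is replaced by the upper end of its level, which costs one factor
    \<open>L\<close>. Together with the \<open>2 * D\<^sup>2\<close> in the bound for
    \<open>T\<close> this gives the constant \<open>8 * D ^ 4\<close>.\<close>
  have "(\<integral>\<^sup>+x. (SUP i\<in>F. ennreal (u i) * indicator (dcube 1 i) x) \<partial>weight_measure w)
      \<le> (\<integral>\<^sup>+x. (\<Sum>k<n. ennreal (t (Suc k)) * indicator (G k) x) \<partial>weight_measure w)"
  proof (intro nn_integral_mono SUP_least)
    fix x i assume i: "i \<in> F"
    show "ennreal (u i) * indicator (dcube 1 i) x \<le> (\<Sum>k<n. ennreal (t (Suc k)) * indicator (G k) x)"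
    proof (cases "0 < u i \<and> x \<in> dcube 1 i")
      case True
      then obtain k where k: "k < n" "t k < u i" "u i \<le> t (Suc k)"
        using lev[of "u i"] i unfolding t_def by auto
      then have "x \<in> G k" using i True unfolding G_def Fk_def by blast
      then have "ennreal (u i) * indicator (dcube 1 i) x \<le> ennreal (t (Suc k)) * indicator (G k) x"
        using k True by (simp add: ennreal_leI)
      also have "\<dots> \<le> (\<Sum>k<n. ennreal (t (Suc k)) * indicator (G k) x)"
        using k by (intro member_le_sum) auto
      finally show ?thesis .
    qed (use F(3)[OF i] in \<open>auto simp: not_less\<close>)
  qed
  also have "\<dots> = (\<Sum>k<n. ennreal (t (Suc k)) * emeasure (weight_measure w) (G k))"
    using Gsets by (subst nn_integral_sum) (auto intro!: sum.cong nn_integral_cmult_indicator)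
  also have "\<dots> = (\<Sum>k<n. ennreal (t (Suc k) * A k))"
    using Gfm tpos by (intro sum.cong) (auto simp: A_def emeasure_eq_measure2 ennreal_mult less_imp_le)
  also have "\<dots> = ennreal (L * T)"
    using tpos Anonneg by (subst sum_ennreal) (auto simp: T_def tSuc[symmetric] sum_distrib_left mult.assoc[symmetric] less_imp_le)
  also have "\<dots> \<le> ennreal (8 * D ^ 4 * (\<Sum>i\<in>S. u i * wmeas w (dcube 1 i)))"
  proof (rule ennreal_leI)
    have "L * T \<le> L * (2 * D\<^sup>2 * (\<Sum>i\<in>S. u i * wmeas w (dcube 1 i)))"
      using T L by (intro mult_left_mono) auto
    also have "\<dots> = 8 * D ^ 4 * (\<Sum>i\<in>S. u i * wmeas w (dcube 1 i))"
      by (simp add: L_def power4_eq_xxxx power2_eq_square)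
    finally show "L * T \<le> 8 * D ^ 4 * (\<Sum>i\<in>S. u i * wmeas w (dcube 1 i))" .
  qed
  finally show thesis using that[OF SF disj Eprop] by blast
qed

subsection \<open>Carleson embedding\<close>

text \<open>Sparseness is measured by a weight; it is used with \<nu>, the reference weight of the
  A_infinity constants. Finiteness is built in so that all later sums are real numbers.\<close>

definition sparse :: "(real ^ 'd \<Rightarrow> real) \<Rightarrow> ((real ^ 'd) \<times> real) set \<Rightarrow> bool" where
  "sparse w S \<longleftrightarrow> finite S \<and> (\<forall>i\<in>S. 0 < snd i) \<and> (\<exists>E. disjoint_family_on E S \<and>
     (\<forall>i\<in>S. E i \<in> sets lebesgue \<and> E i \<subseteq> dcube 1 i \<and> wmeas w (dcube 1 i) \<le> 2 * wmeas w (E i)))"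

lemma sparse_finite: "sparse w S \<Longrightarrow> finite S"
  by (simp add: sparse_def)

lemma sparse_pos: "\<lbrakk>sparse w S; i \<in> S\<rbrakk> \<Longrightarrow> 0 < snd i"
  by (simp add: sparse_def)

lemma sparse_subset: "\<lbrakk>sparse w S; S' \<subseteq> S\<rbrakk> \<Longrightarrow> sparse w S'"
  unfolding sparse_def by (meson disjoint_family_on_mono finite_subset subsetD)

text \<open>On the part \<open>E i\<close> the maximal function inside \<open>A_inf_const\<close>,
  localised to the big cube, is at least \<mu>(Q_i)/\<nu>(Q_i), because Q_i itself is one of the
  competing cubes. Integrating over the disjoint \<open>E i\<close>, each with at least half of
  \<nu>(Q_i), bounds the packing sum; that half is the factor 2.\<close>

lemma Carleson_condition:
  fixes \<mu> \<nu> :: "real ^ 'd \<Rightarrow> real"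
  assumes mu: "weight \<mu>" and nu: "weight \<nu>" and S: "sparse \<nu> S"
    and A: "A_inf_const \<mu> \<nu> \<le> ennreal A" "0 \<le> A"
    and h: "0 < h" and sub: "\<And>i. i \<in> S \<Longrightarrow> dcube 1 i \<subseteq> cube c h"
  shows "(\<Sum>i\<in>S. wmeas \<mu> (dcube 1 i)) \<le> 2 * A * wmeas \<mu> (cube c h)"
proof -
  define R where "R = cube c h"
  obtain E where E: "disjoint_family_on E S" "\<And>i. i \<in> S \<Longrightarrow> E i \<in> sets lebesgue"
      "\<And>i. i \<in> S \<Longrightarrow> E i \<subseteq> dcube 1 i" "\<And>i. i \<in> S \<Longrightarrow> wmeas \<nu> (dcube 1 i) \<le> 2 * wmeas \<nu> (E i)"
    using S unfolding sparse_def by blast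
  have fin: "finite S" and pos: "\<And>i. i \<in> S \<Longrightarrow> 0 < snd i"
    using S by (auto simp: sparse_def)
  have nupos: "0 < wmeas \<nu> (dcube 1 i)" if "i \<in> S" for i using pos[OF that] nu by (simp add: wmeas_cube_pos)
  define \<rho> where "\<rho> i = wmeas \<mu> (dcube 1 i) / wmeas \<nu> (dcube 1 i)" for i
  have rho0: "0 \<le> \<rho> i" for i by (simp add: \<rho>_def)
  define M where "M x = (SUP Q\<in>{Q \<in> cubes. x \<in> Q}.
             emeasure (weight_measure \<mu>) (R \<inter> Q) / emeasure (weight_measure \<nu>) Q)" for x
  have Rpos: "0 < wmeas \<mu> R" using mu h by (simp add: R_def wmeas_cube_pos)
  have pw: "(\<Sum>i\<in>S. ennreal (\<rho> i) * indicator (E i) x) \<le> M x * indicator R x" for x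
  proof (cases "\<exists>i\<in>S. x \<in> E i")
    case True
    then obtain i where i: "i \<in> S" "x \<in> E i" by blast
    have "(\<Sum>j\<in>S. ennreal (\<rho> j) * indicator (E j) x) = (\<Sum>j\<in>S. if j = i then ennreal (\<rho> i) else 0)"
      using E(1) i unfolding disjoint_family_on_def by (intro sum.cong) (auto simp: indicator_def)
    also have "\<dots> = ennreal (\<rho> i)" using i fin by simp
    also have "\<dots> = emeasure (weight_measure \<mu>) (dcube 1 i) / emeasure (weight_measure \<nu>) (dcube 1 i)"
      using mu nu nupos[OF i(1)] by (simp add: emeasure_weight_cube \<rho>_def divide_ennreal)
    \<comment> \<open>The rewriting changes numerator and denominator alike; the denominator is
      restored by the same identity at the end of the next step.\<close>
    also have "dcube 1 i = R \<inter> dcube 1 i" using sub[OF i(1)] by (auto simp: R_def)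
    also have "emeasure (weight_measure \<mu>) (R \<inter> dcube 1 i) / emeasure (weight_measure \<nu>) (R \<inter> dcube 1 i)
        \<le> M x"
      unfolding M_def
    proof (rule SUP_upper2[of "dcube 1 i"])
      show "dcube 1 i \<in> {Q \<in> cubes. x \<in> Q}" 
        using E(3)[OF i(1)] i(2) pos[OF i(1)] unfolding cubes_def
        by (intro CollectI conjI exI[of _ "fst i"] exI[of _ "1 * snd i"]) auto
      have "R \<inter> dcube 1 i = dcube 1 i" using sub[OF i(1)] by (auto simp: R_def)
      then show "emeasure (weight_measure \<mu>) (R \<inter> dcube 1 i) / emeasure (weight_measure \<nu>) (R \<inter> dcube 1 i)
        \<le> emeasure (weight_measure \<mu>) (R \<inter> dcube 1 i) / emeasure (weight_measure \<nu>) (dcube 1 i)" by simp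
    qed
    finally have "(\<Sum>j\<in>S. ennreal (\<rho> j) * indicator (E j) x) \<le> M x" .
    moreover have "x \<in> R" using i(2) E(3)[OF i(1)] sub[OF i(1)] unfolding R_def by blast
    ultimately show ?thesis by simp
  next
    case False
    then have "(\<Sum>i\<in>S. ennreal (\<rho> i) * indicator (E i) x) = 0" by (intro sum.neutral) auto
    then show ?thesis by simp
  qed
  have emE: "emeasure (weight_measure \<nu>) (E i) = ennreal (wmeas \<nu> (E i))" if "i \<in> S" for i
    by (rule emeasure_weight_subset_cube[OF nu E(3)[OF that]])
  have "ennreal (\<Sum>i\<in>S. \<rho> i * wmeas \<nu> (E i)) = (\<Sum>i\<in>S. ennreal (\<rho> i) * emeasure (weight_measure \<nu>) (E i))"
    using rho0 by (subst sum_ennreal[symmetric]) (auto simp: emE ennreal_mult intro!: sum.cong)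
  also have "\<dots> = (\<integral>\<^sup>+x. (\<Sum>i\<in>S. ennreal (\<rho> i) * indicator (E i) x) \<partial>weight_measure \<nu>)"
    using E(2) by (subst nn_integral_sum) (auto intro!: sum.cong nn_integral_cmult_indicator[symmetric])
  also have "\<dots> \<le> (\<integral>\<^sup>+x\<in>R. M x \<partial>weight_measure \<nu>)" by (intro nn_integral_mono pw)
  finally have le: "ennreal (\<Sum>i\<in>S. \<rho> i * wmeas \<nu> (E i)) \<le> (\<integral>\<^sup>+x\<in>R. M x \<partial>weight_measure \<nu>)" .
  have "1 / emeasure (weight_measure \<mu>) R * (\<integral>\<^sup>+x\<in>R. M x \<partial>weight_measure \<nu>) \<le> A_inf_const \<mu> \<nu>"
    unfolding A_inf_const_def M_def using h by (intro SUP_upper) (auto simp: R_def cubes_def)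
  also have "\<dots> \<le> ennreal A" by (rule A)
  finally have "1 / emeasure (weight_measure \<mu>) R * ennreal (\<Sum>i\<in>S. \<rho> i * wmeas \<nu> (E i)) \<le> ennreal A"
    using mult_left_mono[OF le, of "1 / emeasure (weight_measure \<mu>) R"] order_trans by fastforce
  then have "ennreal (1 / wmeas \<mu> R * (\<Sum>i\<in>S. \<rho> i * wmeas \<nu> (E i))) \<le> ennreal A"
    using Rpos mu rho0 unfolding R_def
    by (subst ennreal_mult) (auto simp: emeasure_weight_cube divide_ennreal[symmetric] sum_nonneg)
  then have "1 / wmeas \<mu> R * (\<Sum>i\<in>S. \<rho> i * wmeas \<nu> (E i)) \<le> A"
    using A(2) by simp
  then have *: "(\<Sum>i\<in>S. \<rho> i * wmeas \<nu> (E i)) \<le> A * wmeas \<mu> R"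
    using Rpos by (simp add: field_simps)
  have "(\<Sum>i\<in>S. wmeas \<mu> (dcube 1 i)) = (\<Sum>i\<in>S. \<rho> i * wmeas \<nu> (dcube 1 i))"
    by (intro sum.cong refl) (use nupos in \<open>force simp: \<rho>_def\<close>)
  also have "\<dots> \<le> (\<Sum>i\<in>S. \<rho> i * (2 * wmeas \<nu> (E i)))"
    using rho0 E(4) by (intro sum_mono mult_left_mono) auto
  also have "\<dots> = 2 * (\<Sum>i\<in>S. \<rho> i * wmeas \<nu> (E i))" by (simp add: sum_distrib_left mult.left_commute)
  finally show ?thesis using * by (simp add: R_def)
qed

text \<open>A geometric series is dominated by its largest term, and that term lies below
  \<open>y powr a\<close>. The constant is the sum of the series with ratio
  \<open>2 powr (- a)\<close>.\<close>

lemma sum_levels_le: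
  fixes t :: "nat \<Rightarrow> real"
  assumes t: "\<And>k. 0 < t k" "\<And>k. t (Suc k) = 2 * t k" and a: "0 < a"
  shows "(\<Sum>k\<in>{k. k < n \<and> t k < y}. t k powr a) \<le> 2 powr a / (2 powr a - 1) * y powr a"
proof -
  have th: "1 < (2::real) powr a" using a by simp
  \<comment> \<open>Comparing with \<open>t n\<close>, one step beyond the last summand, gives a
    bound that reproduces itself: \<open>1 / (c - 1) + 1 = c / (c - 1)\<close> for
    \<open>c = 2 powr a\<close>.\<close>
  have geo: "(\<Sum>k<n. t k powr a) \<le> 1 / (2 powr a - 1) * t n powr a" for n
  proof (induction n)
    case 0 show ?case using th by simp
  next
    case (Suc n)
    have "(\<Sum>k<Suc n. t k powr a) \<le> (1 / (2 powr a - 1) + 1) * t n powr a"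
      using Suc by (simp add: algebra_simps)
    also have "1 / (2 powr a - 1) + 1 = 2 powr a / ((2::real) powr a - 1)"
    proof -
      have "1 / (c - 1) + 1 = c / (c - 1)" if "1 < c" for c :: real
        using that by (simp add: field_simps)
      from this[OF th] show ?thesis .
    qed
    also have "\<dots> * t n powr a = 1 / (2 powr a - 1) * t (Suc n) powr a"
      using t(1)[of n] by (simp add: t(2) powr_mult)
    finally show ?case .
  qed
  have tm: "t k \<le> t l" if "k \<le> l" for k l
    by (rule lift_Suc_mono_le[OF _ that]) (simp add: t(2) less_imp_le[OF t(1)])
  have nonneg: "0 \<le> 2 powr a / ((2::real) powr a - 1)"
    by (rule divide_nonneg_pos) (use th in linarith)+
  show ?thesis
  proof (induction n)
    case 0 show ?case using mult_nonneg_nonneg[OF nonneg, of "y powr a"] by simp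
  next
    case (Suc n)
    show ?case
    proof (cases "t n < y")
      case True
      then have "{k. k < Suc n \<and> t k < y} = {..<Suc n}" using tm by (force simp: less_Suc_eq_le)
      then have "(\<Sum>k\<in>{k. k < Suc n \<and> t k < y}. t k powr a) \<le> 1 / (2 powr a - 1) * t (Suc n) powr a"
        using geo[of "Suc n"] by simp
      also have "\<dots> = 2 powr a / (2 powr a - 1) * t n powr a"
        using t(1)[of n] by (simp add: t(2) powr_mult)
      also have "\<dots> \<le> 2 powr a / (2 powr a - 1) * y powr a"
        using True t(1)[of n] a nonneg by (intro mult_left_mono powr_mono2) simp_all
      finally show ?thesis .
    next
      case False
      then have "{k. k < Suc n \<and> t k < y} = {k. k < n \<and> t k < y}" by (auto simp: less_Suc_eq)
      then show ?thesis using Suc by simp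
    qed
  qed
qed

text \<open>Vitali selection among the dilated cubes leaves disjoint ones. The cubes charged to a
  selected one are packed by the Carleson condition into its fourfold enlargement, which doubling
  brings back at the cost \<open>D\<^sup>2\<close>. Keeping only the part of \<open>H\<close> above
  \<open>t / 2\<close> on the right is what later allows summation over all levels \<open>t\<close>,
  as in Marcinkiewicz interpolation.\<close>

lemma Carleson_weak_type:
  fixes \<mu> \<nu> :: "real ^ 'd \<Rightarrow> real"
  assumes mu: "weight \<mu>" and nu: "weight \<nu>" and S: "sparse \<nu> S"
    and A: "A_inf_const \<mu> \<nu> \<le> ennreal A" "0 \<le> A"
    and D: "doubling_with D \<mu>" and N: "1 \<le> N" and t: "0 < t"
    and H: "integrable (weight_measure \<mu>) H" "\<And>x. 0 \<le> H x"
    and big: "\<And>i. i \<in> S \<Longrightarrow> t * wmeas \<mu> (dcube N i) < (LINT x:dcube N i|weight_measure \<mu>. H x)"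
  shows "(\<Sum>i\<in>S. wmeas \<mu> (dcube 1 i)) \<le>
    4 * D\<^sup>2 * A / t * (LINT x|weight_measure \<mu>. H x * indicator {x. t < 2 * H x} x)"
proof -
  let ?M = "weight_measure \<mu>"
  define G where "G x = H x * indicator {x. t < 2 * H x} x" for x
  have fin: "finite S" and pos: "\<And>i. i \<in> S \<Longrightarrow> 0 < snd i" using S by (auto simp: sparse_def)
  have [measurable]: "H \<in> borel_measurable lebesgue" using borel_measurable_integrable[OF H(1)] by simp
  have Gint: "integrable ?M G"
    unfolding G_def by (rule Bochner_Integration.integrable_bound[OF H(1)]) (auto simp: indicator_def H(2))
  have G0: "0 \<le> G x" for x by (simp add: G_def H(2))
  have D1: "1 \<le> D" using doubling_wmeas(2)[OF D mu, of 1] by simp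
  have cube_int: "integrable ?M (\<lambda>x. c * indicator (cube a h) x)" for c h :: real and a
    using mu by (intro integrable_mult_right integrable_real_indicator) (auto simp: emeasure_weight_cube)
  \<comment> \<open>Where \<open>H <= t / 2\<close> it accounts for at most half of the average
    \<open>t\<close>, so the truncated function \<open>G\<close> still has average above
    \<open>t / 2\<close>.\<close>
  have one: "wmeas \<mu> (dcube N i) \<le> 2 / t * (LINT x:dcube N i|?M. G x)" if "i \<in> S" for i
  proof -
    have "(LINT x:dcube N i|?M. H x) \<le> (LINT x|?M. indicator (dcube N i) x * G x + t / 2 * indicator (dcube N i) x)"
      unfolding set_lebesgue_integral_def
    proof (rule integral_mono)
      show "integrable ?M (\<lambda>x. indicator (dcube N i) x *\<^sub>R H x)"
        by (rule integrable_mult_indicator[OF _ H(1)]) simp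
      show "integrable ?M (\<lambda>x. indicator (dcube N i) x * G x + t / 2 * indicator (dcube N i) x)"
        using integrable_mult_indicator[OF _ Gint, of "dcube N i"] cube_int[of "t / 2"]
        by (intro Bochner_Integration.integrable_add) simp_all
      show "indicator (dcube N i) x *\<^sub>R H x \<le> indicator (dcube N i) x * G x + t / 2 * indicator (dcube N i) x" for x
        using t by (auto simp: indicator_def G_def)
    qed
    also have "\<dots> = (LINT x:dcube N i|?M. G x) + t / 2 * wmeas \<mu> (dcube N i)"
      using integrable_mult_indicator[OF _ Gint, of "dcube N i"] cube_int[of "t / 2"] mu
      by (subst Bochner_Integration.integral_add) (simp_all add: set_lebesgue_integral_def)
    finally have "t * wmeas \<mu> (dcube N i) \<le> (LINT x:dcube N i|?M. G x) + t / 2 * wmeas \<mu> (dcube N i)"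
      using big[OF that] by linarith
    then show ?thesis using t by (simp add: field_simps)
  qed
  obtain J where J: "J \<subseteq> S" "disjoint_family_on (dcube N) J"
      "\<And>i. i \<in> S \<Longrightarrow> \<exists>j\<in>J. dcube N i \<subseteq> dcube (4 * N) j"
  proof (rule Vitali_cubes[OF fin pos])
    show "0 < N" using N by simp
  qed auto
  have finJ: "finite J" using J(1) fin finite_subset by blast
  have "(\<Sum>i\<in>S. wmeas \<mu> (dcube 1 i)) \<le> (\<Sum>i\<in>S. \<Sum>j\<in>J. if dcube N i \<subseteq> dcube (4 * N) j then wmeas \<mu> (dcube 1 i) else 0)"
  proof (rule sum_mono)
    fix i assume "i \<in> S"
    then obtain j where j: "j \<in> J" "dcube N i \<subseteq> dcube (4 * N) j" using J(3) by blast
    have "wmeas \<mu> (dcube 1 i) = (if dcube N i \<subseteq> dcube (4 * N) j then wmeas \<mu> (dcube 1 i) else 0)"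
      using j by simp
    also have "\<dots> \<le> (\<Sum>j\<in>J. if dcube N i \<subseteq> dcube (4 * N) j then wmeas \<mu> (dcube 1 i) else 0)"
      using finJ j by (intro member_le_sum) auto
    finally show "wmeas \<mu> (dcube 1 i) \<le> (\<Sum>j\<in>J. if dcube N i \<subseteq> dcube (4 * N) j then wmeas \<mu> (dcube 1 i) else 0)" .
  qed
  also have "\<dots> = (\<Sum>j\<in>J. \<Sum>i\<in>{i\<in>S. dcube N i \<subseteq> dcube (4 * N) j}. wmeas \<mu> (dcube 1 i))"
    by (subst sum.swap) (simp only: sum.inter_filter[OF fin])
  also have "\<dots> \<le> (\<Sum>j\<in>J. 2 * A * (D\<^sup>2 * wmeas \<mu> (dcube N j)))"
  proof (rule sum_mono)
    fix j assume "j \<in> J"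
    then have j: "0 < snd j" using J(1) pos by blast
    have "(\<Sum>i\<in>{i\<in>S. dcube N i \<subseteq> dcube (4 * N) j}. wmeas \<mu> (dcube 1 i)) \<le> 2 * A * wmeas \<mu> (dcube (4 * N) j)"
    proof (rule Carleson_condition[OF mu nu _ A])
      show "sparse \<nu> {i \<in> S. dcube N i \<subseteq> dcube (4 * N) j}" by (rule sparse_subset[OF S]) blast
      show "0 < 4 * N * snd j" using N j by simp
      fix i assume i: "i \<in> {i \<in> S. dcube N i \<subseteq> dcube (4 * N) j}"
      have "dcube 1 i \<subseteq> dcube N i" using i pos N by (intro cube_mono) auto
      then show "dcube 1 i \<subseteq> dcube (4 * N) j" using i by blast
    qed
    also have "\<dots> \<le> 2 * A * (D\<^sup>2 * wmeas \<mu> (dcube N j))"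
      using doubling_wmeas_power[OF D mu, of "N * snd j" "fst j" 2] N j A(2)
      by (intro mult_left_mono) (auto simp: mult.assoc)
    finally show "(\<Sum>i\<in>{i\<in>S. dcube N i \<subseteq> dcube (4 * N) j}. wmeas \<mu> (dcube 1 i)) \<le> 2 * A * (D\<^sup>2 * wmeas \<mu> (dcube N j))" .
  qed
  also have "\<dots> \<le> (\<Sum>j\<in>J. 2 * A * (D\<^sup>2 * (2 / t * (LINT x:dcube N j|?M. G x))))"
    using one J(1) A(2) by (intro sum_mono mult_left_mono) auto
  also have "\<dots> = 4 * D\<^sup>2 * A / t * (\<Sum>j\<in>J. LINT x:dcube N j|?M. G x)"
    unfolding sum_distrib_left by (intro sum.cong refl) (use t in \<open>simp add: field_simps\<close>)
  also have "(\<Sum>j\<in>J. LINT x:dcube N j|?M. G x) = (LINT x|?M. (\<Sum>j\<in>J. indicator (dcube N j) x *\<^sub>R G x))"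
    unfolding set_lebesgue_integral_def
    using integrable_mult_indicator[OF _ Gint] by (intro Bochner_Integration.integral_sum[symmetric]) auto
  also have "4 * D\<^sup>2 * A / t * \<dots> \<le> 4 * D\<^sup>2 * A / t * (LINT x|?M. G x)"
  proof (intro mult_left_mono integral_mono)
    fix x
    show "(\<Sum>j\<in>J. indicator (dcube N j) x *\<^sub>R G x) \<le> G x"
    proof (cases "\<exists>j\<in>J. x \<in> dcube N j")
      case True
      then obtain j where j: "j \<in> J" "x \<in> dcube N j" by blast
      then have "(\<Sum>l\<in>J. indicator (dcube N l) x *\<^sub>R G x) = (\<Sum>l\<in>J. if l = j then G x else 0)"
        using J(2) unfolding disjoint_family_on_def by (intro sum.cong) (auto simp: indicator_def)
      also have "\<dots> = G x" using finJ j by (simp add: sum.delta)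
      finally show ?thesis by simp
    next
      case False
      then have "(\<Sum>j\<in>J. indicator (dcube N j) x *\<^sub>R G x) = 0" by (intro sum.neutral) auto
      then show ?thesis using G0[of x] by simp
    qed
  qed (use Gint A(2) t integrable_mult_indicator[OF _ Gint] in auto)
  finally show ?thesis by (simp add: G_def)
qed

text \<open>The factors are the passage from the lower to the upper end of a level
  (\<open>2 powr s\<close>), the weak-type constant, and the geometric series for exponent
  \<open>s - 1\<close> evaluated at \<open>2 * H x\<close>.\<close>

definition embedding_const :: "real \<Rightarrow> real \<Rightarrow> real" where
  "embedding_const D s = 2 powr s * (4 * D\<^sup>2) * (2 powr (s - 1) / (2 powr (s - 1) - 1) * 2 powr (s - 1))"

lemma embedding_const_nonneg: 
  assumes "1 < s"
  shows "0 \<le> embedding_const D s"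
proof -
  have "1 < (2::real) powr (s - 1)" using assms by simp
  then show ?thesis
    unfolding embedding_const_def by (intro mult_nonneg_nonneg divide_nonneg_pos) (linarith | simp)+
qed

text \<open>The averages are sorted into dyadic levels and the weak-type bound is used at each
  level. Exchanging sum and integral leaves, at a point \<open>x\<close>, a sum over the levels
  below \<open>2 * H x\<close>. Averages are over dilates while the masses are those of the
  undilated cubes, because the dual test functions live on companion cubes.\<close>

lemma Carleson_embedding:
  fixes \<mu> \<nu> :: "real ^ 'd \<Rightarrow> real"
  assumes mu: "weight \<mu>" and nu: "weight \<nu>" and S: "sparse \<nu> S"
    and A: "A_inf_const \<mu> \<nu> \<le> ennreal A" "0 \<le> A"
    and D: "doubling_with D \<mu>" and N: "1 \<le> N" and s: "1 < s"
    and H: "integrable (weight_measure \<mu>) H" "\<And>x. 0 \<le> H x"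
    and Hs: "integrable (weight_measure \<mu>) (\<lambda>x. H x powr s)"
  shows "(\<Sum>i\<in>S. wmeas \<mu> (dcube 1 i) * ((LINT x:dcube N i|weight_measure \<mu>. H x) / wmeas \<mu> (dcube N i)) powr s)
    \<le> embedding_const D s * A * (LINT x|weight_measure \<mu>. H x powr s)"
proof -
  let ?M = "weight_measure \<mu>"
  define X where "X i = (LINT x:dcube N i|?M. H x) / wmeas \<mu> (dcube N i)" for i
  have fin: "finite S" and pos: "\<And>i. i \<in> S \<Longrightarrow> 0 < snd i" using S by (auto simp: sparse_def)
  have Npos: "0 < wmeas \<mu> (dcube N i)" if "i \<in> S" for i using pos[OF that] mu N by (simp add: wmeas_cube_pos)
  have X0: "0 \<le> X i" for i using H(2) by (simp add: X_def set_lebesgue_integral_def)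
  obtain \<epsilon> n where eps: "0 < \<epsilon>" and
    lev: "\<And>v. \<lbrakk>v \<in> X ` S; 0 < v\<rbrakk> \<Longrightarrow> \<exists>k<n. \<epsilon> * 2 ^ k < v \<and> v \<le> \<epsilon> * 2 ^ Suc k"
    using geometric_levels[of "X ` S" 2] fin by (metis finite_imageI one_less_numeral_iff semiring_norm(76))
  define t where "t k = \<epsilon> * 2 ^ k" for k
  have t: "0 < t k" "t (Suc k) = 2 * t k" for k using eps by (auto simp: t_def)
  have [measurable]: "H \<in> borel_measurable lebesgue" using borel_measurable_integrable[OF H(1)] by simp
  \<comment> \<open>Every level below \<open>X i\<close> is counted, not only the one containing it;
    the geometric growth makes the surplus harmless.\<close>
  have "(\<Sum>i\<in>S. wmeas \<mu> (dcube 1 i) * X i powr s)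
      \<le> (\<Sum>i\<in>S. \<Sum>k<n. if t k < X i then t (Suc k) powr s * wmeas \<mu> (dcube 1 i) else 0)"
  proof (rule sum_mono)
    fix i assume i: "i \<in> S"
    show "wmeas \<mu> (dcube 1 i) * X i powr s \<le> (\<Sum>k<n. if t k < X i then t (Suc k) powr s * wmeas \<mu> (dcube 1 i) else 0)"
    proof (cases "X i = 0")
      case False
      then obtain k where k: "k < n" "t k < X i" "X i \<le> t (Suc k)"
        using lev[of "X i"] i X0[of i] unfolding t_def by (auto simp: less_le)
      have "wmeas \<mu> (dcube 1 i) * X i powr s \<le> wmeas \<mu> (dcube 1 i) * t (Suc k) powr s"
        using k X0 s by (intro mult_left_mono powr_mono2) auto
      also have "\<dots> = (if t k < X i then t (Suc k) powr s * wmeas \<mu> (dcube 1 i) else 0)" using k by simp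
      also have "\<dots> \<le> (\<Sum>k<n. if t k < X i then t (Suc k) powr s * wmeas \<mu> (dcube 1 i) else 0)"
        using k by (intro member_le_sum) auto
      finally show ?thesis .
    qed (simp add: sum_nonneg)
  qed
  also have "\<dots> = (\<Sum>k<n. t (Suc k) powr s * (\<Sum>i\<in>{i\<in>S. t k < X i}. wmeas \<mu> (dcube 1 i)))"
    by (subst sum.swap) (simp only: sum_distrib_left, simp only: sum.inter_filter[OF fin])
  also have "\<dots> \<le> (\<Sum>k<n. t (Suc k) powr s * (4 * D\<^sup>2 * A / t k * (LINT x|?M. H x * indicator {x. t k < 2 * H x} x)))"
  proof (intro sum_mono mult_left_mono)
    fix k
    show "(\<Sum>i\<in>{i\<in>S. t k < X i}. wmeas \<mu> (dcube 1 i)) \<le> 4 * D\<^sup>2 * A / t k * (LINT x|?M. H x * indicator {x. t k < 2 * H x} x)"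
    proof (rule Carleson_weak_type[OF mu nu sparse_subset[OF S] A D N t(1) H])
      fix i assume "i \<in> {i\<in>S. t k < X i}"
      then show "t k * wmeas \<mu> (dcube N i) < (LINT x:dcube N i|?M. H x)"
        using Npos[of i] by (simp add: X_def pos_less_divide_eq)
    qed auto
  qed auto
  also have "\<dots> = (\<Sum>k<n. 2 powr s * (4 * D\<^sup>2) * A * (LINT x|?M. t k powr (s - 1) * (H x * indicator {x. t k < 2 * H x} x)))"
  proof (intro sum.cong refl)
    fix k
    \<comment> \<open>The weak-type bound costs one power of \<open>t k\<close>. The remaining
      exponent \<open>s - 1\<close> is positive, so the sum over levels is controlled by its top
      term.\<close>
    have "t (Suc k) powr s / t k = 2 powr s * t k powr (s - 1)"
      using t[of k] by (simp add: powr_mult powr_diff)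
    then show "t (Suc k) powr s * (4 * D\<^sup>2 * A / t k * (LINT x|?M. H x * indicator {x. t k < 2 * H x} x)) =
      2 powr s * (4 * D\<^sup>2) * A * (LINT x|?M. t k powr (s - 1) * (H x * indicator {x. t k < 2 * H x} x))"
      (is "?a * (?b / t k * ?I) = _")
    proof -
      assume eq: "?a / t k = 2 powr s * t k powr (s - 1)"
      have "?a * (?b / t k * ?I) = (?a / t k) * (?b * ?I)" by simp
      also have "\<dots> = 2 powr s * (4 * D\<^sup>2) * A * (t k powr (s - 1) * ?I)" unfolding eq by simp
      also have "t k powr (s - 1) * ?I = (LINT x|?M. t k powr (s - 1) * (H x * indicator {x. t k < 2 * H x} x))"
        by (rule integral_mult_right_zero[symmetric])
      finally show ?thesis .
    qed
  qed
  also have "\<dots> = 2 powr s * (4 * D\<^sup>2) * A * (LINT x|?M. (\<Sum>k<n. t k powr (s - 1) * (H x * indicator {x. t k < 2 * H x} x)))"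
  proof -
    have "integrable ?M (\<lambda>x. H x * indicator {x. t k < 2 * H x} x)" for k
      by (rule Bochner_Integration.integrable_bound[OF H(1)]) (auto simp: indicator_def H(2))
    then show ?thesis by (subst Bochner_Integration.integral_sum) (auto simp: sum_distrib_left)
  qed
  also have "\<dots> \<le> 2 powr s * (4 * D\<^sup>2) * A * (LINT x|?M. 2 powr (s - 1) / (2 powr (s - 1) - 1) * 2 powr (s - 1) * H x powr s)"
  proof (intro mult_left_mono integral_mono_AE')
    show "AE x in ?M. (\<Sum>k<n. t k powr (s - 1) * (H x * indicator {x. t k < 2 * H x} x)) \<le>
        2 powr (s - 1) / (2 powr (s - 1) - 1) * 2 powr (s - 1) * H x powr s"
    proof (rule AE_I2)
      fix x
      have "(\<Sum>k<n. t k powr (s - 1) * (H x * indicator {x. t k < 2 * H x} x)) =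
          H x * (\<Sum>k\<in>{k. k < n \<and> t k < 2 * H x}. t k powr (s - 1))"
        unfolding sum_distrib_left by (rule sum.mono_neutral_cong_right) (auto simp: indicator_def)
      also have "\<dots> \<le> H x * (2 powr (s - 1) / (2 powr (s - 1) - 1) * (2 * H x) powr (s - 1))"
        using sum_levels_le[of t "s - 1"] t s H(2)[of x] by (intro mult_left_mono) auto
      also have "\<dots> = 2 powr (s - 1) / (2 powr (s - 1) - 1) * 2 powr (s - 1) * (H x * H x powr (s - 1))"
        using H(2)[of x] by (simp add: powr_mult)
      also have "H x * H x powr (s - 1) = H x powr s"
        using H(2)[of x] s by (cases "H x = 0") (auto simp: powr_diff)
      finally show "(\<Sum>k<n. t k powr (s - 1) * (H x * indicator {x. t k < 2 * H x} x)) \<le>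
        2 powr (s - 1) / (2 powr (s - 1) - 1) * 2 powr (s - 1) * H x powr s" .
    qed
    have "1 < (2::real) powr (s - 1)" using s by simp
    then have "0 \<le> 2 powr (s - 1) / ((2::real) powr (s - 1) - 1)"
      by (intro divide_nonneg_pos) linarith+
    then show "AE x in ?M. 0 \<le> 2 powr (s - 1) / (2 powr (s - 1) - 1) * 2 powr (s - 1) * H x powr s"
      by (intro AE_I2 mult_nonneg_nonneg) simp_all
  qed (use Hs A in auto)
  also have "\<dots> = embedding_const D s * A * (LINT x|?M. H x powr s)"
    by (simp add: embedding_const_def)
  finally show ?thesis by (simp add: X_def)
qed

lemma integrable_indicator_sum_powr:
  fixes b :: "(real ^ 'd) \<times> real \<Rightarrow> real"
  assumes mu: "weight \<mu>" and fin: "finite S" and b0: "\<And>i. i \<in> S \<Longrightarrow> 0 \<le> b i" and e: "0 < e"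
  shows "integrable (weight_measure \<mu>) (\<lambda>x. (\<Sum>i\<in>S. b i * indicator (dcube N i) x) powr e)"
proof -
  define F where "F x = (\<Sum>i\<in>S. b i * indicator (dcube N i) x)" for x
  have F0: "0 \<le> F x" for x unfolding F_def using b0 by (intro sum_nonneg) auto
  have [measurable]: "F \<in> borel_measurable lebesgue" unfolding F_def by measurable
  have "integrable (weight_measure \<mu>) (\<lambda>x. F x powr e)"
  proof (rule integrableI_bounded_set[where A = "\<Union>i\<in>S. dcube N i" and B = "(\<Sum>i\<in>S. b i) powr e"])
    show "emeasure (weight_measure \<mu>) (\<Union>i\<in>S. dcube N i) < \<infinity>"
      using fin by (intro emeasure_weight_compact mu compact_UN) auto
    show "(\<lambda>x. F x powr e) \<in> borel_measurable (weight_measure \<mu>)" by simp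
    have "F x \<le> (\<Sum>i\<in>S. b i)" for x
      unfolding F_def using b0 by (intro sum_mono) (auto simp: indicator_def)
    then show "AE x\<in>(\<Union>i\<in>S. dcube N i) in (weight_measure \<mu>). norm (F x powr e) \<le> (\<Sum>i\<in>S. b i) powr e"
      using F0 e by (intro AE_I2 impI) (auto intro!: powr_mono2)
    have "F x = 0" if "x \<notin> (\<Union>i\<in>S. dcube N i)" for x
      unfolding F_def using that by (intro sum.neutral) auto
    then show "AE x in (weight_measure \<mu>). x \<notin> (\<Union>i\<in>S. dcube N i) \<longrightarrow> F x powr e = 0" by (intro AE_I2) auto
  qed (use fin in auto)
  then show ?thesis by (simp add: F_def)
qed

text \<open>Duality with F^(p-1): the integral of F^p is the sum of \<open>b i\<close> times
  integrals of F^(p-1) over the dilates. Up to doubling, \<mu>(Q_i) \<open>b i\<close> equals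
  \<open>a i\<close> \<nu>(Q_i)^(1/p) \<mu>(Q_i)^(1/p'), so Hoelder over the indices separates the
  wanted sum from one that the embedding with exponent p' controls.\<close>

lemma sparse_sum_norm:
  fixes \<mu> \<nu> :: "real ^ 'd \<Rightarrow> real"
  assumes mu: "weight \<mu>" and nu: "weight \<nu>" and S: "sparse \<nu> S"
    and A: "A_inf_const \<mu> \<nu> \<le> ennreal A" "0 \<le> A"
    and D: "doubling_with D \<mu>"
    and p: "1 < p" "1 < p'" "1 / p + 1 / p' = 1"
    and a: "\<And>i. i \<in> S \<Longrightarrow> 0 \<le> a i"
    and b: "\<And>i. b i = a i * (wmeas \<nu> (dcube 1 i) / wmeas \<mu> (dcube 1 i)) powr (1 / p)"
  shows "(LINT x|weight_measure \<mu>. (\<Sum>i\<in>S. b i * indicator (dcube (2 ^ m) i) x) powr p) powr (1 / p)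
    \<le> D ^ m * embedding_const D p' powr (1 / p') * A powr (1 / p') * (\<Sum>i\<in>S. a i powr p * wmeas \<nu> (dcube 1 i)) powr (1 / p)"
proof -
  let ?M = "weight_measure \<mu>" and ?N = "(2::real) ^ m"
  define F where "F x = (\<Sum>i\<in>S. b i * indicator (dcube ?N i) x)" for x
  define T where "T = (\<Sum>i\<in>S. a i powr p * wmeas \<nu> (dcube 1 i))"
  have fin: "finite S" and pos: "\<And>i. i \<in> S \<Longrightarrow> 0 < snd i" using S by (auto simp: sparse_def)
  have mupos: "0 < wmeas \<mu> (dcube 1 i)" "0 < wmeas \<nu> (dcube 1 i)" "0 < wmeas \<mu> (dcube ?N i)" if "i \<in> S" for i
    using pos[OF that] mu nu by (auto intro!: wmeas_cube_pos)
  have b0: "0 \<le> b i" if "i \<in> S" for i using a[OF that] by (simp add: b)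
  have F0: "0 \<le> F x" for x unfolding F_def using b0 by (intro sum_nonneg) auto
  have D1: "1 \<le> D" using doubling_wmeas(2)[OF D mu, of 1] by simp
  have [measurable]: "F \<in> borel_measurable lebesgue" unfolding F_def by measurable
  have Fint: "integrable ?M (\<lambda>x. F x powr e)" if "0 < e" for e
    unfolding F_def by (rule integrable_indicator_sum_powr[OF mu fin b0 that])
  \<comment> \<open>\<open>H\<close> is the extremal dual function:
    \<open>H powr p' = F powr p\<close>, so the embedding returns the same integral \<open>X\<close>
    to the power \<open>1 / p'\<close>.\<close>
  define H where "H x = F x powr (p - 1)" for x
  define X where "X = (LINT x|?M. F x powr p)"
  have X0: "0 \<le> X" by (simp add: X_def)
  have conj: "(p - 1) * p' = p" using p by (auto simp: field_simps)
  have Hint: "integrable ?M H" unfolding H_def using p by (intro Fint) simp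
  have Hp: "H x powr p' = F x powr p" for x by (simp add: H_def powr_powr conj)
  define \<xi> where "\<xi> i = (LINT x:dcube ?N i|?M. H x) / wmeas \<mu> (dcube ?N i)" for i
  have xi0: "0 \<le> \<xi> i" for i by (simp add: \<xi>_def set_lebesgue_integral_def H_def)
  have emb: "(\<Sum>i\<in>S. wmeas \<mu> (dcube 1 i) * \<xi> i powr p') \<le> embedding_const D p' * A * X"
    unfolding \<xi>_def X_def Hp[symmetric]
    using Fint[of p] p by (intro Carleson_embedding[OF mu nu S A D _ _ Hint]) (auto simp: Hp, simp add: H_def)
  have "X = (LINT x|?M. (\<Sum>i\<in>S. b i * (indicator (dcube ?N i) x *\<^sub>R H x)))"
    unfolding X_def
  proof (rule Bochner_Integration.integral_cong[OF refl])
    fix x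
    have "F x powr p = F x * H x" using F0[of x] p by (cases "F x = 0") (auto simp: H_def powr_diff)
    also have "\<dots> = (\<Sum>i\<in>S. b i * (indicator (dcube ?N i) x *\<^sub>R H x))"
      by (simp add: F_def sum_distrib_right mult.assoc)
    finally show "F x powr p = (\<Sum>i\<in>S. b i * (indicator (dcube ?N i) x *\<^sub>R H x))" .
  qed
  also have "\<dots> = (\<Sum>i\<in>S. b i * (LINT x:dcube ?N i|?M. H x))"
    unfolding set_lebesgue_integral_def
    using integrable_mult_indicator[OF _ Hint] by (subst Bochner_Integration.integral_sum) auto
  also have "\<dots> \<le> (\<Sum>i\<in>S. D ^ m * ((a i * wmeas \<nu> (dcube 1 i) powr (1 / p)) * (wmeas \<mu> (dcube 1 i) powr (1 / p') * \<xi> i)))"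
  proof (rule sum_mono)
    fix i assume i: "i \<in> S"
    have "b i * (LINT x:dcube ?N i|?M. H x) = b i * \<xi> i * wmeas \<mu> (dcube ?N i)"
      using mupos[OF i] by (simp add: \<xi>_def)
    also have "\<dots> \<le> b i * \<xi> i * (D ^ m * wmeas \<mu> (dcube 1 i))"
      using doubling_wmeas_power[OF D mu pos[OF i], of "fst i" m] b0[OF i] xi0 by (intro mult_left_mono) auto
    also have "\<dots> = D ^ m * ((a i * wmeas \<nu> (dcube 1 i) powr (1 / p)) * ((wmeas \<mu> (dcube 1 i) / wmeas \<mu> (dcube 1 i) powr (1 / p)) * \<xi> i))"
      using mupos[OF i] by (simp add: b powr_divide)
    also have "wmeas \<mu> (dcube 1 i) / wmeas \<mu> (dcube 1 i) powr (1 / p) = wmeas \<mu> (dcube 1 i) powr (1 - 1 / p)"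
      using mupos[OF i] by (simp add: powr_diff)
    also have "1 - 1 / p = 1 / p'" using p by simp
    finally show "b i * (LINT x:dcube ?N i|?M. H x) \<le>
      D ^ m * ((a i * wmeas \<nu> (dcube 1 i) powr (1 / p)) * (wmeas \<mu> (dcube 1 i) powr (1 / p') * \<xi> i))" .
  qed
  also have "\<dots> = D ^ m * (\<Sum>i\<in>S. (a i * wmeas \<nu> (dcube 1 i) powr (1 / p)) * (wmeas \<mu> (dcube 1 i) powr (1 / p') * \<xi> i))"
    by (simp add: sum_distrib_left)
  also have "\<dots> \<le> D ^ m * ((\<Sum>i\<in>S. (a i * wmeas \<nu> (dcube 1 i) powr (1 / p)) powr p) powr (1 / p) *
      (\<Sum>i\<in>S. (wmeas \<mu> (dcube 1 i) powr (1 / p') * \<xi> i) powr p') powr (1 / p'))"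
    using D1 a xi0 fin p by (intro mult_left_mono sum_Hoelder) auto
  also have "(\<Sum>i\<in>S. (a i * wmeas \<nu> (dcube 1 i) powr (1 / p)) powr p) = T"
    unfolding T_def using a mupos p by (intro sum.cong) (auto simp: powr_mult powr_powr)
  also have "(\<Sum>i\<in>S. (wmeas \<mu> (dcube 1 i) powr (1 / p') * \<xi> i) powr p') = (\<Sum>i\<in>S. wmeas \<mu> (dcube 1 i) * \<xi> i powr p')"
    using xi0 mupos p by (intro sum.cong) (auto simp: powr_mult powr_powr)
  also have "D ^ m * (T powr (1 / p) * (\<Sum>i\<in>S. wmeas \<mu> (dcube 1 i) * \<xi> i powr p') powr (1 / p')) \<le>
      D ^ m * (T powr (1 / p) * (embedding_const D p' * A * X) powr (1 / p'))"
    using D1 emb p xi0 by (intro mult_left_mono powr_mono2 sum_nonneg) auto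
  also have "\<dots> = (D ^ m * embedding_const D p' powr (1 / p') * A powr (1 / p') * T powr (1 / p)) * X powr (1 / p')"
    using embedding_const_nonneg[OF p(2), of D] A X0 by (simp add: powr_mult)
  finally have main: "X \<le> (D ^ m * embedding_const D p' powr (1 / p') * A powr (1 / p') * T powr (1 / p)) * X powr (1 / p')"
    (is "_ \<le> ?c * _") .
  \<comment> \<open>\<open>X\<close> is a finite real, so unless it is 0 the factor
    \<open>X powr (1 / p')\<close> cancels.\<close>
  have "X powr (1 / p) \<le> ?c"
  proof (cases "X = 0")
    case False
    then have "0 < X" using X0 by simp
    have "X = X powr (1 / p) * X powr (1 / p')" using \<open>0 < X\<close> p by (simp flip: powr_add)
    then have "X powr (1 / p) * X powr (1 / p') \<le> ?c * X powr (1 / p')" using main by simp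
    then show ?thesis using \<open>0 < X\<close> by (simp add: mult_le_cancel_right)
  next
    case True
    then show ?thesis using D1 by simp
  qed
  then show ?thesis by (simp add: X_def F_def T_def)
qed

subsection \<open>Oscillations and the off-support bilinear form\<close>

definition osc :: "(real ^ 'd \<Rightarrow> complex) \<Rightarrow> (real ^ 'd) set \<Rightarrow> real" where
  "osc b Q = (LINT x:Q|lebesgue. cmod (b x - average Q b))"

text \<open>A single inequality encodes support and size, and it is monotone in \<open>Q\<close>: a
  function on a companion cube is also a test function on any larger cube.\<close>

definition test_function :: "(real ^ 'd) set \<Rightarrow> (real ^ 'd \<Rightarrow> complex) \<Rightarrow> bool" where
  "test_function Q f \<longleftrightarrow> f \<in> borel_measurable lebesgue \<and> (\<forall>x. cmod (f x) \<le> indicator Q x)"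

lemma test_function_outside: "\<lbrakk>test_function Q f; x \<notin> Q\<rbrakk> \<Longrightarrow> f x = 0"
  unfolding test_function_def by (metis indicator_simps(2) norm_le_zero_iff)

lemma test_function_le_1: "test_function Q f \<Longrightarrow> cmod (f x) \<le> 1"
  unfolding test_function_def by (smt (verit) indicator_le_1)

lemma test_function_support:
  assumes "test_function Q f" "compact Q"
  shows "closure {x. f x \<noteq> 0} \<subseteq> Q" "f \<in> L_infty_c"
proof -
  have "{x. f x \<noteq> 0} \<subseteq> Q" using test_function_outside[OF assms(1)] by blast
  then show sub: "closure {x. f x \<noteq> 0} \<subseteq> Q"
    using assms(2) by (simp add: closure_minimal compact_imp_closed)
  have "compact (closure {x. f x \<noteq> 0})"
    using compact_Int_closed[OF assms(2), of "closure {x. f x \<noteq> 0}"] sub by (simp add: Int_absorb1)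
  moreover have "bounded (range f)"
    using test_function_le_1[OF assms(1)] by (auto simp: bounded_iff)
  ultimately show "f \<in> L_infty_c"
    using assms(1) by (simp add: L_infty_c_def test_function_def)
qed

lemma set_integrable_compact:
  "\<lbrakk>locally_integrable f; compact Q\<rbrakk> \<Longrightarrow> set_integrable lebesgue Q f"
  by (simp add: locally_integrable_def)

lemma integrable_mult_test_function:
  fixes b f :: "real ^ 'd \<Rightarrow> complex"
  assumes b: "locally_integrable b" and Q: "compact Q" and f: "test_function Q f"
  shows "integrable lebesgue (\<lambda>x. b x * f x)"
proof (rule Bochner_Integration.integrable_bound)
  show "integrable lebesgue (\<lambda>x. indicator Q x *\<^sub>R b x)"
    using set_integrable_compact[OF b Q] by (simp add: set_integrable_def)
  show "(\<lambda>x. b x * f x) \<in> borel_measurable lebesgue"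
    using locally_integrable_measurable[OF b] f
    by (intro borel_measurable_times) (auto simp: test_function_def)
  show "AE x in lebesgue. norm (b x * f x) \<le> norm (indicator Q x *\<^sub>R b x)"
  proof (rule AE_I2)
    fix x
    have "cmod (f x) \<le> indicator Q x" using f by (simp add: test_function_def)
    then have "cmod (b x) * cmod (f x) \<le> cmod (b x) * indicator Q x" by (intro mult_left_mono) auto
    then show "norm (b x * f x) \<le> norm (indicator Q x *\<^sub>R b x)" by (simp add: norm_mult mult.commute)
  qed
qed

lemma locally_integrable_const: "locally_integrable (\<lambda>x :: real ^ 'd. c)"
  unfolding locally_integrable_def set_integrable_def
proof (intro allI impI integrable_scaleR_left integrable_real_indicator)
  fix S :: "(real ^ 'd) set" assume "compact S"
  then have "S \<in> lmeasurable" by (rule lmeasurable_compact)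
  then show "S \<in> sets lebesgue" "emeasure lebesgue S < \<infinity>"
    using fmeasurableD2[of S lebesgue] by (auto simp: fmeasurableD top.not_eq_extremum)
qed

lemma locally_integrable_diff_const:
  assumes "locally_integrable b"
  shows "locally_integrable (\<lambda>x. b x - c)"
  using assms locally_integrable_const[of c] unfolding locally_integrable_def
  by (auto intro: set_integral_diff)

lemma set_integrable_cmod_diff:
  assumes "locally_integrable (b :: real ^ 'd \<Rightarrow> complex)" "compact Q"
  shows "set_integrable lebesgue Q (\<lambda>x. cmod (b x - c))"
  using set_integrable_compact[OF locally_integrable_diff_const[OF assms(1), of c] assms(2)]
  by (rule set_integrable_norm)

lemma average_cube:
  fixes b :: "real ^ 'd \<Rightarrow> complex"
  assumes "0 < h"
  shows "measure lebesgue (cube c h) *\<^sub>R average (cube c h) b = (LINT x:cube c h|lebesgue. b x)"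
  using assms measure_lebesgue_cube[of h c] by (simp add: average_def)

lemma set_lebesgue_integral_const_cube:
  fixes z :: complex
  shows "(LINT x:cube a h|lebesgue. z) = measure lebesgue (cube a h) *\<^sub>R z"
proof -
  have "cube a h \<in> lmeasurable" by (simp add: lmeasurable_compact)
  then have "emeasure lebesgue (cube a h) < \<infinity>"
    using fmeasurableD2[of "cube a h" lebesgue] by (simp add: top.not_eq_extremum)
  then have "integrable lebesgue (indicator (cube a h) :: _ \<Rightarrow> real)" by (intro integrable_real_indicator) auto
  then show ?thesis by (simp add: set_lebesgue_integral_def)
qed

text \<open>Replacing the mean by \<open>z\<close> costs \<open>cmod (z - average Q b)\<close>,
  which is at most the mean of \<open>cmod (b - z)\<close>; hence the factor 2.\<close>

lemma osc_le:
  fixes b :: "real ^ 'd \<Rightarrow> complex"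
  assumes b: "locally_integrable b" and h: "0 < h"
  shows "osc b (cube c h) \<le> 2 * (LINT x:cube c h|lebesgue. cmod (b x - z))"
proof -
  let ?Q = "cube c h"
  have int: "set_integrable lebesgue ?Q (\<lambda>x. cmod (b x - w))" for w
    using set_integrable_cmod_diff[OF b] by simp
  have intc: "set_integrable lebesgue ?Q (\<lambda>x. w)" for w :: real
    by (rule set_integrable_compact[OF locally_integrable_const compact_cube])
  have intc': "set_integrable lebesgue ?Q (\<lambda>x. z)"
    by (rule set_integrable_compact[OF locally_integrable_const compact_cube])
  have intb: "set_integrable lebesgue ?Q b" using set_integrable_compact[OF b] by simp
  have "osc b ?Q \<le> (LINT x:?Q|lebesgue. cmod (b x - z) + cmod (z - average ?Q b))"
    unfolding osc_def using int intc
    by (intro set_integral_mono set_integral_add) (auto intro: norm_triangle_sub order_trans[OF norm_triangle_ineq4] norm_diff_triangle_le)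
  also have "\<dots> = (LINT x:?Q|lebesgue. cmod (b x - z)) + measure lebesgue ?Q * cmod (z - average ?Q b)"
    using int intc by (subst set_integral_add) (auto simp: set_lebesgue_integral_def lmeasurable_compact fmeasurableD2)
  also have "measure lebesgue ?Q * cmod (z - average ?Q b) = cmod (measure lebesgue ?Q *\<^sub>R z - measure lebesgue ?Q *\<^sub>R average ?Q b)"
    by (simp add: scaleR_diff_right[symmetric])
  also have "\<dots> = cmod (LINT x:?Q|lebesgue. b x - z)"
    using intb intc' unfolding average_cube[OF h]
    by (subst set_integral_diff) (auto simp: set_lebesgue_integral_const_cube norm_minus_commute)
  also have "\<dots> \<le> (LINT x:?Q|lebesgue. cmod (b x - z))"
    unfolding set_lebesgue_integral_def by (rule order_trans[OF integral_norm_bound]) simp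
  finally show ?thesis by simp
qed

text \<open>With the kernel frozen at \<open>K0\<close> the form factorises. The error is at most
  \<epsilon> times the integral of |b y - b x|, split through an arbitrary constant
  \<open>m\<close>. The assumptions \<open>unif\<close> and \<open>cont\<close> provide
  measurability: \<open>cont\<close> for the inner integrand, \<open>unif\<close> for the dependence
  of the inner integral on \<open>y\<close>.\<close>

lemma kernel_form_near_constant:
  fixes b f g :: "real ^ 'd \<Rightarrow> complex" and K :: "real ^ 'd \<Rightarrow> real ^ 'd \<Rightarrow> complex"
  assumes b: "locally_integrable b" and PQ: "compact P" "compact Q"
    and f: "test_function Q f" and g: "test_function P g"
    and unif: "\<And>e. 0 < e \<Longrightarrow> \<exists>\<delta>>0. \<forall>y\<in>P. \<forall>y'\<in>P. \<forall>x\<in>Q. dist y y' < \<delta> \<longrightarrow> cmod (K y x - K y' x) \<le> e"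
    and cont: "\<And>y. y \<in> P \<Longrightarrow> continuous_on Q (K y)"
    and near: "\<And>x y. \<lbrakk>x \<in> Q; y \<in> P\<rbrakk> \<Longrightarrow> cmod (K y x - K0) \<le> \<epsilon>"
  shows "cmod ((LINT y|lebesgue. LINT x|lebesgue. (b y - b x) * K y x * f x * g y)
      - K0 * (LINT y|lebesgue. g y * (b y * (LINT x|lebesgue. f x) - (LINT x|lebesgue. b x * f x))))
    \<le> \<epsilon> * (measure lebesgue Q * (LINT y:P|lebesgue. cmod (b y - m)) +
          measure lebesgue P * (LINT x:Q|lebesgue. cmod (b x - m)))"
proof -
  have PQsets: "P \<in> sets lebesgue" "Q \<in> sets lebesgue" "P \<in> sets borel" "Q \<in> sets borel"
    using PQ by (auto simp: lmeasurable_compact fmeasurableD compact_imp_closed)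
  have finm: "emeasure lebesgue P < \<infinity>" "emeasure lebesgue Q < \<infinity>"
    using PQ by (auto simp: lmeasurable_compact fmeasurableD2 less_top[symmetric])
  have bM [measurable]: "b \<in> borel_measurable lebesgue" by (rule locally_integrable_measurable[OF b])
  have fM [measurable]: "f \<in> borel_measurable lebesgue" using f by (simp add: test_function_def)
  have gM [measurable]: "g \<in> borel_measurable lebesgue" using g by (simp add: test_function_def)
  have KM: "(\<lambda>x. indicator Q x *\<^sub>R K y x) \<in> borel_measurable lebesgue" if "y \<in> P" for y
    using borel_measurable_continuous_on_indicator[OF PQsets(4) cont[OF that]]
    by (intro measurable_completion) simp
  have Kint: "integrable lebesgue (\<lambda>x. K y x * h x)"
    if y: "y \<in> P" and h: "integrable lebesgue h" "\<And>x. x \<notin> Q \<Longrightarrow> h x = 0" for y and h :: "real ^ 'd \<Rightarrow> complex"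
  proof (rule Bochner_Integration.integrable_bound)
    show "integrable lebesgue (\<lambda>x. (cmod K0 + \<epsilon>) *\<^sub>R h x)" using h(1) by (rule integrable_scaleR_right)
    have eq: "(\<lambda>x. K y x * h x) = (\<lambda>x. (indicator Q x *\<^sub>R K y x) * h x)"
      using h(2) by (force simp: indicator_def)
    show "(\<lambda>x. K y x * h x) \<in> borel_measurable lebesgue"
      unfolding eq using KM[OF y] borel_measurable_integrable[OF h(1)] by (rule borel_measurable_times)
    show "AE x in lebesgue. norm (K y x * h x) \<le> norm ((cmod K0 + \<epsilon>) *\<^sub>R h x)"
    proof (rule AE_I2)
      fix x
      show "norm (K y x * h x) \<le> norm ((cmod K0 + \<epsilon>) *\<^sub>R h x)"
      proof (cases "x \<in> Q")
        case True
        have "cmod (K y x) \<le> cmod K0 + \<epsilon>"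
          using near[OF True y] norm_triangle_sub[of "K y x" K0] by linarith
        then have "cmod (K y x) * cmod (h x) \<le> \<bar>cmod K0 + \<epsilon>\<bar> * cmod (h x)"
          by (intro mult_right_mono) auto
        then show ?thesis by (simp add: norm_mult)
      qed (simp add: h(2))
    qed
  qed
  define V where "V h y = (LINT x|lebesgue. K y x * h x)" for h :: "real ^ 'd \<Rightarrow> complex" and y
  \<comment> \<open>The kernel is uniformly continuous in \<open>y\<close> for all \<open>x\<close>
    in \<open>Q\<close>, and this passes to the integral against \<open>h\<close>. The
    \<open>I + 1\<close> avoids division by 0 when \<open>h\<close> vanishes almost
    everywhere.\<close>
  have Vcont: "continuous_on P (V h)"
    if h: "integrable lebesgue h" "\<And>x. x \<notin> Q \<Longrightarrow> h x = 0" for h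
    unfolding continuous_on_iff
  proof (intro ballI allI impI)
    fix y and e :: real assume y: "y \<in> P" and e: "0 < e"
    define I where "I = (LINT x|lebesgue. cmod (h x))"
    have I: "0 \<le> I" by (simp add: I_def)
    obtain \<delta> where \<delta>: "0 < \<delta>" "\<And>y y' x. \<lbrakk>y \<in> P; y' \<in> P; x \<in> Q; dist y y' < \<delta>\<rbrakk> \<Longrightarrow> cmod (K y x - K y' x) \<le> e / (2 * (I + 1))"
      using unif[of "e / (2 * (I + 1))"] e I by (auto simp: divide_simps)
    show "\<exists>d>0. \<forall>y'\<in>P. dist y' y < d \<longrightarrow> dist (V h y') (V h y) < e"
    proof (intro exI[of _ \<delta>] conjI ballI impI)
      fix y' assume y': "y' \<in> P" "dist y' y < \<delta>"
      have "V h y' - V h y = (LINT x|lebesgue. K y' x * h x - K y x * h x)"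
        unfolding V_def using Kint[OF y h] Kint[OF y'(1) h] by (subst Bochner_Integration.integral_diff) auto
      then have "dist (V h y') (V h y) \<le> (LINT x|lebesgue. cmod (K y' x * h x - K y x * h x))"
        by (simp add: dist_norm)
      also have "\<dots> \<le> (LINT x|lebesgue. e / (2 * (I + 1)) * cmod (h x))"
      proof (rule integral_mono)
        show "integrable lebesgue (\<lambda>x. cmod (K y' x * h x - K y x * h x))"
          using Kint[OF y h] Kint[OF y'(1) h] by (intro integrable_norm Bochner_Integration.integrable_diff)
        show "integrable lebesgue (\<lambda>x. e / (2 * (I + 1)) * cmod (h x))"
          using h(1) by (intro integrable_mult_right integrable_norm)
        fix x
        show "cmod (K y' x * h x - K y x * h x) \<le> e / (2 * (I + 1)) * cmod (h x)"
        proof (cases "x \<in> Q")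
          case True
          have "cmod (K y' x - K y x) * cmod (h x) \<le> e / (2 * (I + 1)) * cmod (h x)"
            using \<delta>(2)[OF y'(1) y True y'(2)] by (intro mult_right_mono) auto
          then show ?thesis by (simp only: norm_mult[symmetric] left_diff_distrib)
        qed (simp add: h(2))
      qed
      also have "\<dots> = e * (I / (2 * (I + 1)))" by (simp add: I_def)
      also have "\<dots> < e * 1" using e I by (intro mult_strict_left_mono) (auto simp: field_simps)
      finally show "dist (V h y') (V h y) < e" by simp
    qed (rule \<delta>)
  qed
  have VM: "(\<lambda>y. indicator P y *\<^sub>R V h y) \<in> borel_measurable lebesgue"
    if h: "integrable lebesgue h" "\<And>x. x \<notin> Q \<Longrightarrow> h x = 0" for h
    using borel_measurable_continuous_on_indicator[OF PQsets(3) Vcont[OF h]]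
    by (intro measurable_completion) simp
  have fint: "integrable lebesgue f"
    using integrable_mult_test_function[OF locally_integrable_const PQ(2) f, of 1] by simp
  have gint: "integrable lebesgue g"
    using integrable_mult_test_function[OF locally_integrable_const PQ(1) g, of 1] by simp
  have bfint: "integrable lebesgue (\<lambda>x. b x * f x)" by (rule integrable_mult_test_function[OF b PQ(2) f])
  have bgint: "integrable lebesgue (\<lambda>x. b x * g x)" by (rule integrable_mult_test_function[OF b PQ(1) g])
  have f0: "f x = 0" if "x \<notin> Q" for x by (rule test_function_outside[OF f that])
  have g0: "g x = 0" if "x \<notin> P" for x by (rule test_function_outside[OF g that])
  have bf0: "b x * f x = 0" if "x \<notin> Q" for x using f0[OF that] by simp
  define F0 where "F0 = (LINT x|lebesgue. f x)"
  define F1 where "F1 = (LINT x|lebesgue. b x * f x)"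
  define \<Phi> where "\<Phi> y = (LINT x|lebesgue. (b y - b x) * K y x * f x * g y)" for y
  define G where "G y = g y * (b y * F0 - F1)" for y
  have Phi: "\<Phi> y = g y * (b y * (indicator P y *\<^sub>R V f y) - indicator P y *\<^sub>R V (\<lambda>x. b x * f x) y)" for y
  proof (cases "y \<in> P")
    case True
    have "\<Phi> y = (LINT x|lebesgue. g y * (b y * (K y x * f x) - K y x * (b x * f x)))"
      unfolding \<Phi>_def by (intro Bochner_Integration.integral_cong) (auto simp: algebra_simps)
    also have "\<dots> = g y * (b y * V f y - V (\<lambda>x. b x * f x) y)"
      unfolding V_def using Kint[OF True fint f0] Kint[OF True bfint bf0]
      by (simp add: Bochner_Integration.integral_diff)
    finally show ?thesis using True by simp
  next
    case False
    then show ?thesis by (simp add: \<Phi>_def g0)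
  qed
  have PhiM: "\<Phi> \<in> borel_measurable lebesgue"
    unfolding Phi[abs_def] using VM[OF fint f0] VM[OF bfint bf0]
    by (intro borel_measurable_times borel_measurable_diff gM bM)
  have Gint: "integrable lebesgue G"
  proof -
    have "G = (\<lambda>y. F0 * (b y * g y) - F1 * g y)" by (auto simp: G_def algebra_simps)
    then show ?thesis using bgint gint by simp
  qed
  define bound where "bound y = \<epsilon> * (measure lebesgue Q * (indicator P y *\<^sub>R cmod (b y - m))
      + indicator P y *\<^sub>R (LINT x:Q|lebesgue. cmod (b x - m)))" for y
  have Pint: "integrable lebesgue (\<lambda>y. indicator P y *\<^sub>R cmod (b y - m))"
    using set_integrable_cmod_diff[OF b PQ(1)] by (simp add: set_integrable_def)
  have Qint: "integrable lebesgue (\<lambda>y. indicator Q y *\<^sub>R cmod (b y - m))"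
    using set_integrable_cmod_diff[OF b PQ(2)] by (simp add: set_integrable_def)
  have indint: "integrable lebesgue (indicator P :: _ \<Rightarrow> real)" "integrable lebesgue (indicator Q :: _ \<Rightarrow> real)"
    using finm PQsets by (auto intro: integrable_real_indicator)
  have boundint: "integrable lebesgue bound"
    unfolding bound_def
    by (intro integrable_mult_right Bochner_Integration.integrable_add integrable_scaleR_left indint Pint)
  have le: "cmod (\<Phi> y - K0 * G y) \<le> bound y" for y
  proof (cases "y \<in> P")
    case True
    have "\<Phi> y - K0 * G y = (LINT x|lebesgue. (b y - b x) * K y x * f x * g y - K0 * (g y * (b y * f x - b x * f x)))"
    proof -
      have "integrable lebesgue (\<lambda>x. (b y - b x) * K y x * f x * g y)"
      proof -
        have "(\<lambda>x. (b y - b x) * K y x * f x * g y) = (\<lambda>x. g y * (b y * (K y x * f x) - K y x * (b x * f x)))"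
          by (auto simp: algebra_simps)
        then show ?thesis using Kint[OF True fint f0] Kint[OF True bfint bf0] by simp
      qed
      then show ?thesis
        unfolding \<Phi>_def G_def F0_def F1_def using fint bfint
        by (subst Bochner_Integration.integral_diff) (auto simp: Bochner_Integration.integral_diff)
    qed
    then have "cmod (\<Phi> y - K0 * G y) \<le> (LINT x|lebesgue. cmod ((b y - b x) * K y x * f x * g y - K0 * (g y * (b y * f x - b x * f x))))"
      by simp
    also have "\<dots> \<le> (LINT x|lebesgue. \<epsilon> * (indicator Q x *\<^sub>R cmod (b y - m) + indicator Q x *\<^sub>R cmod (b x - m)))"
    proof (rule integral_mono_AE')
      show "integrable lebesgue (\<lambda>x. \<epsilon> * (indicator Q x *\<^sub>R cmod (b y - m) + indicator Q x *\<^sub>R cmod (b x - m)))"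
        by (intro integrable_mult_right Bochner_Integration.integrable_add integrable_scaleR_left indint Qint)
      have eps: "0 \<le> \<epsilon>" if "x \<in> Q" for x using near[OF that True] norm_ge_zero order_trans by blast
      show "AE x in lebesgue. 0 \<le> \<epsilon> * (indicator Q x *\<^sub>R cmod (b y - m) + indicator Q x *\<^sub>R cmod (b x - m))"
        by (rule AE_I2) (use eps in \<open>auto simp: indicator_def\<close>)
      show "AE x in lebesgue. cmod ((b y - b x) * K y x * f x * g y - K0 * (g y * (b y * f x - b x * f x)))
        \<le> \<epsilon> * (indicator Q x *\<^sub>R cmod (b y - m) + indicator Q x *\<^sub>R cmod (b x - m))"
      proof (rule AE_I2)
        fix x
        show "cmod ((b y - b x) * K y x * f x * g y - K0 * (g y * (b y * f x - b x * f x)))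
          \<le> \<epsilon> * (indicator Q x *\<^sub>R cmod (b y - m) + indicator Q x *\<^sub>R cmod (b x - m))"
        proof (cases "x \<in> Q")
          case x: True
          have "cmod ((b y - b x) * K y x * f x * g y - K0 * (g y * (b y * f x - b x * f x)))
              = cmod (K y x - K0) * cmod (b y - b x) * (cmod (f x) * cmod (g y))"
            by (simp only: norm_mult[symmetric]) (simp add: algebra_simps)
          also have "\<dots> \<le> cmod (K y x - K0) * cmod (b y - b x) * (1 * 1)"
            using test_function_le_1[OF f] test_function_le_1[OF g]
            by (intro mult_left_mono mult_mono) auto
          also have "\<dots> \<le> \<epsilon> * (cmod (b y - m) + cmod (b x - m)) * (1 * 1)"
            using near[OF x True] eps[OF x] norm_triangle_ineq4[of "b y - m" "b x - m"]
            by (intro mult_right_mono mult_mono) auto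
          finally show ?thesis using x by simp
        qed (simp add: f0)
      qed
    qed
    also have "\<dots> = \<epsilon> * (measure lebesgue Q * cmod (b y - m) + (LINT x:Q|lebesgue. cmod (b x - m)))"
      using Qint indint(2) finm(2)
      by (subst integral_mult_right_zero, subst Bochner_Integration.integral_add)
         (auto simp: set_lebesgue_integral_def PQsets)
    finally show ?thesis using True by (simp add: bound_def)
  next
    case False
    then show ?thesis by (simp add: Phi G_def g0 bound_def)
  qed
  have "integrable lebesgue (\<lambda>y. \<Phi> y - K0 * G y)"
    using le PhiM borel_measurable_integrable[OF Gint]
    by (intro Bochner_Integration.integrable_bound[OF boundint] AE_I2) (auto intro: order_trans[OF _ abs_ge_self])
  note dint = this
  have "integrable lebesgue (\<lambda>y. (\<Phi> y - K0 * G y) + K0 * G y)"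
    using dint Gint by (intro Bochner_Integration.integrable_add integrable_mult_right)
  then have Phiint: "integrable lebesgue \<Phi>" by simp
  have "(LINT y|lebesgue. \<Phi> y) - K0 * (LINT y|lebesgue. G y) = (LINT y|lebesgue. \<Phi> y - K0 * G y)"
    using Phiint Gint by (subst Bochner_Integration.integral_diff) auto
  then have "cmod ((LINT y|lebesgue. \<Phi> y) - K0 * (LINT y|lebesgue. G y)) \<le> (LINT y|lebesgue. cmod (\<Phi> y - K0 * G y))"
    by simp
  also have "\<dots> \<le> (LINT y|lebesgue. bound y)"
    using dint boundint le by (intro integral_mono integrable_norm)
  also have "\<dots> = \<epsilon> * (measure lebesgue Q * (LINT y:P|lebesgue. cmod (b y - m)) +
          measure lebesgue P * (LINT x:Q|lebesgue. cmod (b x - m)))"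
    unfolding bound_def using Pint indint(1) finm(1)
    by (subst integral_mult_right_zero, subst Bochner_Integration.integral_add)
       (auto simp: set_lebesgue_integral_def PQsets)
  finally show ?thesis by (simp add: \<Phi>_def G_def F0_def F1_def)
qed


lemma mult_cnj_sgn: "z * cnj (sgn z) = of_real (cmod z)"
proof (cases "z = 0")
  case False
  have "z * cnj (sgn z) = (z * cnj z) / of_real (cmod z)"
    by (simp add: sgn_div_norm scaleR_conv_of_real divide_inverse)
  also have "\<dots> = of_real (cmod z)"
    using False by (simp add: complex_norm_square[symmetric] power2_eq_square)
  finally show ?thesis .
qed simp

text \<open>The two pairs of test functions dualise \<open>b - \<langle>b\<rangle>\<close> on one of the cubes against the constant \<open>1\<close> on
  the other. The kernel error is bounded by a small multiple of the same pair of oscillations and absorbed.\<close>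

lemma oscillation_testing:
  fixes b :: "real ^ 'd \<Rightarrow> complex" and K :: "real ^ 'd \<Rightarrow> real ^ 'd \<Rightarrow> complex"
  assumes b: "locally_integrable b" and h: "0 < h"
    and sep: "0 < s" "\<And>x y. \<lbrakk>x \<in> cube c h; y \<in> cube c' h\<rbrakk> \<Longrightarrow> s \<le> dist x y"
    and unif: "\<And>e. 0 < e \<Longrightarrow> \<exists>\<delta>>0. \<forall>y\<in>cube c' h. \<forall>y'\<in>cube c' h. \<forall>x\<in>cube c h.
        dist y y' < \<delta> \<longrightarrow> cmod (K y x - K y' x) \<le> e"
    and cont: "\<And>y. y \<in> cube c' h \<Longrightarrow> continuous_on (cube c h) (K y)"
    and near: "\<And>x y. \<lbrakk>x \<in> cube c h; y \<in> cube c' h\<rbrakk> \<Longrightarrow> cmod (K y x - K0) \<le> k / 6"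
    and k: "0 < k" "k \<le> cmod K0"
    and U: "off_support_representation b K U"
  obtains f g f' g' where "test_function (cube c h) f" "test_function (cube c' h) g"
    "test_function (cube c h) f'" "test_function (cube c' h) g'"
    "osc b (cube c h) \<le> 8 / (k * (2 * h) ^ CARD('d)) *
      (cmod (LINT x|lebesgue. g x * U f x) + cmod (LINT x|lebesgue. g' x * U f' x))"
proof -
  define Q where "Q = cube c h"
  define P where "P = cube c' h"
  define v where "v = (2 * h) ^ CARD('d)"
  have v: "0 < v" "measure lebesgue Q = v" "measure lebesgue P = v"
    using h measure_lebesgue_cube[of h] by (auto simp: v_def Q_def P_def simp del: measure_completion)
  have PQ: "compact P" "compact Q" by (simp_all add: P_def Q_def)
  have [measurable]: "P \<in> sets lebesgue" "Q \<in> sets lebesgue" by (simp_all add: P_def Q_def)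
  have [measurable]: "b \<in> borel_measurable lebesgue" by (rule locally_integrable_measurable[OF b])
  define mP where "mP = average P b"
  define mQ where "mQ = average Q b"
  have avP: "(LINT x:P|lebesgue. b x) = v *\<^sub>R mP"
    using average_cube[OF h, of c' b] v(3) by (simp add: mP_def P_def del: measure_completion)
  have avQ: "(LINT x:Q|lebesgue. b x) = v *\<^sub>R mQ"
    using average_cube[OF h, of c b] v(2) by (simp add: mQ_def Q_def del: measure_completion)
  \<comment> \<open>The kernel error needs one common constant on both cubes, here
    \<open>mP\<close>; it involves \<open>a\<close> on \<open>Q\<close> and \<open>aP\<close> on
    \<open>P\<close>. Testing controls \<open>a\<close> and \<open>a2\<close>, and \<open>aP\<close>
    is reduced to \<open>a2\<close> at the cost of a factor 2.\<close>
  define a where "a = (LINT x:Q|lebesgue. cmod (b x - mP))"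
  define a2 where "a2 = (LINT x:P|lebesgue. cmod (b x - mQ))"
  define aP where "aP = (LINT x:P|lebesgue. cmod (b x - mP))"
  have nonneg: "0 \<le> a" "0 \<le> a2" "0 \<le> aP" by (simp_all add: a_def a2_def aP_def set_lebesgue_integral_def)
  have aP: "aP \<le> 2 * a2"
    using osc_le[OF b h, of c' mQ] by (simp add: osc_def aP_def a2_def mP_def P_def)
  have oscQ: "osc b Q \<le> 2 * a"
    using osc_le[OF b h, of c mP] by (simp add: a_def Q_def)
  define sP where "sP x = indicator P x *\<^sub>R cnj (sgn (b x - mQ))" for x
  define sQ where "sQ x = indicator Q x *\<^sub>R cnj (sgn (b x - mP))" for x
  define oP where "oP x = (indicator P x :: complex)" for x
  define oQ where "oQ x = (indicator Q x :: complex)" for x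
  have sgnM: "(\<lambda>x. cnj (sgn (b x - z))) \<in> borel_measurable lebesgue" for z
  proof -
    have "(\<lambda>x. cnj ((b x - z) / of_real (cmod (b x - z)))) \<in> borel_measurable lebesgue"
      by (intro measurable_compose[OF _ borel_measurable_continuous_onI[of cnj]] borel_measurable_divide)
        (auto intro!: continuous_intros)
    then show ?thesis by (simp add: sgn_eq)
  qed
  have test: "test_function P sP" "test_function Q sQ" "test_function P oP" "test_function Q oQ"
    using sgnM unfolding test_function_def sP_def sQ_def oP_def oQ_def
    by (auto simp: indicator_def norm_sgn intro!: borel_measurable_scaleR)
  have bQ: "set_integrable lebesgue Q b" and bP: "set_integrable lebesgue P b"
    using set_integrable_compact[OF b] PQ by auto
  define J where "J = v * aP + v * a"
  note unif' = unif[folded P_def Q_def] and cont' = cont[folded P_def Q_def] and near' = near[folded P_def Q_def]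
  have J0: "0 \<le> J" using nonneg v by (simp add: J_def)
  have form: "cmod K0 * cmod (LINT y|lebesgue. g y * (b y * (LINT x|lebesgue. f x) - (LINT x|lebesgue. b x * f x)))
      \<le> cmod (LINT x|lebesgue. g x * U f x) + k / 6 * J"
    if f: "test_function Q f" and g: "test_function P g" for f g
  proof -
    have "separated_supports f g"
      unfolding separated_supports_def using test_function_support(1)[OF f PQ(2)] test_function_support(1)[OF g PQ(1)] sep
      by (intro exI[of _ s]) (auto simp: P_def Q_def)
    then have eq: "(LINT x|lebesgue. g x * U f x) = (LINT y|lebesgue. LINT x|lebesgue. (b y - b x) * K y x * f x * g y)"
      using U test_function_support(2)[OF f PQ(2)] test_function_support(2)[OF g PQ(1)]
      unfolding off_support_representation_def by blast
    have "cmod ((LINT x|lebesgue. g x * U f x)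
      - K0 * (LINT y|lebesgue. g y * (b y * (LINT x|lebesgue. f x) - (LINT x|lebesgue. b x * f x)))) \<le> k / 6 * J"
      unfolding eq J_def aP_def a_def using kernel_form_near_constant[OF b PQ f g unif' cont' near', of mP]
      unfolding v by blast
    then show ?thesis
      by (smt (verit, best) norm_mult norm_minus_commute norm_triangle_sub)
  qed
  have P1: "(LINT y|lebesgue. oP y * (b y * z - w)) = v *\<^sub>R (mP * z - w)" for z w
  proof -
    have "(LINT y|lebesgue. oP y * (b y * z - w)) = (LINT y:P|lebesgue. b y * z - w)"
      unfolding set_lebesgue_integral_def oP_def
      by (intro Bochner_Integration.integral_cong) (auto simp: indicator_def)
    also have "\<dots> = (LINT y:P|lebesgue. b y * z) - (LINT y:P|lebesgue. w)"
      using bP set_integrable_compact[OF locally_integrable_const PQ(1)]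
      by (intro set_integral_diff) (auto intro: set_integrable_mult_left)
    also have "(LINT y:P|lebesgue. w) = v *\<^sub>R w"
      using set_lebesgue_integral_const_cube[of c' h w] v(3) by (simp add: P_def del: measure_completion)
    also have "(LINT y:P|lebesgue. b y * z) = v *\<^sub>R mP * z"
      using avP by simp
    finally show ?thesis by (simp add: scaleR_diff_right)
  qed
  \<comment> \<open>Testing with 1 on \<open>P\<close> replaces \<open>b y\<close> by its mean
    \<open>mP\<close>, so the phase \<open>sQ\<close> meets exactly \<open>b - mP\<close>.\<close>
  have I1: "(LINT y|lebesgue. oP y * (b y * (LINT x|lebesgue. sQ x) - (LINT x|lebesgue. b x * sQ x))) = - (v *\<^sub>R of_real a)"
  proof -
    have ints: "integrable lebesgue sQ" "integrable lebesgue (\<lambda>x. b x * sQ x)"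
      using integrable_mult_test_function[OF locally_integrable_const PQ(2) test(2), of 1]
        integrable_mult_test_function[OF b PQ(2) test(2)] by auto
    have "(LINT x|lebesgue. b x * sQ x) - mP * (LINT x|lebesgue. sQ x) = (LINT x|lebesgue. b x * sQ x - mP * sQ x)"
      using ints by simp
    also have "\<dots> = (LINT x|lebesgue. of_real (indicator Q x *\<^sub>R cmod (b x - mP)))"
      by (intro Bochner_Integration.integral_cong) 
         (auto simp: sQ_def indicator_def mult_cnj_sgn left_diff_distrib[symmetric])
    also have "\<dots> = of_real a" unfolding a_def set_lebesgue_integral_def
      using set_integrable_cmod_diff[OF b PQ(2), of mP] by (intro integral_of_real) (simp add: set_integrable_def)
    finally have "mP * (LINT x|lebesgue. sQ x) - (LINT x|lebesgue. b x * sQ x) = - of_real a"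
      by (metis minus_diff_eq)
    then show ?thesis unfolding P1 by simp
  qed
  have I2: "(LINT y|lebesgue. sP y * (b y * (LINT x|lebesgue. oQ x) - (LINT x|lebesgue. b x * oQ x))) = v *\<^sub>R of_real a2"
  proof -
    have "(LINT x|lebesgue. oQ x) = (LINT x:Q|lebesgue. 1)"
      unfolding set_lebesgue_integral_def oQ_def
      by (intro Bochner_Integration.integral_cong) (auto simp: indicator_def)
    also have "\<dots> = of_real v"
      using set_lebesgue_integral_const_cube[of c h 1] v(2) by (simp add: Q_def scaleR_conv_of_real del: measure_completion)
    finally have F0: "(LINT x|lebesgue. oQ x) = of_real v" .
    have "(LINT x|lebesgue. b x * oQ x) = (LINT x:Q|lebesgue. b x)"
      unfolding set_lebesgue_integral_def oQ_def
      by (intro Bochner_Integration.integral_cong) (auto simp: indicator_def)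
    then have F1: "(LINT x|lebesgue. b x * oQ x) = of_real v * mQ" using avQ by (simp add: scaleR_conv_of_real)
    have "(LINT y|lebesgue. sP y * (b y * of_real v - of_real v * mQ)) = (LINT y|lebesgue. of_real (v * (indicator P y *\<^sub>R cmod (b y - mQ))))"
    proof (rule Bochner_Integration.integral_cong[OF refl])
      fix y
      have "sP y * (b y * of_real v - of_real v * mQ) = of_real v * (indicator P y *\<^sub>R ((b y - mQ) * cnj (sgn (b y - mQ))))"
        by (simp add: sP_def algebra_simps)
      then show "sP y * (b y * of_real v - of_real v * mQ) = of_real (v * (indicator P y *\<^sub>R cmod (b y - mQ)))"
        by (simp add: mult_cnj_sgn scaleR_conv_of_real)
    qed
    also have "\<dots> = of_real (LINT y|lebesgue. v * (indicator P y *\<^sub>R cmod (b y - mQ)))"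
      using set_integrable_cmod_diff[OF b PQ(1), of mQ]
      by (intro integral_of_real integrable_mult_right) (simp add: set_integrable_def)
    also have "\<dots> = v *\<^sub>R of_real a2" by (simp add: a2_def set_lebesgue_integral_def scaleR_conv_of_real)
    finally show ?thesis unfolding F0 F1 .
  qed
  define X1 where "X1 = cmod (LINT x|lebesgue. oP x * U sQ x)"
  define X2 where "X2 = cmod (LINT x|lebesgue. sP x * U oQ x)"
  have "k * (v * a) \<le> cmod K0 * (v * a)" using k nonneg v by (intro mult_right_mono) auto
  also have "\<dots> \<le> X1 + k / 6 * J"
    using form[OF test(2,3)] unfolding I1 X1_def using nonneg v by simp
  finally have e1: "k * (v * a) \<le> X1 + k / 6 * J" .
  have "k * (v * a2) \<le> cmod K0 * (v * a2)" using k nonneg v by (intro mult_right_mono) auto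
  also have "\<dots> \<le> X2 + k / 6 * J"
    using form[OF test(4,1)] unfolding I2 X2_def using nonneg v by simp
  finally have e2: "k * (v * a2) \<le> X2 + k / 6 * J" .
  \<comment> \<open>The error \<open>k / 6 * J\<close> occurs once from \<open>e1\<close> and twice
    from \<open>e2\<close>, in total half of \<open>k * J\<close>. This fixes the tolerance
    1/6.\<close>
  have "k * J = k * (v * aP) + k * (v * a)" by (simp add: J_def algebra_simps)
  also have "k * (v * aP) \<le> k * (v * (2 * a2))" using aP k v by (intro mult_left_mono) auto
  finally have kJ: "k * J \<le> 2 * X2 + X1 + k * J / 2" using e1 e2 by (simp add: algebra_simps)
  have "k * (v * a) \<le> k * J" using k v nonneg by (intro mult_left_mono) (auto simp: J_def)
  also have "\<dots> \<le> 4 * (X1 + X2)"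
  proof -
    have "0 \<le> X1" by (simp add: X1_def)
    moreover have "t \<le> 4 * (X1 + X2)" if "0 \<le> X1" "t \<le> 2 * X2 + X1 + t / 2" for t :: real
      using that by argo
    ultimately show ?thesis using kJ by blast
  qed
  finally have "a \<le> 4 * (X1 + X2) / (k * v)" using k v by (simp add: field_simps)
  then have "osc b Q \<le> 2 * (4 * (X1 + X2) / (k * v))" using oscQ by linarith
  also have "\<dots> = 8 / (k * v) * (X1 + X2)" by simp
  finally have "osc b Q \<le> 8 / (k * v) * (X1 + X2)" .
  then show thesis
    using that[of sQ oP oQ sP] test unfolding X1_def X2_def P_def Q_def v_def by auto
qed

section \<open>Kernel estimates: companion cubes and uniform continuity off the diagonal\<close>

lemma modulus_small:
  assumes "modulus_of_continuity \<omega>" "0 < e"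
  obtains \<delta> where "0 < \<delta>" "\<And>t. \<lbrakk>0 < t; t < \<delta>\<rbrakk> \<Longrightarrow> \<omega> t < e"
proof -
  have "(\<omega> \<longlongrightarrow> 0) (at 0 within {0..})" using assms by (simp add: modulus_of_continuity_def)
  \<comment> \<open>The limit says nothing about \<omega> at 0 itself, hence the restriction to
    positive \<open>t\<close>; later uses reach smaller arguments by monotonicity.\<close>
  from tendstoD[OF this assms(2)] obtain \<delta> where
    \<delta>: "0 < \<delta>" "\<And>t. \<lbrakk>0 \<le> t; t \<noteq> 0; dist t 0 < \<delta>\<rbrakk> \<Longrightarrow> dist (\<omega> t) 0 < e"
    unfolding eventually_at by auto
  have "\<omega> t < e" if "0 < t" "t < \<delta>" for t
    using \<delta>(2)[of t] that by (auto simp: dist_real_def)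
  then show thesis using that \<delta>(1) by blast
qed

text \<open>Non-degeneracy is applied at scale \<open>A * h\<close> with \<open>A\<close> large:
  \<open>K c' c\<close> is then large compared with its variation when both points move inside cubes
  of half side \<open>h\<close>. The size bound for the kernel keeps \<open>c'\<close> from being
  too far away, so one dilation factor \<open>2 ^ m\<close> serves all cubes.\<close>

lemma kernel_point:
  fixes K :: "real ^ 'd \<Rightarrow> real ^ 'd \<Rightarrow> complex"
  assumes K: "CZ_kernel \<omega> K" and nd: "nondegenerate_kernel K"
  obtains B \<kappa> m where "0 < B" "0 < \<kappa>"
    "\<And>c h. 0 < h \<Longrightarrow> \<exists>c'. cube c' h \<subseteq> cube c (2 ^ m * h) \<and>
      (\<exists>k. k * h ^ CARD('d) = \<kappa> \<and> k \<le> cmod (K c' c) \<and>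
      (\<forall>x\<in>cube c h. \<forall>y\<in>cube c' h. B * h \<le> norm (y - x) \<and> cmod (K y x - K c' c) \<le> k / 6))"
proof -
  let ?d = "CARD('d)"
  obtain CK where CK: "\<And>x y. x \<noteq> y \<Longrightarrow> cmod (K x y) \<le> CK / norm (x - y) ^ ?d"
    using K unfolding CZ_kernel_def by blast
  have reg: "cmod (K x y - K x' y) + cmod (K y x - K y x') \<le> 1 / norm (x - y) ^ ?d * \<omega> (norm (x - x') / norm (x - y))"
    if "x \<noteq> y" "norm (x - x') \<le> 1 / 2 * norm (x - y)" for x x' y
    using K that unfolding CZ_kernel_def by blast
  have \<omega>: "mono_on {0..} \<omega>" "\<And>t. 0 \<le> t \<Longrightarrow> 0 \<le> \<omega> t" "(\<omega> \<longlongrightarrow> 0) (at 0 within {0..})"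
    using K unfolding CZ_kernel_def modulus_of_continuity_def by blast+
  obtain cK where cK: "0 < cK" and nd': "\<And>x \<rho>. 0 < \<rho> \<Longrightarrow> \<exists>y. norm (x - y) \<ge> cK * \<rho> \<and> cmod (K y x) \<ge> cK / \<rho> ^ ?d"
    using nd unfolding nondegenerate_kernel_def by blast
  \<comment> \<open>Chosen so that at distance \<open>r0 / 2\<close> the regularity bound is exactly
    \<open>k / 12\<close>; two such moves give \<open>k / 6\<close>.\<close>
  define \<eta> where "\<eta> = cK / 12 * (cK / 2) ^ ?d"
  have eta: "0 < \<eta>" using cK by (simp add: \<eta>_def)
  obtain \<delta> where \<delta>: "0 < \<delta>" "\<And>t. \<lbrakk>0 < t; t < \<delta>\<rbrakk> \<Longrightarrow> \<omega> t < \<eta>"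
    using modulus_small[OF _ eta] K unfolding CZ_kernel_def by blast
  define \<tau> where "\<tau> = min (\<delta> / 2) (1 / 4)"
  have tau: "0 < \<tau>" "\<tau> \<le> 1 / 4" "\<omega> \<tau> < \<eta>" using \<delta> by (auto simp: \<tau>_def)
  \<comment> \<open>Chosen so that a displacement by \<open>CARD('d) * h\<close> relative to the
    distance \<open>r0 / 2\<close> is exactly \<tau>.\<close>
  define A where "A = 2 * real ?d / (cK * \<tau>)"
  have A: "0 < A" "2 * real ?d = cK * A * \<tau>" using cK tau by (auto simp: A_def)
  \<comment> \<open>The 1 makes \<kappa> at most its own power, which avoids taking a root of
    \<open>CK / cK\<close> when distances are compared.\<close>
  define \<kappa> where "\<kappa> = max 1 (CK / cK)"
  obtain m where m: "\<kappa> * A + 1 < 2 ^ m" using real_arch_pow[of 2 "\<kappa> * A + 1"] by auto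
  have "\<exists>c'. cube c' h \<subseteq> cube c (2 ^ m * h) \<and>
    (\<exists>k. k * h ^ ?d = cK / A ^ ?d \<and> k \<le> cmod (K c' c) \<and>
    (\<forall>x\<in>cube c h. \<forall>y\<in>cube c' h. cK * A / 2 * h \<le> norm (y - x) \<and> cmod (K y x - K c' c) \<le> k / 6))"
    if h: "0 < h" for c h
  proof -
    define r0 where "r0 = cK * (A * h)"
    have r0: "0 < r0" using cK A h by (simp add: r0_def)
    obtain c' where c': "r0 \<le> norm (c - c')" "cK / (A * h) ^ ?d \<le> cmod (K c' c)"
      using nd'[of "A * h" c] A h by (auto simp: r0_def)
    define k where "k = cK / (A * h) ^ ?d"
    have k: "0 < k" using cK A h by (simp add: k_def)
    have ne: "c \<noteq> c'" using c' r0 by auto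
    have dh: "2 * (real ?d * h) = r0 * \<tau>" using A by (simp add: r0_def)
    have dh4: "real ?d * h \<le> r0 / 8" using dh tau r0 mult_left_mono[of \<tau> "1/4" r0] by linarith
    have upper: "norm (c - c') \<le> \<kappa> * (A * h)"
    proof -
      have "cK / (A * h) ^ ?d \<le> CK / norm (c' - c) ^ ?d" using c'(2) CK[of c' c] ne by auto
      then have "norm (c' - c) ^ ?d \<le> CK / cK * (A * h) ^ ?d"
        using cK A h ne by (simp add: field_simps)
      also have "\<dots> \<le> \<kappa> ^ ?d * (A * h) ^ ?d"
      proof (intro mult_right_mono)
        have "CK / cK \<le> \<kappa>" by (simp add: \<kappa>_def)
        also have "\<kappa> \<le> \<kappa> ^ ?d" by (rule self_le_power) (auto simp: \<kappa>_def)
        finally show "CK / cK \<le> \<kappa> ^ ?d" .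
      qed (use A h in auto)
      finally have "norm (c' - c) ^ ?d \<le> (\<kappa> * (A * h)) ^ ?d" by (simp add: power_mult_distrib)
      then have "norm (c' - c) \<le> \<kappa> * (A * h)"
        using A h by (subst (asm) power_mono_iff) (auto simp: \<kappa>_def)
      then show ?thesis by (simp add: norm_minus_commute)
    qed
    have incl: "cube c' h \<subseteq> cube c (2 ^ m * h)"
    proof (rule cube_subset_cube)
      fix i
      have "\<bar>c' $ i - c $ i\<bar> \<le> norm (c' - c)" using component_le_norm_cart[of "c' - c" i] by simp
      also have "\<dots> \<le> \<kappa> * (A * h)" using upper by (simp add: norm_minus_commute)
      finally have "\<bar>c' $ i - c $ i\<bar> + h \<le> (\<kappa> * A + 1) * h" by (simp add: algebra_simps)
      also have "\<dots> \<le> 2 ^ m * h" using m h by (intro mult_right_mono) auto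
      finally show "\<bar>c' $ i - c $ i\<bar> + h \<le> 2 ^ m * h" .
    qed
    have small: "1 / n ^ ?d * \<omega> (t / n) \<le> k / 12" if "r0 / 2 \<le> n" "0 \<le> t" "t \<le> real ?d * h" for n t
    proof -
      have n: "0 < n" using that r0 by linarith
      have "t / n \<le> (real ?d * h) / (r0 / 2)" using that r0 n h by (intro frac_le) auto
      also have "\<dots> = \<tau>" using dh r0 by (simp add: field_simps)
      finally have "\<omega> (t / n) \<le> \<omega> \<tau>" using that n tau by (intro mono_onD[OF \<omega>(1)]) auto
      then have "1 / n ^ ?d * \<omega> (t / n) \<le> 1 / (r0 / 2) ^ ?d * \<eta>"
        using tau that n r0 \<omega>(2)[of "t / n"] by (intro mult_mono divide_left_mono power_mono) auto
      also have "\<dots> = k / 12"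
        using cK A h by (simp add: r0_def k_def \<eta>_def power_mult_distrib power_divide field_simps)
      finally show ?thesis .
    qed
    have "cK * A / 2 * h \<le> norm (y - x) \<and> cmod (K y x - K c' c) \<le> k / 6"
      if x: "x \<in> cube c h" and y: "y \<in> cube c' h" for x y
    proof -
      have nx: "norm (x - c) \<le> real ?d * h" and ny: "norm (y - c') \<le> real ?d * h"
        using norm_le_cube x y by blast+
      have 1: "norm (c - c') \<le> norm (x - c) + norm (c' - x)"
        using norm_triangle_ineq[of "c - x" "x - c'"] by (simp add: norm_minus_commute)
      have 2: "norm (c' - x) \<le> norm (y - c') + norm (y - x)"
        using norm_triangle_ineq[of "c' - y" "y - x"] by (simp add: norm_minus_commute)
      have far: "r0 / 2 \<le> norm (c' - x)" using 1 nx c'(1) dh4 r0 by linarith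
      have "r0 / 2 \<le> norm (y - x)" using 1 2 nx ny c'(1) dh4 r0 by linarith
      then have sep: "cK * A / 2 * h \<le> norm (y - x)" by (simp add: r0_def)
      have "c' \<noteq> x" using far r0 by auto
      have "cmod (K c' x - K y x) + cmod (K x c' - K x y) \<le> 1 / norm (c' - x) ^ ?d * \<omega> (norm (c' - y) / norm (c' - x))"
        using ny far dh4 r0 by (intro reg \<open>c' \<noteq> x\<close>) (simp add: norm_minus_commute)
      also have "\<dots> \<le> k / 12" using ny far by (intro small) (auto simp: norm_minus_commute)
      finally have a: "cmod (K c' x - K y x) \<le> k / 12" using norm_ge_zero[of "K x c' - K x y"] by linarith
      have "cmod (K c c' - K x c') + cmod (K c' c - K c' x) \<le> 1 / norm (c - c') ^ ?d * \<omega> (norm (c - x) / norm (c - c'))"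
        using nx c' dh4 r0 by (intro reg ne) (simp add: norm_minus_commute)
      also have "\<dots> \<le> k / 12" using nx c' r0 by (intro small) (auto simp: norm_minus_commute)
      finally have b: "cmod (K c' c - K c' x) \<le> k / 12" using norm_ge_zero[of "K c c' - K x c'"] by linarith
      have "cmod (K y x - K c' c) \<le> cmod (K c' x - K y x) + cmod (K c' c - K c' x)"
        using norm_triangle_ineq[of "K y x - K c' x" "K c' x - K c' c"] by (simp add: norm_minus_commute)
      then show ?thesis using a b sep by simp
    qed
    moreover have "k * h ^ ?d = cK / A ^ ?d" using h by (simp add: k_def power_mult_distrib)
    ultimately show ?thesis using incl c'(2) unfolding k_def by blast
  qed
  moreover have "0 < cK * A / 2" "0 < cK / A ^ ?d" using cK A by auto
  ultimately show thesis using that[of "cK * A / 2" "cK / A ^ ?d" m] by blast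
qed

text \<open>In \<delta> the bound \<open>s / 2\<close> makes the regularity estimate applicable, and
  the other bound keeps the argument of \<omega> at most \<tau>/2. This supplies the continuity
  hypotheses that yield measurability of the off-support form.\<close>

lemma CZ_kernel_continuity:
  fixes K :: "real ^ 'd \<Rightarrow> real ^ 'd \<Rightarrow> complex"
  assumes K: "CZ_kernel \<omega> K" and s: "0 < s" and e: "0 < e"
  shows "\<exists>\<delta>>0. \<forall>x x' y. s \<le> norm (x - y) \<longrightarrow> dist x x' < \<delta> \<longrightarrow>
    cmod (K x y - K x' y) \<le> e \<and> cmod (K y x - K y x') \<le> e"
proof -
  let ?d = "CARD('d)"
  have reg: "cmod (K x y - K x' y) + cmod (K y x - K y x') \<le> 1 / norm (x - y) ^ ?d * \<omega> (norm (x - x') / norm (x - y))"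
    if "x \<noteq> y" "norm (x - x') \<le> 1 / 2 * norm (x - y)" for x x' y
    using K that unfolding CZ_kernel_def by blast
  have \<omega>: "mono_on {0..} \<omega>" "\<And>t. 0 \<le> t \<Longrightarrow> 0 \<le> \<omega> t" "(\<omega> \<longlongrightarrow> 0) (at 0 within {0..})"
    using K unfolding CZ_kernel_def modulus_of_continuity_def by blast+
  have "0 < e * s ^ ?d" using e s by simp
  then obtain \<tau> where \<tau>: "0 < \<tau>" "\<And>t. \<lbrakk>0 < t; t < \<tau>\<rbrakk> \<Longrightarrow> \<omega> t < e * s ^ ?d"
    using modulus_small K unfolding CZ_kernel_def by blast
  define \<delta> where "\<delta> = min (s / 2) (s * (\<tau> / 2))"
  have "cmod (K x y - K x' y) \<le> e \<and> cmod (K y x - K y x') \<le> e"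
    if xy: "s \<le> norm (x - y)" "dist x x' < \<delta>" for x x' y
  proof -
    have ne: "x \<noteq> y" using xy s by auto
    then have n: "0 < norm (x - y)" by simp
    have "norm (x - x') / norm (x - y) \<le> (s * (\<tau> / 2)) / s"
      using xy s \<tau>(1) by (intro frac_le) (auto simp: \<delta>_def dist_norm zero_le_mult_iff)
    then have "\<omega> (norm (x - x') / norm (x - y)) \<le> \<omega> (\<tau> / 2)"
      using s \<tau> by (intro mono_onD[OF \<omega>(1)]) auto
    also have "\<dots> < e * s ^ ?d" using \<tau> by simp
    finally have w: "\<omega> (norm (x - x') / norm (x - y)) \<le> e * s ^ ?d" by simp
    have "cmod (K x y - K x' y) + cmod (K y x - K y x') \<le> 1 / norm (x - y) ^ ?d * \<omega> (norm (x - x') / norm (x - y))"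
      using xy by (intro reg ne) (auto simp: \<delta>_def dist_norm)
    also have "\<dots> \<le> 1 / s ^ ?d * (e * s ^ ?d)"
      using w s xy n \<omega>(2)[of "norm (x - x') / norm (x - y)"] mult_pos_pos[OF zero_less_power[OF n] zero_less_power[OF s]] by (intro mult_mono divide_left_mono power_mono) auto
    also have "\<dots> = e" using s by simp
    finally show ?thesis using norm_ge_zero[of "K x y - K x' y"] norm_ge_zero[of "K y x - K y x'"] by linarith
  qed
  moreover have "0 < \<delta>" using s \<tau> by (simp add: \<delta>_def)
  ultimately show ?thesis by blast
qed

text \<open>The quantifier order matters: \<open>C\<close> and \<open>m\<close> depend on the kernel
  only. The companion cube is forgotten in favour of a concentric dilate, so that later only the
  families \<open>dcube (2 ^ m)\<close> occur.\<close>

lemma oscillation_bound: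
  fixes K :: "real ^ 'd \<Rightarrow> real ^ 'd \<Rightarrow> complex"
  assumes K: "CZ_kernel \<omega> K" and nd: "nondegenerate_kernel K"
  shows "\<exists>C>0. \<exists>m. \<forall>c h b U. 0 < h \<longrightarrow> locally_integrable b \<longrightarrow> off_support_representation b K U \<longrightarrow>
    (\<exists>f g f' g'. test_function (cube c h) f \<and> test_function (cube c (2 ^ m * h)) g \<and>
      test_function (cube c h) f' \<and> test_function (cube c (2 ^ m * h)) g' \<and>
      osc b (cube c h) \<le> C * (cmod (LINT x|lebesgue. g x * U f x) + cmod (LINT x|lebesgue. g' x * U f' x)))"
proof -
  let ?d = "CARD('d)"
  show ?thesis
  proof (rule kernel_point[OF K nd])
    fix B \<kappa> m assume B: "0 < B" and \<kappa>: "0 < \<kappa>" and pt: "\<And>c h. 0 < h \<Longrightarrow> \<exists>c'. cube c' h \<subseteq> cube c (2 ^ m * h) \<and>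
      (\<exists>k. k * h ^ ?d = \<kappa> \<and> k \<le> cmod (K c' c) \<and>
      (\<forall>x\<in>cube c h. \<forall>y\<in>cube c' h. B * h \<le> norm (y - x) \<and> cmod (K y x - K c' c) \<le> k / 6))"
    have "\<exists>f g f' g'. test_function (cube c h) f \<and> test_function (cube c (2 ^ m * h)) g \<and>
        test_function (cube c h) f' \<and> test_function (cube c (2 ^ m * h)) g' \<and>
        osc b (cube c h) \<le> 8 / (\<kappa> * 2 ^ ?d) * (cmod (LINT x|lebesgue. g x * U f x) + cmod (LINT x|lebesgue. g' x * U f' x))"
      if h: "0 < h" and b: "locally_integrable b" and U: "off_support_representation b K U" for c h b U
    proof -
      obtain c' k where c': "cube c' h \<subseteq> cube c (2 ^ m * h)" and k: "k * h ^ ?d = \<kappa>" "k \<le> cmod (K c' c)"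
        and near: "\<And>x y. \<lbrakk>x \<in> cube c h; y \<in> cube c' h\<rbrakk> \<Longrightarrow> B * h \<le> norm (y - x) \<and> cmod (K y x - K c' c) \<le> k / 6"
        using pt[OF h, of c] by blast
      have s: "0 < B * h" using B h by simp
      have "0 < k" using k(1) \<kappa> h by (metis zero_less_mult_pos2 zero_less_power)
      have mono: "test_function (cube c (2 ^ m * h)) g" if "test_function (cube c' h) g" for g
      proof -
        have "indicator (cube c' h) x \<le> (indicator (cube c (2 ^ m * h)) x :: real)" for x
          using c' by (auto simp: indicator_def)
        then show ?thesis using that unfolding test_function_def by (meson order_trans)
      qed
      show ?thesis
      proof (rule oscillation_testing[OF b h s _ _ _ _ \<open>0 < k\<close> k(2) U, of c c'])
        fix x y assume "x \<in> cube c h" "y \<in> cube c' h"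
        from near[OF this] show "B * h \<le> dist x y" "cmod (K y x - K c' c) \<le> k / 6"
          by (auto simp: dist_commute[of x y] dist_norm[of y x])
      next
        fix e :: real assume "0 < e"
        from CZ_kernel_continuity[OF K s this] near
        show "\<exists>\<delta>>0. \<forall>y\<in>cube c' h. \<forall>y'\<in>cube c' h. \<forall>x\<in>cube c h. dist y y' < \<delta> \<longrightarrow> cmod (K y x - K y' x) \<le> e"
          by meson
      next
        fix y assume y: "y \<in> cube c' h"
        show "continuous_on (cube c h) (K y)"
          unfolding continuous_on_iff
        proof (intro ballI allI impI)
          fix x and e :: real assume x: "x \<in> cube c h" and e: "0 < e"
          then have e2: "0 < e / 2" by simp
          obtain \<delta> where \<delta>: "0 < \<delta>" "\<And>x x' y. \<lbrakk>B * h \<le> norm (x - y); dist x x' < \<delta>\<rbrakk> \<Longrightarrow> cmod (K y x - K y x') \<le> e / 2"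
            using CZ_kernel_continuity[OF K s e2] by meson
          have far: "B * h \<le> norm (x - y)" using near[OF x y] by (simp add: norm_minus_commute)
          show "\<exists>d>0. \<forall>x'\<in>cube c h. dist x' x < d \<longrightarrow> dist (K y x') (K y x) < e"
          proof (intro exI[of _ \<delta>] conjI ballI impI)
            fix x' assume "dist x' x < \<delta>"
            then have "cmod (K y x - K y x') \<le> e / 2" using \<delta>(2)[OF far, of x'] by (simp add: dist_commute)
            then show "dist (K y x') (K y x) < e" using e by (simp add: dist_norm norm_minus_commute)
          qed (rule \<delta>)
        qed
      next
        fix f g f' g'
        assume t: "test_function (cube c h) f" "test_function (cube c' h) g"
          "test_function (cube c h) f'" "test_function (cube c' h) g'"
          "osc b (cube c h) \<le> 8 / (k * (2 * h) ^ ?d) *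
            (cmod (LINT x|lebesgue. g x * U f x) + cmod (LINT x|lebesgue. g' x * U f' x))"
        \<comment> \<open>The side length cancels here, which makes the constant the same for all
          cubes.\<close>
        have "k * (2 * h) ^ ?d = \<kappa> * 2 ^ ?d" using k(1) by (simp add: power_mult_distrib mult_ac)
        note t5 = t(5)[unfolded this]
        show ?thesis
          by (intro exI conjI) (rule t(1), rule mono[OF t(2)], rule t(3), rule mono[OF t(4)], rule t5)
      qed
    qed
    moreover have "0 < 8 / (\<kappa> * 2 ^ ?d)" using \<kappa> by simp
    ultimately show ?thesis by blast
  qed
qed

subsection \<open>Random signs and duality\<close>

text \<open>The additive constant \<open>z\<close> is what makes the induction work: it absorbs the new diagonal term.\<close>

lemma sign_choice:
  fixes m :: "'i \<Rightarrow> 'i \<Rightarrow> complex"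
  assumes "finite S"
  shows "\<exists>\<sigma> :: 'i \<Rightarrow> real. (\<forall>i. \<bar>\<sigma> i\<bar> = 1) \<and>
    cmod (z + (\<Sum>i\<in>S. m i i)) \<le> cmod (z + (\<Sum>i\<in>S. \<Sum>j\<in>S. of_real (\<sigma> i * \<sigma> j) * m i j))"
  using assms
proof (induction S arbitrary: z rule: finite_induct)
  case empty
  show ?case by (intro exI[of _ "\<lambda>_. 1"]) simp
next
  case (insert n S)
  obtain \<sigma> :: "'i \<Rightarrow> real" where \<sigma>: "\<And>i. \<bar>\<sigma> i\<bar> = 1"
    "cmod (z + m n n + (\<Sum>i\<in>S. m i i)) \<le> cmod (z + m n n + (\<Sum>i\<in>S. \<Sum>j\<in>S. of_real (\<sigma> i * \<sigma> j) * m i j))"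
    using insert.IH[of "z + m n n"] by blast
  define w where "w = z + m n n + (\<Sum>i\<in>S. \<Sum>j\<in>S. of_real (\<sigma> i * \<sigma> j) * m i j)"
  define v where "v = (\<Sum>j\<in>S. of_real (\<sigma> j) * m n j) + (\<Sum>i\<in>S. of_real (\<sigma> i) * m i n)"
  \<comment> \<open>\<open>v\<close> collects the cross terms of the new index. As \<open>w\<close>
    is the midpoint of \<open>w + v\<close> and \<open>w - v\<close>, one sign does not decrease the
    modulus; the new diagonal term is unchanged because the sign squares to 1.\<close>
  have "2 * cmod w = cmod ((w + v) + (w - v))" by (simp add: norm_mult)
  also have "\<dots> \<le> cmod (w + v) + cmod (w - v)" by (rule norm_triangle_ineq)
  finally have "cmod w \<le> cmod (w + of_real 1 * v) \<or> cmod w \<le> cmod (w + of_real (- 1) * v)" by (simp) linarith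
  then obtain e :: real where e: "\<bar>e\<bar> = 1" "cmod w \<le> cmod (w + of_real e * v)"
    by (metis abs_minus_cancel abs_one)
  have e2: "of_real e * of_real e = (1 :: complex)"
    using e(1) by (metis abs_mult_self_eq mult_1 of_real_1 of_real_mult)
  let ?s = "\<sigma>(n := e)"
  have S: "(\<Sum>i\<in>S. \<Sum>j\<in>S. of_real (?s i * ?s j) * m i j) = (\<Sum>i\<in>S. \<Sum>j\<in>S. of_real (\<sigma> i * \<sigma> j) * m i j)"
    using insert.hyps(2) by (intro sum.cong) auto
  have S1: "(\<Sum>j\<in>S. of_real (?s n * ?s j) * m n j) = of_real e * (\<Sum>j\<in>S. of_real (\<sigma> j) * m n j)"
    unfolding sum_distrib_left using insert.hyps(2) by (intro sum.cong) auto
  have S2: "(\<Sum>i\<in>S. of_real (?s i * ?s n) * m i n) = of_real e * (\<Sum>i\<in>S. of_real (\<sigma> i) * m i n)"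
    unfolding sum_distrib_left using insert.hyps(2) by (intro sum.cong) auto
  have "z + (\<Sum>i\<in>insert n S. \<Sum>j\<in>insert n S. of_real (?s i * ?s j) * m i j)
      = z + ((of_real (?s n * ?s n) * m n n + (\<Sum>i\<in>S. of_real (?s i * ?s n) * m i n)) +
        ((\<Sum>j\<in>S. of_real (?s n * ?s j) * m n j) + (\<Sum>i\<in>S. \<Sum>j\<in>S. of_real (?s i * ?s j) * m i j)))"
    using insert.hyps by (simp only: sum.insert sum.distrib not_False_eq_True)
  also have "\<dots> = w + of_real e * v"
    unfolding S S1 S2 w_def v_def using e2 by (simp add: algebra_simps)
  finally have "z + (\<Sum>i\<in>insert n S. \<Sum>j\<in>insert n S. of_real (?s i * ?s j) * m i j) = w + of_real e * v" .
  moreover have "cmod (z + (\<Sum>i\<in>insert n S. m i i)) \<le> cmod w"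
    using \<sigma>(2) insert.hyps unfolding w_def by (simp add: add.assoc)
  ultimately have "cmod (z + (\<Sum>i\<in>insert n S. m i i)) \<le> cmod (z + (\<Sum>i\<in>insert n S. \<Sum>j\<in>insert n S. of_real (?s i * ?s j) * m i j))"
    using e(2) by simp
  moreover have "\<forall>i. \<bar>?s i\<bar> = 1" using \<sigma>(1) e(1) by simp
  ultimately show ?case by blast
qed

section \<open>Weighted norms, the duality pairing and finite sums under the operator\<close>

lemma Lp_norm_altdef:
  "Lp_norm s w f = epowr (\<integral>\<^sup>+x. ennreal (cmod (f x) powr s) \<partial>weight_measure w) (1 / s)"
  by (simp add: wnorm_def epowr_ennreal)

lemma Lp_dominated:
  assumes "0 < s" "f \<in> borel_measurable lebesgue" "\<And>x. cmod (f x) \<le> F x"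
    and int: "integrable (weight_measure w) (\<lambda>x. F x powr s)"
  shows "Lp_norm s w f \<le> ennreal ((LINT x|weight_measure w. F x powr s) powr (1 / s))" "f \<in> Lp s w"
proof -
  have "(\<integral>\<^sup>+x. ennreal (cmod (f x) powr s) \<partial>weight_measure w) \<le> (\<integral>\<^sup>+x. ennreal (F x powr s) \<partial>weight_measure w)"
    using assms by (intro nn_integral_mono ennreal_leI powr_mono2) auto
  also have "\<dots> = ennreal (LINT x|weight_measure w. F x powr s)"
    using int by (intro nn_integral_eq_integral) auto
  finally have "Lp_norm s w f \<le> epowr (ennreal (LINT x|weight_measure w. F x powr s)) (1 / s)"
    unfolding Lp_norm_altdef using assms(1) by (intro epowr_mono) auto
  then show *: "Lp_norm s w f \<le> ennreal ((LINT x|weight_measure w. F x powr s) powr (1 / s))"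
    by (simp add: epowr_ennreal)
  then have "Lp_norm s w f < \<infinity>" using le_less_trans by fastforce
  then show "f \<in> Lp s w" using assms(2) by (simp add: Lp_def)
qed

text \<open>The factor \<open>lam powr (- 1 / q) * lam powr (1 / q) = 1\<close> is inserted before
  Hoelder; the q'-th power of its first half is the dual weight \<open>lam'\<close>.\<close>

lemma Lp_duality:
  fixes g h :: "real ^ 'd \<Rightarrow> complex"
  assumes q: "1 < q" "1 < q'" "1 / q + 1 / q' = 1"
    and lam: "weight lam" and lam': "weight lam'" "\<And>x. lam' x = lam x powr (- q' / q)"
    and g: "g \<in> borel_measurable lebesgue" and h: "h \<in> borel_measurable lebesgue"
  shows "(\<integral>\<^sup>+x. ennreal (cmod (g x * h x)) \<partial>lebesgue) \<le> Lp_norm q' lam' g * Lp_norm q lam h"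
proof -
  have [measurable]: "lam \<in> borel_measurable lebesgue" by (rule weight_measurable[OF lam])
  note [measurable] = g h
  have pos: "0 < lam x" for x by (rule weight_pos[OF lam])
  have "(\<integral>\<^sup>+x. ennreal (cmod (g x * h x)) \<partial>lebesgue)
      = (\<integral>\<^sup>+x. ennreal ((cmod (g x) * lam x powr (- 1 / q)) * (cmod (h x) * lam x powr (1 / q))) \<partial>lebesgue)"
  proof (intro nn_integral_cong)
    fix x
    have "lam x powr (- 1 / q) * lam x powr (1 / q) = 1" using pos[of x] by (simp flip: powr_add)
    then show "ennreal (cmod (g x * h x)) = ennreal ((cmod (g x) * lam x powr (- 1 / q)) * (cmod (h x) * lam x powr (1 / q)))"
      by (simp add: norm_mult mult_ac)
  qed
  also have "\<dots> \<le> epowr (\<integral>\<^sup>+x. ennreal ((cmod (g x) * lam x powr (- 1 / q)) powr q') \<partial>lebesgue) (1 / q') *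
      epowr (\<integral>\<^sup>+x. ennreal ((cmod (h x) * lam x powr (1 / q)) powr q) \<partial>lebesgue) (1 / q)"
    using q by (intro nn_integral_Hoelder) auto
  also have "(\<integral>\<^sup>+x. ennreal ((cmod (g x) * lam x powr (- 1 / q)) powr q') \<partial>lebesgue)
      = (\<integral>\<^sup>+x. ennreal (cmod (g x) powr q') \<partial>weight_measure lam')"
    unfolding nn_integral_weight_measure[OF lam'(1), of "\<lambda>x. ennreal (cmod (g x) powr q')", simplified]
    by (intro nn_integral_cong) (simp add: lam'(2) powr_mult powr_powr ennreal_mult'' mult.commute)
  also have "(\<integral>\<^sup>+x. ennreal ((cmod (h x) * lam x powr (1 / q)) powr q) \<partial>lebesgue)
      = (\<integral>\<^sup>+x. ennreal (cmod (h x) powr q) \<partial>weight_measure lam)"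
    unfolding nn_integral_weight_measure[OF lam, of "\<lambda>x. ennreal (cmod (h x) powr q)", simplified]
    using q pos by (intro nn_integral_cong) (simp add: powr_mult powr_powr ennreal_mult'' mult.commute less_imp_le)
  finally show ?thesis by (simp add: Lp_norm_altdef)
qed

lemma Lp_norm_cmult:
  assumes "0 < s" "f \<in> borel_measurable lebesgue"
  shows "Lp_norm s w (\<lambda>x. a * f x) = ennreal (cmod a) * Lp_norm s w f"
proof -
  have "(\<integral>\<^sup>+x. ennreal (cmod (a * f x) powr s) \<partial>weight_measure w)
      = (\<integral>\<^sup>+x. ennreal (cmod a powr s) * ennreal (cmod (f x) powr s) \<partial>weight_measure w)"
    by (intro nn_integral_cong) (simp add: norm_mult powr_mult ennreal_mult)
  also have "\<dots> = ennreal (cmod a powr s) * (\<integral>\<^sup>+x. ennreal (cmod (f x) powr s) \<partial>weight_measure w)"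
  proof (intro nn_integral_cmult)
    note [measurable] = assms(2)
    show "(\<lambda>x. ennreal (cmod (f x) powr s)) \<in> borel_measurable (weight_measure w)" by measurable
  qed
  finally show ?thesis
    using assms(1) by (simp add: Lp_norm_altdef epowr_mult epowr_ennreal powr_powr)
qed

lemma Lp_norm_cong_AE:
  assumes "weight w" "AE x in lebesgue. f x = g x"
  shows "Lp_norm s w f = Lp_norm s w g"
proof -
  have "AE x in weight_measure w. ennreal (cmod (f x) powr s) = ennreal (cmod (g x) powr s)"
    unfolding AE_weight_measure[OF assms(1)] using assms(2) by eventually_elim simp
  from nn_integral_cong_AE[OF this] show ?thesis by (simp add: Lp_norm_altdef)
qed

lemma op_norm_bound:
  assumes U: "bounded_linear_Lp p \<mu> q lam U" and pq: "0 < p" "0 < q" and lam: "weight lam" and f: "f \<in> Lp p \<mu>"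
  shows "Lp_norm q lam (U f) \<le> op_norm p \<mu> q lam U * Lp_norm p \<mu> f"
proof (cases "Lp_norm p \<mu> f = 0")
  case True
  \<comment> \<open>A function of norm 0 cannot be normalised, so the supremum is of no use here;
    boundedness forces the norm of its image to be 0.\<close>
  obtain B :: real where "Lp_norm q lam (U f) \<le> ennreal B * Lp_norm p \<mu> f"
    using U f unfolding bounded_linear_Lp_def by blast
  then show ?thesis using True by simp
next
  case False
  have fM: "f \<in> borel_measurable lebesgue" and "Lp_norm p \<mu> f < \<infinity>" using f by (auto simp: Lp_def)
  then obtain n where n: "Lp_norm p \<mu> f = ennreal n" "0 < n"
    using False by (cases "Lp_norm p \<mu> f") (auto simp: less_le)
  define f' where "f' x = of_real (1 / n) * f x" for x
  have norm': "Lp_norm p \<mu> f' = 1"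
    unfolding f'_def Lp_norm_cmult[OF pq(1) fM] n(1) using n(2) by (simp add: ennreal_mult[symmetric] norm_divide)
  have "f' \<in> borel_measurable lebesgue" unfolding f'_def using fM by (intro borel_measurable_times) auto
  then have "f' \<in> Lp p \<mu>" using norm' by (simp add: Lp_def)
  then have "Lp_norm q lam (U f') \<le> op_norm p \<mu> q lam U"
    unfolding op_norm_def using norm' by (intro SUP_upper) auto
  moreover have "AE x in lebesgue. U f' x = of_real (1 / n) * U f x"
    using U f unfolding bounded_linear_Lp_def f'_def by blast
  then have "Lp_norm q lam (U f') = Lp_norm q lam (\<lambda>x. of_real (1 / n) * U f x)"
    by (rule Lp_norm_cong_AE[OF lam])
  moreover have "\<dots> = ennreal (1 / n) * Lp_norm q lam (U f)"
  proof (subst Lp_norm_cmult[OF pq(2)])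
    show "U f \<in> borel_measurable lebesgue" using U f unfolding bounded_linear_Lp_def Lp_def by blast
  qed (use n in \<open>simp add: norm_divide\<close>)
  ultimately have "ennreal n * (ennreal (1 / n) * Lp_norm q lam (U f)) \<le> ennreal n * op_norm p \<mu> q lam U"
    by (intro mult_left_mono) auto
  then show ?thesis using n by (simp add: mult.assoc[symmetric] ennreal_mult[symmetric] mult.commute)
qed

text \<open>Additivity of \<open>U\<close> holds only almost everywhere and only on
  \<open>Lp\<close>, so the induction runs over partial sums whose membership is secured by
  domination with indicators.\<close>

lemma bounded_linear_Lp_sum:
  assumes U: "bounded_linear_Lp p \<mu> q lam U" and mu: "weight \<mu>" and p: "0 < p"
    and S: "finite S" and f: "\<And>i. i \<in> S \<Longrightarrow> test_function (dcube N i) (f i)"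
  shows "AE x in lebesgue. U (\<lambda>x. \<Sum>i\<in>S. \<alpha> i * f i x) x = (\<Sum>i\<in>S. \<alpha> i * U (f i) x)"
    and "\<And>x. cmod (\<Sum>i\<in>S. \<alpha> i * f i x) \<le> (\<Sum>i\<in>S. cmod (\<alpha> i) * indicator (dcube N i) x)"
    and "(\<lambda>x. \<Sum>i\<in>S. \<alpha> i * f i x) \<in> Lp p \<mu>"
proof -
  have dom: "cmod (\<Sum>i\<in>R. \<alpha> i * f i x) \<le> (\<Sum>i\<in>R. cmod (\<alpha> i) * indicator (dcube N i) x)"
    if "R \<subseteq> S" for R x
    by (rule sum_norm_le) (use f that in \<open>auto simp: norm_mult test_function_def intro!: mult_left_mono\<close>)
  then show "\<And>x. cmod (\<Sum>i\<in>S. \<alpha> i * f i x) \<le> (\<Sum>i\<in>S. cmod (\<alpha> i) * indicator (dcube N i) x)" by blast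
  have fM: "f i \<in> borel_measurable lebesgue" if "i \<in> S" for i using f[OF that] by (simp add: test_function_def)
  have Lp: "(\<lambda>x. \<Sum>i\<in>R. \<alpha> i * f i x) \<in> Lp p \<mu>" if "R \<subseteq> S" for R
  proof (rule Lp_dominated(2)[OF p _ dom[OF that]])
    show "(\<lambda>x. \<Sum>i\<in>R. \<alpha> i * f i x) \<in> borel_measurable lebesgue"
      using fM that by (intro borel_measurable_sum borel_measurable_times) auto
    show "integrable (weight_measure \<mu>) (\<lambda>x. (\<Sum>i\<in>R. cmod (\<alpha> i) * indicator (dcube N i) x) powr p)"
      using finite_subset[OF that S] p by (intro integrable_indicator_sum_powr mu) auto
  qed
  then show "(\<lambda>x. \<Sum>i\<in>S. \<alpha> i * f i x) \<in> Lp p \<mu>" by blast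
  have Lp1: "f i \<in> Lp p \<mu>" if "i \<in> S" for i
  proof (rule Lp_dominated(2)[OF p fM[OF that]])
    show "cmod (f i x) \<le> (\<Sum>j\<in>{i}. 1 * indicator (dcube N j) x)" for x
      using f[OF that] by (simp add: test_function_def)
    show "integrable (weight_measure \<mu>) (\<lambda>x. (\<Sum>j\<in>{i}. 1 * indicator (dcube N j) x) powr p)"
      using p by (intro integrable_indicator_sum_powr mu) auto
  qed
  have add: "AE x in lebesgue. U (\<lambda>x. f x + g x) x = U f x + U g x" if "f \<in> Lp p \<mu>" "g \<in> Lp p \<mu>" for f g
    using U that unfolding bounded_linear_Lp_def by blast
  have scale: "AE x in lebesgue. U (\<lambda>x. a * f x) x = a * U f x" if "f \<in> Lp p \<mu>" for f a
    using U that unfolding bounded_linear_Lp_def by blast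
  have "R \<subseteq> S \<longrightarrow> (AE x in lebesgue. U (\<lambda>x. \<Sum>i\<in>R. \<alpha> i * f i x) x = (\<Sum>i\<in>R. \<alpha> i * U (f i) x))"
    if "finite R" for R using that
  proof (induction R rule: finite_induct)
    case empty
    \<comment> \<open>The image of the zero function is obtained from homogeneity with scalar
      0.\<close>
    show ?case using scale[OF Lp[of "{}"], of 0] by simp
  next
    case (insert n R)
    show ?case
    proof
      assume sub: "insert n R \<subseteq> S"
      have Lpn: "(\<lambda>x. \<alpha> n * f n x) \<in> Lp p \<mu>" using Lp[of "{n}"] sub by simp
      have eq: "(\<lambda>x. \<Sum>i\<in>insert n R. \<alpha> i * f i x) = (\<lambda>x. \<alpha> n * f n x + (\<Sum>i\<in>R. \<alpha> i * f i x))"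
        using insert.hyps by simp
      have 1: "AE x in lebesgue. U (\<lambda>x. \<Sum>i\<in>insert n R. \<alpha> i * f i x) x = U (\<lambda>x. \<alpha> n * f n x) x + U (\<lambda>x. \<Sum>i\<in>R. \<alpha> i * f i x) x"
        unfolding eq using sub by (intro add Lpn Lp) auto
      have 2: "AE x in lebesgue. U (\<lambda>x. \<alpha> n * f n x) x = \<alpha> n * U (f n) x"
        using sub by (intro scale Lp1) auto
      have 3: "AE x in lebesgue. U (\<lambda>x. \<Sum>i\<in>R. \<alpha> i * f i x) x = (\<Sum>i\<in>R. \<alpha> i * U (f i) x)"
        using insert.IH sub by auto
      show "AE x in lebesgue. U (\<lambda>x. \<Sum>i\<in>insert n R. \<alpha> i * f i x) x = (\<Sum>i\<in>insert n R. \<alpha> i * U (f i) x)"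
        using 1 2 3
      proof eventually_elim
        case (elim x)
        then show ?case using insert.hyps by simp
      qed
    qed
  qed
  then show "AE x in lebesgue. U (\<lambda>x. \<Sum>i\<in>S. \<alpha> i * f i x) x = (\<Sum>i\<in>S. \<alpha> i * U (f i) x)"
    using S by blast
qed

text \<open>Phases make the diagonal terms nonnegative, and a good choice of signs makes the full
  double sum at least as large as the diagonal. That double sum is a single pairing of
  \<open>gg\<close> with \<open>U ff\<close>. Both functions have majorants independent of phases
  and signs.\<close>

lemma diagonal_sum_bound:
  assumes U: "bounded_linear_Lp p \<mu> q lam U"
    and w: "weight \<mu>" "weight lam" "weight lam'" "\<And>x. lam' x = lam x powr (- q' / q)"
    and pq: "1 < p" "1 < q" "1 < q'" "1 / q + 1 / q' = 1"
    and S: "finite S" and f: "\<And>i. i \<in> S \<Longrightarrow> test_function (dcube 1 i) (f i)"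
    and g: "\<And>i. i \<in> S \<Longrightarrow> test_function (dcube N i) (g i)"
    and a: "\<And>i. 0 \<le> a i" and c: "\<And>i. 0 \<le> c i"
  shows "ennreal (\<Sum>i\<in>S. a i * c i * cmod (LINT x|lebesgue. g i x * U (f i) x)) \<le>
    op_norm p \<mu> q lam U
      * ennreal ((LINT x|weight_measure \<mu>. (\<Sum>i\<in>S. a i * indicator (dcube 1 i) x) powr p) powr (1 / p))
      * ennreal ((LINT x|weight_measure lam'. (\<Sum>i\<in>S. c i * indicator (dcube N i) x) powr q') powr (1 / q'))"
proof -
  have p0: "0 < p" "0 < q" "0 < q'" using pq by auto
  define X where "X i j = (LINT x|lebesgue. g i x * U (f j) x)" for i j
  \<comment> \<open>The phase turns the diagonal entry into its modulus; it is attached to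
    \<open>g i\<close>, whose majorant it leaves intact.\<close>
  define \<theta> where "\<theta> i = cnj (sgn (X i i))" for i
  have theta: "cmod (\<theta> i) \<le> 1" for i by (simp add: \<theta>_def norm_sgn)
  define m where "m i j = of_real (c i) * \<theta> i * of_real (a j) * X i j" for i j
  obtain \<sigma> :: "_ \<Rightarrow> real" where \<sigma>: "\<And>i. \<bar>\<sigma> i\<bar> = 1"
    "cmod (0 + (\<Sum>i\<in>S. m i i)) \<le> cmod (0 + (\<Sum>i\<in>S. \<Sum>j\<in>S. of_real (\<sigma> i * \<sigma> j) * m i j))"
    using sign_choice[OF S, of 0 m] by blast
  define \<alpha> where "\<alpha> j = complex_of_real (\<sigma> j * a j)" for j
  define \<gamma> where "\<gamma> i = complex_of_real (\<sigma> i * c i) * \<theta> i" for i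
  define ff where "ff x = (\<Sum>j\<in>S. \<alpha> j * f j x)" for x
  define gg where "gg x = (\<Sum>i\<in>S. \<gamma> i * g i x)" for x
  have fsum: "AE x in lebesgue. U ff x = (\<Sum>j\<in>S. \<alpha> j * U (f j) x)"
      "\<And>x. cmod (ff x) \<le> (\<Sum>j\<in>S. cmod (\<alpha> j) * indicator (dcube 1 j) x)" "ff \<in> Lp p \<mu>"
    unfolding ff_def[abs_def] using bounded_linear_Lp_sum[OF U w(1) p0(1) S, where N = 1 and f = f and \<alpha> = \<alpha>] f
    by blast+
  have gM: "g i \<in> borel_measurable lebesgue" if "i \<in> S" for i using g[OF that] by (simp add: test_function_def)
  have ggM: "gg \<in> borel_measurable lebesgue" unfolding gg_def using gM by (intro borel_measurable_sum borel_measurable_times) auto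
  have ggle: "cmod (gg x) \<le> (\<Sum>i\<in>S. c i * indicator (dcube N i) x)" for x
    unfolding gg_def
  proof (rule sum_norm_le)
    fix i assume i: "i \<in> S"
    have "cmod (\<gamma> i) \<le> c i" using theta[of i] \<sigma>(1)[of i] c[of i] by (simp add: \<gamma>_def norm_mult abs_mult mult_left_le)
    then show "cmod (\<gamma> i * g i x) \<le> c i * indicator (dcube N i) x"
      unfolding norm_mult using g[OF i] c by (intro mult_mono) (auto simp: test_function_def)
  qed
  have ffle: "cmod (ff x) \<le> (\<Sum>i\<in>S. a i * indicator (dcube 1 i) x)" for x
    using fsum(2)[of x] \<sigma>(1) a by (simp add: \<alpha>_def norm_mult)
  have ffM: "ff \<in> borel_measurable lebesgue" using fsum(3) by (simp add: Lp_def)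
  have UM: "U h \<in> borel_measurable lebesgue" "Lp_norm q lam (U h) < \<infinity>" if "h \<in> Lp p \<mu>" for h
    using U that unfolding bounded_linear_Lp_def Lp_def by blast+
  have Lpf: "f j \<in> Lp p \<mu>" if "j \<in> S" for j
    using bounded_linear_Lp_sum(3)[OF U w(1) p0(1), of "{j}" 1 f "\<lambda>_. 1"] f[OF that] by simp
  have gnorm: "Lp_norm q' lam' (g i) < \<infinity>" if "i \<in> S" for i
  proof -
    have "g i \<in> Lp q' lam'"
    proof (rule Lp_dominated(2)[OF p0(3) gM[OF that]])
      show "cmod (g i x) \<le> (\<Sum>j\<in>{i}. 1 * indicator (dcube N j) x)" for x
        using g[OF that] by (simp add: test_function_def)
      show "integrable (weight_measure lam') (\<lambda>x. (\<Sum>j\<in>{i}. 1 * indicator (dcube N j) x) powr q')"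
        using p0 by (intro integrable_indicator_sum_powr w) auto
    qed
    then show ?thesis by (simp add: Lp_def)
  qed
  have int: "integrable lebesgue (\<lambda>x. g i x * U (f j) x)" if "i \<in> S" "j \<in> S" for i j
  proof (rule integrableI_bounded)
    show "(\<lambda>x. g i x * U (f j) x) \<in> borel_measurable lebesgue"
      using gM that UM(1)[OF Lpf] by (intro borel_measurable_times) auto
    have "(\<integral>\<^sup>+x. ennreal (norm (g i x * U (f j) x)) \<partial>lebesgue) \<le> Lp_norm q' lam' (g i) * Lp_norm q lam (U (f j))"
      using that by (intro Lp_duality[OF pq(2-4) w(2-4)] gM UM Lpf)
    also have "\<dots> < \<infinity>" using gnorm[OF that(1)] UM(2)[OF Lpf[OF that(2)]] by (simp add: ennreal_mult_less_top)
    finally show "(\<integral>\<^sup>+x. ennreal (norm (g i x * U (f j) x)) \<partial>lebesgue) < \<infinity>" .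
  qed
  have "(LINT x|lebesgue. gg x * U ff x) = (LINT x|lebesgue. (\<Sum>i\<in>S. \<Sum>j\<in>S. \<gamma> i * \<alpha> j * (g i x * U (f j) x)))"
  proof (rule integral_cong_AE)
    show "(\<lambda>x. gg x * U ff x) \<in> borel_measurable lebesgue"
      using ggM UM(1)[OF fsum(3)] by (intro borel_measurable_times)
    show "(\<lambda>x. \<Sum>i\<in>S. \<Sum>j\<in>S. \<gamma> i * \<alpha> j * (g i x * U (f j) x)) \<in> borel_measurable lebesgue"
      using gM UM(1)[OF Lpf] by (intro borel_measurable_sum borel_measurable_times) auto
    show "AE x in lebesgue. gg x * U ff x = (\<Sum>i\<in>S. \<Sum>j\<in>S. \<gamma> i * \<alpha> j * (g i x * U (f j) x))"
      using fsum(1)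
    proof eventually_elim
      case (elim x)
      show ?case unfolding elim gg_def[of x] sum_product by (intro sum.cong refl) (simp add: mult_ac)
    qed
  qed
  also have "\<dots> = (\<Sum>i\<in>S. \<Sum>j\<in>S. \<gamma> i * \<alpha> j * X i j)"
    unfolding X_def using int by (simp add: Bochner_Integration.integral_sum)
  also have "\<dots> = (\<Sum>i\<in>S. \<Sum>j\<in>S. of_real (\<sigma> i * \<sigma> j) * m i j)"
    by (intro sum.cong refl) (simp add: \<alpha>_def \<gamma>_def m_def mult_ac)
  finally have form: "(LINT x|lebesgue. gg x * U ff x) = (\<Sum>i\<in>S. \<Sum>j\<in>S. of_real (\<sigma> i * \<sigma> j) * m i j)" .
  have mii: "m i i = of_real (a i * c i * cmod (X i i))" for i
  proof -
    have "m i i = of_real (a i * c i) * (X i i * cnj (sgn (X i i)))" by (simp add: m_def \<theta>_def mult_ac)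
    then show ?thesis by (simp add: mult_cnj_sgn)
  qed
  have "(\<Sum>i\<in>S. a i * c i * cmod (X i i)) = cmod (\<Sum>i\<in>S. m i i)"
    unfolding mii of_real_sum[symmetric] using a c by (simp add: sum_nonneg del: of_real_sum)
  also have "\<dots> \<le> cmod (LINT x|lebesgue. gg x * U ff x)" unfolding form using \<sigma>(2) by simp
  finally have "ennreal (\<Sum>i\<in>S. a i * c i * cmod (X i i)) \<le> ennreal (cmod (LINT x|lebesgue. gg x * U ff x))"
    by (rule ennreal_leI)
  \<comment> \<open>A non-integrable function has Bochner integral 0, so that case is
    trivial.\<close>
  also have "\<dots> \<le> (\<integral>\<^sup>+x. ennreal (cmod (gg x * U ff x)) \<partial>lebesgue)"
  proof (cases "integrable lebesgue (\<lambda>x. gg x * U ff x)")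
    case True
    then show ?thesis by (rule integral_norm_bound_ennreal)
  qed (simp add: not_integrable_integral_eq)
  also have "\<dots> \<le> Lp_norm q' lam' gg * Lp_norm q lam (U ff)"
    by (intro Lp_duality[OF pq(2-4) w(2-4)] ggM UM fsum(3))
  also have "\<dots> \<le> Lp_norm q' lam' gg * (op_norm p \<mu> q lam U * Lp_norm p \<mu> ff)"
    by (intro mult_left_mono op_norm_bound[OF U p0(1,2) w(2) fsum(3)]) simp
  also have "\<dots> \<le> ennreal ((LINT x|weight_measure lam'. (\<Sum>i\<in>S. c i * indicator (dcube N i) x) powr q') powr (1 / q'))
     * (op_norm p \<mu> q lam U * ennreal ((LINT x|weight_measure \<mu>. (\<Sum>i\<in>S. a i * indicator (dcube 1 i) x) powr p) powr (1 / p)))"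
  proof (intro mult_mono Lp_dominated(1) p0 ggM ffM ggle ffle order_refl)
    show "integrable (weight_measure lam') (\<lambda>x. (\<Sum>i\<in>S. c i * indicator (dcube N i) x) powr q')"
      using c p0 by (intro integrable_indicator_sum_powr w S) auto
    show "integrable (weight_measure \<mu>) (\<lambda>x. (\<Sum>i\<in>S. a i * indicator (dcube 1 i) x) powr p)"
      using a p0 by (intro integrable_indicator_sum_powr w S) auto
  qed auto
  finally show ?thesis by (simp add: X_def mult_ac)
qed

subsection \<open>The estimate for finitely many cubes\<close>

text \<open>This form also covers an infinite A_infinity constant. The added 1 and the assumption
  \<open>0 < T\<close> keep the other factors positive, so that the right-hand side is then really
  infinite.\<close>

lemma sparse_sum_norm_ennreal:
  fixes \<mu> \<nu> :: "real ^ 'd \<Rightarrow> real"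
  assumes mu: "weight \<mu>" and nu: "weight \<nu>" and S: "sparse \<nu> S" and D: "doubling_with D \<mu>"
    and p: "1 < p" "1 < p'" "1 / p + 1 / p' = 1"
    and a: "\<And>i. i \<in> S \<Longrightarrow> 0 \<le> a i"
    and b: "\<And>i. b i = a i * (wmeas \<nu> (dcube 1 i) / wmeas \<mu> (dcube 1 i)) powr (1 / p)"
    and T: "T = (\<Sum>i\<in>S. a i powr p * wmeas \<nu> (dcube 1 i))" "0 < T"
  shows "ennreal ((LINT x|weight_measure \<mu>. (\<Sum>i\<in>S. b i * indicator (dcube (2 ^ m) i) x) powr p) powr (1 / p))
    \<le> ennreal (1 + D ^ m * embedding_const D p' powr (1 / p')) * epowr (A_inf_const \<mu> \<nu>) (1 / p') * ennreal (T powr (1 / p))"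
proof -
  have D1: "1 \<le> D" using doubling_wmeas(2)[OF D mu, of 1] by simp
  define E where "E = D ^ m * embedding_const D p' powr (1 / p')"
  have E: "0 \<le> E" using D1 by (simp add: E_def)
  show ?thesis
  proof (cases "A_inf_const \<mu> \<nu>")
    case (real A)
    have "(LINT x|weight_measure \<mu>. (\<Sum>i\<in>S. b i * indicator (dcube (2 ^ m) i) x) powr p) powr (1 / p)
        \<le> E * A powr (1 / p') * T powr (1 / p)"
      unfolding E_def T(1) using real by (intro sparse_sum_norm[OF mu nu S _ _ D p a b]) auto
    also have "\<dots> \<le> (1 + E) * A powr (1 / p') * T powr (1 / p)"
      by (intro mult_right_mono) auto
    finally have "ennreal ((LINT x|weight_measure \<mu>. (\<Sum>i\<in>S. b i * indicator (dcube (2 ^ m) i) x) powr p) powr (1 / p))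
        \<le> ennreal ((1 + E) * A powr (1 / p') * T powr (1 / p))" by (rule ennreal_leI)
    also have "\<dots> = ennreal (1 + E) * epowr (A_inf_const \<mu> \<nu>) (1 / p') * ennreal (T powr (1 / p))"
      using E real by (simp add: ennreal_mult epowr_ennreal)
    finally show ?thesis by (simp add: E_def)
  next
    case top
    have "ennreal (1 + E) * top * ennreal (T powr (1 / p)) = top"
      using E T(2) by (simp add: ennreal_mult_top ennreal_top_mult)
    then show ?thesis using top by (simp add: E_def)
  qed
qed

lemma finite_family_bound:
  fixes b :: "real ^ 'd \<Rightarrow> complex" and \<mu> lam lam' \<nu> :: "real ^ 'd \<Rightarrow> real"
  assumes pq: "1 < q" "q < p" "1 / r = 1 / q - 1 / p" "1 / p + 1 / p' = 1" "1 / q + 1 / q' = 1"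
    and w: "weight \<mu>" "weight lam" "weight lam'" "weight \<nu>" "\<And>x. lam' x = lam x powr (- q' / q)"
    and D: "doubling_with D\<^sub>1 \<mu>" "doubling_with D\<^sub>2 lam'" "doubling_with D\<^sub>3 \<nu>"
    and B: "B_const p q' \<mu> lam' \<nu> < \<infinity>"
    and U: "bounded_linear_Lp p \<mu> q lam U"
    and osc: "0 < C" "\<And>c h. 0 < h \<Longrightarrow> \<exists>f g f' g'. test_function (cube c h) f \<and> test_function (cube c (2 ^ m * h)) g \<and>
      test_function (cube c h) f' \<and> test_function (cube c (2 ^ m * h)) g' \<and>
      osc b (cube c h) \<le> C * (cmod (LINT x|lebesgue. g x * U f x) + cmod (LINT x|lebesgue. g' x * U f' x))"
    and F: "finite F" "\<And>i. i \<in> F \<Longrightarrow> 0 < snd i"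
  shows "(\<integral>\<^sup>+x. (SUP i\<in>F. ennreal ((osc b (dcube 1 i) / wmeas \<nu> (dcube 1 i)) powr r) * indicator (dcube 1 i) x) \<partial>weight_measure \<nu>)
    \<le> epowr (ennreal ((8 * D\<^sub>3 ^ 4) powr (1 / r) * (2 * C) * (1 + embedding_const D\<^sub>1 p' powr (1 / p')) * (1 + D\<^sub>2 ^ m * embedding_const D\<^sub>2 q powr (1 / q)))
       * B_const p q' \<mu> lam' \<nu> * epowr (A_inf_const \<mu> \<nu>) (1 / p') * epowr (A_inf_const lam' \<nu>) (1 / q) * op_norm p \<mu> q lam U) r"
proof -
  have D3: "1 \<le> D\<^sub>3" using doubling_wmeas(2)[OF D(3) w(4), of 1] by simp
  have D1: "1 \<le> D\<^sub>1" using doubling_wmeas(2)[OF D(1) w(1), of 1] by simp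
  have D2: "1 \<le> D\<^sub>2" using doubling_wmeas(2)[OF D(2) w(3), of 1] by simp
  have p1: "1 < p" using pq by simp
  have "1 / p < 1" "0 < 1 / p" using p1 by auto
  then have "0 < 1 / p'" "1 / p' < 1" using pq(4) by linarith+
  then have p'1: "1 < p'" by (simp add: field_simps zero_less_divide_iff split: if_splits)
  have "1 / q < 1" "0 < 1 / q" using pq(1) by auto
  then have "0 < 1 / q'" "1 / q' < 1" using pq(5) by linarith+
  then have q'1: "1 < q'" by (simp add: field_simps zero_less_divide_iff split: if_splits)
  have "1 / p < 1 / q" using pq(1,2) by (simp add: field_simps)
  then have "0 < 1 / r" using pq(3) by linarith
  then have r0: "0 < r" by simp
  \<comment> \<open>This identity distributes \<open>Om i powr (r - 1)\<close> over the two test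
    families.\<close>
  have rexp: "r / p + r / q' = r - 1"
  proof -
    have "1 / p + 1 / q' = 1 - 1 / r" using pq(3,5) by linarith
    then have "r * (1 / p + 1 / q') = r * (1 - 1 / r)" by simp
    then show ?thesis using r0 by (simp add: algebra_simps)
  qed
  define Om where "Om i = osc b (dcube 1 i) / wmeas \<nu> (dcube 1 i)" for i
  have osc0: "0 \<le> osc b Q" for Q by (simp add: osc_def set_lebesgue_integral_def)
  have Om0: "0 \<le> Om i" for i using osc0 by (simp add: Om_def)
  obtain S E where SF: "S \<subseteq> F" and disj: "disjoint_family_on E S"
    and E: "\<And>i. i \<in> S \<Longrightarrow> E i \<in> sets lebesgue \<and> E i \<subseteq> dcube 1 i \<and> wmeas \<nu> (dcube 1 i) \<le> 2 * wmeas \<nu> (E i)"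
    and int: "(\<integral>\<^sup>+x. (SUP i\<in>F. ennreal (Om i powr r) * indicator (dcube 1 i) x) \<partial>weight_measure \<nu>)
       \<le> ennreal (8 * D\<^sub>3 ^ 4 * (\<Sum>i\<in>S. Om i powr r * wmeas \<nu> (dcube 1 i)))"
    by (rule sparse_selection[OF w(4) D(3) F, of "\<lambda>i. Om i powr r"]) auto
  have S: "sparse \<nu> S" unfolding sparse_def using disj E SF F finite_subset by blast
  have finS: "finite S" by (rule sparse_finite[OF S])
  define T where "T = (\<Sum>i\<in>S. Om i powr r * wmeas \<nu> (dcube 1 i))"
  have T0: "0 \<le> T" unfolding T_def by (intro sum_nonneg) auto
  define e1 where "e1 = 1 + embedding_const D\<^sub>1 p' powr (1 / p')"
  define e2 where "e2 = 1 + D\<^sub>2 ^ m * embedding_const D\<^sub>2 q powr (1 / q)"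
  have e: "0 < e1" "0 < e2" using D1 D2 by (auto simp: e1_def e2_def add_pos_nonneg)
  define Bc where "Bc = B_const p q' \<mu> lam' \<nu>"
  define A1 where "A1 = epowr (A_inf_const \<mu> \<nu>) (1 / p')"
  define A2 where "A2 = epowr (A_inf_const lam' \<nu>) (1 / q)"
  define op where "op = op_norm p \<mu> q lam U"
  have key: "ennreal (T powr (1 / r)) \<le> ennreal (2 * C * e1 * e2) * Bc * A1 * A2 * op"
  \<comment> \<open>For \<open>T = 0\<close> the claim is trivial; otherwise \<open>T\<close> is
    positive and finite, as the final cancellation requires.\<close>
  proof (cases "T = 0")
    case False
    then have Tpos: "0 < T" using T0 by simp
    obtain \<beta> where \<beta>: "Bc = ennreal \<beta>" "0 \<le> \<beta>" using B unfolding Bc_def by (cases "B_const p q' \<mu> lam' \<nu>") auto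
    have pos: "0 < wmeas \<mu> (dcube 1 i)" "0 < wmeas \<nu> (dcube 1 i)" "0 < wmeas lam' (dcube 1 i)" if "i \<in> S" for i
      using sparse_pos[OF S that] w by (auto intro!: wmeas_cube_pos)
    define a where "a i = Om i powr (r / p) * (wmeas \<nu> (dcube 1 i) / wmeas \<mu> (dcube 1 i)) powr (1 / p)" for i
    define c where "c i = Om i powr (r / q') * (wmeas \<nu> (dcube 1 i) / wmeas lam' (dcube 1 i)) powr (1 / q')" for i
    have a0: "0 \<le> a i" and c0: "0 \<le> c i" for i by (simp_all add: a_def c_def)
    \<comment> \<open>The weight ratios in \<open>a i\<close> and \<open>c i\<close> are the
      reciprocals of those in the B-constant, so their product with the latter is 1.\<close>
    have le\<beta>: "Om i powr (r - 1) \<le> \<beta> * (a i * c i)" if i: "i \<in> S" for i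
    proof -
      define x y z where "x = wmeas \<mu> (dcube 1 i)" and "y = wmeas \<nu> (dcube 1 i)" and "z = wmeas lam' (dcube 1 i)"
      have xyz: "0 < x" "0 < y" "0 < z" using pos[OF i] by (auto simp: x_def y_def z_def)
      have "dcube 1 i \<in> cubes" unfolding cubes_def
        by (intro CollectI exI[of _ "fst i"] exI[of _ "1 * snd i"]) (use sparse_pos[OF S i] in simp)
      then have "epowr (emeasure (weight_measure \<mu>) (dcube 1 i) / emeasure (weight_measure \<nu>) (dcube 1 i)) (1 / p) *
        epowr (emeasure (weight_measure lam') (dcube 1 i) / emeasure (weight_measure \<nu>) (dcube 1 i)) (1 / q') \<le> Bc"
        unfolding Bc_def B_const_def by (rule SUP_upper)
      then have "ennreal ((x / y) powr (1 / p) * (z / y) powr (1 / q')) \<le> ennreal \<beta>"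
        using xyz w \<beta> unfolding x_def y_def z_def
        by (simp add: emeasure_weight_cube divide_ennreal epowr_ennreal ennreal_mult)
      then have "(x / y) powr (1 / p) * (z / y) powr (1 / q') \<le> \<beta>" using \<beta> by simp
      then have "(x / y) powr (1 / p) * (z / y) powr (1 / q') * (a i * c i) \<le> \<beta> * (a i * c i)"
        using a0 c0 by (intro mult_right_mono) auto
      also have "(x / y) powr (1 / p) * (z / y) powr (1 / q') * (a i * c i) =
          (Om i powr (r / p) * Om i powr (r / q')) * (((x / y) powr (1 / p) * (y / x) powr (1 / p)) * ((z / y) powr (1 / q') * (y / z) powr (1 / q')))"
        by (simp add: a_def c_def x_def y_def z_def)
      also have "(x / y) powr (1 / p) * (y / x) powr (1 / p) = 1" using xyz by (simp flip: powr_mult)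
      also have "(z / y) powr (1 / q') * (y / z) powr (1 / q') = 1" using xyz by (simp flip: powr_mult)
      also have "Om i powr (r / p) * Om i powr (r / q') = Om i powr (r - 1)" by (simp flip: powr_add rexp)
      finally show ?thesis by simp
    qed
    define P where "P i f g f' g' \<longleftrightarrow> test_function (dcube 1 i) f \<and> test_function (dcube (2 ^ m) i) g \<and>
      test_function (dcube 1 i) f' \<and> test_function (dcube (2 ^ m) i) g' \<and>
      osc b (dcube 1 i) \<le> C * (cmod (LINT x|lebesgue. g x * U f x) + cmod (LINT x|lebesgue. g' x * U f' x))" for i f g f' g'
    have "\<forall>i\<in>S. \<exists>f g f' g'. P i f g f' g'"
    proof
      fix i assume "i \<in> S"
      from osc(2)[OF sparse_pos[OF S this], of "fst i"] show "\<exists>f g f' g'. P i f g f' g'" by (simp add: P_def)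
    qed
    then obtain f g f' g' where P: "\<And>i. i \<in> S \<Longrightarrow> P i (f i) (g i) (f' i) (g' i)" by metis
    define X where "X i = cmod (LINT x|lebesgue. g i x * U (f i) x)" for i
    define X' where "X' i = cmod (LINT x|lebesgue. g' i x * U (f' i) x)" for i
    have "T \<le> (\<Sum>i\<in>S. \<beta> * C * (a i * c i * X i + a i * c i * X' i))"
      unfolding T_def
    proof (rule sum_mono)
      fix i assume i: "i \<in> S"
      \<comment> \<open>One power of \<open>Om i\<close> cancels the mass of the cube and leaves the
        bare oscillation, which the kernel estimate bounds.\<close>
      have "Om i powr r * wmeas \<nu> (dcube 1 i) = Om i powr (r - 1) * osc b (dcube 1 i)"
      proof (cases "Om i = 0")
        case True
        then show ?thesis by simp
      next
        case False
        then have "Om i powr r = Om i powr (r - 1) * Om i" using Om0[of i] by (simp add: powr_diff)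
        then show ?thesis using pos(2)[OF i] by (simp add: Om_def)
      qed
      also have "\<dots> \<le> (\<beta> * (a i * c i)) * (C * (X i + X' i))"
        using le\<beta>[OF i] P[OF i] osc0 \<beta>(2) a0 c0 by (intro mult_mono) (auto simp: P_def X_def X'_def)
      also have "\<dots> = \<beta> * C * (a i * c i * X i + a i * c i * X' i)" by (simp add: algebra_simps)
      finally show "Om i powr r * wmeas \<nu> (dcube 1 i) \<le> \<beta> * C * (a i * c i * X i + a i * c i * X' i)" .
    qed
    then have T_le: "T \<le> \<beta> * C * ((\<Sum>i\<in>S. a i * c i * X i) + (\<Sum>i\<in>S. a i * c i * X' i))"
      by (simp only: sum_distrib_left[symmetric] sum.distrib)
    define NF where "NF = ennreal ((LINT x|weight_measure \<mu>. (\<Sum>i\<in>S. a i * indicator (dcube 1 i) x) powr p) powr (1 / p))"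
    define NG where "NG = ennreal ((LINT x|weight_measure lam'. (\<Sum>i\<in>S. c i * indicator (dcube (2 ^ m) i) x) powr q') powr (1 / q'))"
    have "ennreal (\<Sum>i\<in>S. a i * c i * X i) \<le> op * NF * NG"
      unfolding X_def op_def NF_def NG_def using P
      by (intro diagonal_sum_bound[OF U w(1-3,5) p1 pq(1) q'1 pq(5) finS _ _ a0 c0]) (auto simp: P_def)
    moreover have "ennreal (\<Sum>i\<in>S. a i * c i * X' i) \<le> op * NF * NG"
      unfolding X'_def op_def NF_def NG_def using P
      by (intro diagonal_sum_bound[OF U w(1-3,5) p1 pq(1) q'1 pq(5) finS _ _ a0 c0]) (auto simp: P_def)
    ultimately have sums: "ennreal ((\<Sum>i\<in>S. a i * c i * X i) + (\<Sum>i\<in>S. a i * c i * X' i)) \<le> 2 * (op * NF * NG)"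
      using a0 c0 by (subst ennreal_plus) (auto simp: X_def X'_def mult_2 intro!: sum_nonneg add_mono)
    \<comment> \<open>The functions \<open>f i\<close> live on the undilated cubes, so the dilation
      exponent is 0 here; for \<open>NG\<close> it is \<open>m\<close>.\<close>
    have NF: "NF \<le> ennreal e1 * A1 * ennreal (T powr (1 / p))"
      using sparse_sum_norm_ennreal[OF w(1,4) S D(1) p1 p'1 pq(4), of "\<lambda>i. Om i powr (r / p)" a T 0] Tpos p1
      unfolding NF_def e1_def A1_def by (simp add: a_def powr_powr T_def)
    have NG: "NG \<le> ennreal e2 * A2 * ennreal (T powr (1 / q'))"
      using sparse_sum_norm_ennreal[OF w(3,4) S D(2) q'1 pq(1), of "\<lambda>i. Om i powr (r / q')" c T m] Tpos q'1 pq(5)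
      unfolding NG_def e2_def A2_def by (simp add: c_def powr_powr T_def add.commute)
    have "ennreal T \<le> ennreal (\<beta> * C * ((\<Sum>i\<in>S. a i * c i * X i) + (\<Sum>i\<in>S. a i * c i * X' i)))"
      by (rule ennreal_leI[OF T_le])
    also have "\<dots> = ennreal \<beta> * ennreal C * ennreal ((\<Sum>i\<in>S. a i * c i * X i) + (\<Sum>i\<in>S. a i * c i * X' i))"
      using \<beta> osc(1) a0 c0 by (simp add: ennreal_mult X_def X'_def sum_nonneg add_nonneg_nonneg)
    also have "\<dots> \<le> ennreal \<beta> * ennreal C * (2 * (op * NF * NG))"
      by (intro mult_left_mono sums) auto
    also have "\<dots> \<le> ennreal \<beta> * ennreal C * (2 * (op * (ennreal e1 * A1 * ennreal (T powr (1 / p))) * (ennreal e2 * A2 * ennreal (T powr (1 / q')))))"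
      by (intro mult_left_mono mult_mono NF NG order_refl) auto
    also have "\<dots> = (ennreal (T powr (1 / p)) * ennreal (T powr (1 / q'))) * ((2 * ennreal C * ennreal e1 * ennreal e2) * Bc * A1 * A2 * op)"
      unfolding \<beta>(1) by (simp only: mult_ac)
    also have "2 * ennreal C * ennreal e1 * ennreal e2 = ennreal (2 * C * e1 * e2)"
      using osc(1) e by (simp add: ennreal_mult)
    also have "ennreal (T powr (1 / p)) * ennreal (T powr (1 / q')) = ennreal (T powr (1 / p + 1 / q'))"
      by (simp add: ennreal_mult powr_add)
    finally have "ennreal T \<le> ennreal (T powr (1 / p + 1 / q')) * (ennreal (2 * C * e1 * e2) * Bc * A1 * A2 * op)" .
    moreover have "T = T powr (1 / p + 1 / q') * T powr (1 / r)"
    proof -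
      have "1 / p + 1 / q' + 1 / r = 1" using pq(3,5) by linarith
      then show ?thesis using Tpos by (simp flip: powr_add)
    qed
    then have "ennreal T = ennreal (T powr (1 / p + 1 / q')) * ennreal (T powr (1 / r))"
      by (metis ennreal_mult powr_ge_zero)
    ultimately have "ennreal (T powr (1 / p + 1 / q')) * ennreal (T powr (1 / r)) \<le>
      ennreal (T powr (1 / p + 1 / q')) * (ennreal (2 * C * e1 * e2) * Bc * A1 * A2 * op)" by simp
    then show ?thesis using Tpos by (subst (asm) ennreal_mult_le_mult_iff) auto
  qed simp
  have "epowr (ennreal (8 * D\<^sub>3 ^ 4 * T)) (1 / r) = ennreal ((8 * D\<^sub>3 ^ 4) powr (1 / r)) * ennreal (T powr (1 / r))"
  proof -
    have "0 \<le> 8 * D\<^sub>3 ^ 4 * T" using T0 by simp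
    then have "epowr (ennreal (8 * D\<^sub>3 ^ 4 * T)) (1 / r) = ennreal ((8 * D\<^sub>3 ^ 4) powr (1 / r) * T powr (1 / r))"
      by (simp only: epowr_ennreal powr_mult)
    then show ?thesis by (simp only: ennreal_mult powr_ge_zero)
  qed
  also have "\<dots> \<le> ennreal ((8 * D\<^sub>3 ^ 4) powr (1 / r)) * (ennreal (2 * C * e1 * e2) * Bc * A1 * A2 * op)"
    by (intro mult_left_mono key) simp
  also have "\<dots> = ennreal ((8 * D\<^sub>3 ^ 4) powr (1 / r) * (2 * C) * e1 * e2) * Bc * A1 * A2 * op"
    using osc(1) e by (simp add: ennreal_mult mult_ac)
  finally have "epowr (ennreal (8 * D\<^sub>3 ^ 4 * T)) (1 / r) \<le> \<dots>" .
  then have "ennreal (8 * D\<^sub>3 ^ 4 * T) \<le> epowr (ennreal ((8 * D\<^sub>3 ^ 4) powr (1 / r) * (2 * C) * e1 * e2) * Bc * A1 * A2 * op) r"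
    using r0 by (subst (asm) epowr_le_iff) auto
  then show ?thesis
    using int unfolding T_def Om_def e1_def e2_def Bc_def A1_def A2_def op_def by (rule order_trans[rotated])
qed

subsection \<open>Reduction to countably many cubes\<close>

text \<open>A countable family lets the supremum be dominated by a measurable function. The dummy
  value 1 makes every index a genuine cube.\<close>

definition rational_cube :: "nat \<Rightarrow> (real ^ 'd) \<times> real" where
  "rational_cube n = (case from_nat n :: ('d \<Rightarrow> rat) \<times> rat of
     (c, h) \<Rightarrow> (\<chi> i. of_rat (c i), if 0 < h then of_rat h else 1))"

lemma rational_cube_pos: "0 < snd (rational_cube n)"
  by (simp add: rational_cube_def split: prod.split)

lemma rational_cube_approx:
  fixes c :: "real ^ 'd"
  assumes "0 < h"
  obtains n where "cube c h \<subseteq> dcube 1 (rational_cube n)" "dcube 1 (rational_cube n) \<subseteq> cube c (2 * h)"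
proof -
  have "\<exists>\<rho> :: rat. x - h / 4 < of_rat \<rho> \<and> of_rat \<rho> < x + h / 4" for x
    using of_rat_dense[of "x - h / 4" "x + h / 4"] assms by auto
  then have "\<forall>i. \<exists>\<rho> :: rat. c $ i - h / 4 < of_rat \<rho> \<and> of_rat \<rho> < c $ i + h / 4" by blast
  from choice[OF this] obtain \<rho> :: "'d \<Rightarrow> rat" where
    \<rho>0: "\<forall>i. c $ i - h / 4 < of_rat (\<rho> i) \<and> of_rat (\<rho> i) < c $ i + h / 4" ..
  have \<rho>: "\<bar>c $ i - of_rat (\<rho> i)\<bar> \<le> h / 4" for i
    using \<rho>0[rule_format, of i] by (intro abs_leI) argo+
  \<comment> \<open>The centre moves by at most \<open>h / 4\<close> in each coordinate, so a half
    side between \<open>5 / 4 * h\<close> and \<open>7 / 4 * h\<close> fits the cube between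
    \<open>cube c h\<close> and \<open>cube c (2 * h)\<close>.\<close>
  obtain s :: rat where s: "5 / 4 * h < of_rat s" "of_rat s < 7 / 4 * h"
    using of_rat_dense[of "5 / 4 * h" "7 / 4 * h"] assms by auto
  have "0 < s"
    using s(1) assms by (metis (no_types, opaque_lifting) dual_order.strict_trans mult_pos_pos zero_less_divide_iff zero_less_numeral zero_less_of_rat_iff)
  define n where "n = to_nat (\<rho>, s)"
  define j :: "(real ^ 'd) \<times> real" where "j = rational_cube n"
  have n: "j = (\<chi> i. of_rat (\<rho> i), of_rat s)"
    using \<open>0 < s\<close> by (simp add: j_def rational_cube_def n_def)
  show thesis
  proof (rule that[of n, folded j_def])
    show "cube c h \<subseteq> dcube 1 j"
    proof (rule cube_subset_cube)
      fix i
      show "\<bar>c $ i - fst j $ i\<bar> + h \<le> 1 * snd j"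
        using \<rho>[of i] s by (simp add: n)
    qed
    show "dcube 1 j \<subseteq> cube c (2 * h)"
    proof (rule cube_subset_cube)
      fix i
      show "\<bar>fst j $ i - c $ i\<bar> + 1 * snd j \<le> 2 * h"
        using \<rho>[of i] s by (simp add: n abs_minus_commute)
    qed
  qed
qed

text \<open>Passing from a cube to a slightly larger rational one costs 2 for the change of mean and
  \<open>D\<close> for the change of \<nu>-measure.\<close>

lemma sharp_maximal_le:
  fixes b :: "real ^ 'd \<Rightarrow> complex"
  assumes nu: "weight \<nu>" and D: "doubling_with D \<nu>" and b: "locally_integrable b"
  shows "sharp_maximal \<nu> b x \<le> ennreal (2 * D) *
    (SUP n. ennreal (osc b (dcube 1 (rational_cube n)) / wmeas \<nu> (dcube 1 (rational_cube n))) * indicator (dcube 1 (rational_cube n)) x)"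
    (is "_ \<le> _ * (SUP n. ?t n)")
  unfolding sharp_maximal_def
proof (rule SUP_least)
  have D1: "1 \<le> D" using doubling_wmeas(2)[OF D nu, of 1] by simp
  fix Q :: "(real ^ 'd) set" assume "Q \<in> cubes"
  then obtain c h where Q: "Q = cube c h" and h: "0 < h" by (auto simp: cubes_def)
  have osc0: "0 \<le> osc b R" for R by (simp add: osc_def set_lebesgue_integral_def)
  have nn: "(\<integral>\<^sup>+y\<in>Q. ennreal (cmod (b y - average Q b)) \<partial>lebesgue) = ennreal (osc b Q)"
    unfolding osc_def set_lebesgue_integral_def
  proof (subst nn_integral_eq_integral[symmetric])
    show "integrable lebesgue (\<lambda>y. indicator Q y *\<^sub>R cmod (b y - average Q b))"
      using set_integrable_cmod_diff[OF b, of Q] by (simp add: set_integrable_def Q)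
  qed (auto intro!: nn_integral_cong simp: indicator_def)
  show "indicator Q x / emeasure (weight_measure \<nu>) Q * (\<integral>\<^sup>+y\<in>Q. ennreal (cmod (b y - average Q b)) \<partial>lebesgue)
    \<le> ennreal (2 * D) * (SUP n. ?t n)"
  proof (cases "x \<in> Q")
    case True
    obtain n where n: "Q \<subseteq> dcube 1 (rational_cube n)" "dcube 1 (rational_cube n) \<subseteq> cube c (2 * h)"
      using rational_cube_approx[OF h, of c] unfolding Q by blast
    define R :: "(real ^ 'd) set" where "R = dcube 1 (rational_cube n)"
    have Rpos: "0 < wmeas \<nu> R" unfolding R_def by (intro wmeas_cube_pos[OF nu]) (simp add: rational_cube_pos)
    have Qpos: "0 < wmeas \<nu> Q" unfolding Q by (rule wmeas_cube_pos[OF nu h])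
    have "wmeas \<nu> R \<le> wmeas \<nu> (cube c (2 * h))"
      using n nu by (intro wmeas_mono[of _ _ _ c "2 * h"]) (auto simp: R_def)
    also have "\<dots> \<le> D * wmeas \<nu> Q" unfolding Q by (rule doubling_wmeas(1)[OF D nu h])
    finally have RQ: "wmeas \<nu> R \<le> D * wmeas \<nu> Q" .
    have "osc b Q \<le> 2 * (LINT y:Q|lebesgue. cmod (b y - average R b))"
      unfolding Q by (rule osc_le[OF b h])
    also have "(LINT y:Q|lebesgue. cmod (b y - average R b)) \<le> osc b R"
      unfolding osc_def set_lebesgue_integral_def
    proof (rule integral_mono)
      show "integrable lebesgue (\<lambda>y. indicator Q y *\<^sub>R cmod (b y - average R b))"
        using set_integrable_cmod_diff[OF b, of Q] by (simp add: set_integrable_def Q)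
      show "integrable lebesgue (\<lambda>y. indicator R y *\<^sub>R cmod (b y - average R b))"
        using set_integrable_cmod_diff[OF b, of R] by (simp add: set_integrable_def R_def)
      show "indicator Q y *\<^sub>R cmod (b y - average R b) \<le> indicator R y *\<^sub>R cmod (b y - average R b)" for y
        using n(1) by (auto simp: indicator_def R_def)
    qed
    finally have oQ: "osc b Q \<le> 2 * osc b R" by simp
    have "osc b Q / wmeas \<nu> Q \<le> 2 * osc b R / (wmeas \<nu> R / D)"
      using oQ RQ osc0[of R] osc0[of Q] Rpos Qpos D1 by (intro frac_le) (auto simp: field_simps)
    also have "\<dots> = 2 * D * (osc b R / wmeas \<nu> R)" by simp
    finally have "ennreal (osc b Q / wmeas \<nu> Q) \<le> ennreal (2 * D) * ennreal (osc b R / wmeas \<nu> R)"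
      using D1 osc0[of R] by (simp add: ennreal_leI flip: ennreal_mult)
    also have "ennreal (osc b R / wmeas \<nu> R) = ?t n"
      using True n(1) by (simp add: R_def subset_iff)
    also have "ennreal (2 * D) * ?t n \<le> ennreal (2 * D) * (SUP n. ?t n)"
      by (intro mult_left_mono SUP_upper) auto
    finally have *: "ennreal (osc b Q / wmeas \<nu> Q) \<le> ennreal (2 * D) * (SUP n. ?t n)" .
    have "indicator Q x / emeasure (weight_measure \<nu>) Q * ennreal (osc b Q) = ennreal (1 / wmeas \<nu> Q) * ennreal (osc b Q)"
      using True Qpos nu by (simp add: Q emeasure_weight_cube divide_ennreal flip: ennreal_1)
    also have "\<dots> = ennreal (osc b Q / wmeas \<nu> Q)"
      using osc0[of Q] by (simp flip: ennreal_mult)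
    finally show ?thesis using * by (simp add: nn)
  qed simp
qed

text \<open>Suprema over the first \<open>N\<close> rational cubes are measurable and increase with
  \<open>N\<close>, so monotone convergence carries the uniform finite bound over. The sharp maximal
  function enters only through monotonicity of the integral, where its measurability is not at
  issue.\<close>

lemma sharp_maximal_norm_le:
  fixes b :: "real ^ 'd \<Rightarrow> complex"
  assumes nu: "weight \<nu>" and D: "doubling_with D \<nu>" and b: "locally_integrable b" and r: "0 < r"
    and fin: "\<And>F. \<lbrakk>finite F; \<And>i. i \<in> F \<Longrightarrow> 0 < snd i\<rbrakk> \<Longrightarrow>
      (\<integral>\<^sup>+x. (SUP i\<in>F. ennreal ((osc b (dcube 1 i) / wmeas \<nu> (dcube 1 i)) powr r) * indicator (dcube 1 i) x) \<partial>weight_measure \<nu>) \<le> epowr Z r"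
  shows "wnorm r \<nu> (sharp_maximal \<nu> b) \<le> ennreal (2 * D) * Z"
proof -
  define u where "u i = (osc b (dcube 1 i) / wmeas \<nu> (dcube 1 i)) powr r" for i
  define t where "t i x = ennreal (u i) * indicator (dcube 1 i) x" for i and x :: "real ^ 'd"
  define W where "W N x = (SUP i\<in>rational_cube ` {..<N}. t i x)" for N :: nat and x
  have osc0: "0 \<le> osc b R" for R by (simp add: osc_def set_lebesgue_integral_def)
  have pw: "epowr (sharp_maximal \<nu> b x) r \<le> ennreal ((2 * D) powr r) * (SUP N. W N x)" for x
  proof -
    let ?o = "\<lambda>n. ennreal (osc b (dcube 1 (rational_cube n)) / wmeas \<nu> (dcube 1 (rational_cube n))) * indicator (dcube 1 (rational_cube n)) x"
    have D1: "1 \<le> D" using doubling_wmeas(2)[OF D nu, of 1] by simp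
    have "epowr (sharp_maximal \<nu> b x) r \<le> epowr (ennreal (2 * D) * (SUP n. ?o n)) r"
      using sharp_maximal_le[OF nu D b, of x] r by (intro epowr_mono) auto
    also have "\<dots> = ennreal ((2 * D) powr r) * epowr (SUP n. ?o n) r"
      using D1 by (simp add: epowr_mult epowr_ennreal)
    also have "epowr (SUP n. ?o n) r \<le> (SUP N. W N x)"
    proof (subst epowr_le_iff[OF r], rule SUP_least)
      fix n
      have "epowr (?o n) r = t (rational_cube n) x"
        using osc0 by (auto simp: t_def u_def indicator_def epowr_ennreal)
      also have "\<dots> \<le> W (Suc n) x" unfolding W_def by (intro SUP_upper) auto
      also have "\<dots> \<le> (SUP N. W N x)" by (intro SUP_upper) auto
      finally show "?o n \<le> epowr (SUP N. W N x) (1 / r)" using r by (simp add: epowr_le_iff)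
    qed
    finally show ?thesis by (simp add: mult_left_mono)
  qed
  have WM: "W N \<in> borel_measurable (weight_measure \<nu>)" for N
    unfolding W_def t_def by (intro borel_measurable_SUP borel_measurable_times_ennreal) (auto intro: countable_finite)
  have "(\<integral>\<^sup>+x. epowr (sharp_maximal \<nu> b x) r \<partial>weight_measure \<nu>) \<le> (\<integral>\<^sup>+x. ennreal ((2 * D) powr r) * (SUP N. W N x) \<partial>weight_measure \<nu>)"
    by (intro nn_integral_mono pw)
  also have "\<dots> = ennreal ((2 * D) powr r) * (\<integral>\<^sup>+x. (SUP N. W N x) \<partial>weight_measure \<nu>)"
    using WM by (intro nn_integral_cmult borel_measurable_SUP) auto
  also have "(\<integral>\<^sup>+x. (SUP N. W N x) \<partial>weight_measure \<nu>) = (SUP N. \<integral>\<^sup>+x. W N x \<partial>weight_measure \<nu>)"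
  proof (rule nn_integral_monotone_convergence_SUP[OF _ WM])
    show "incseq W"
      unfolding incseq_def le_fun_def W_def by (intro allI impI SUP_subset_mono) auto
  qed
  also have "\<dots> \<le> epowr Z r"
  proof (rule SUP_least)
    fix N
    show "(\<integral>\<^sup>+x. W N x \<partial>weight_measure \<nu>) \<le> epowr Z r"
      unfolding W_def t_def u_def by (rule fin) (auto simp: rational_cube_pos)
  qed
  finally have "(\<integral>\<^sup>+x. epowr (sharp_maximal \<nu> b x) r \<partial>weight_measure \<nu>) \<le> ennreal ((2 * D) powr r) * epowr Z r"
    by (simp add: mult_left_mono)
  also have "\<dots> = epowr (ennreal (2 * D) * Z) r"
  proof -
    have "1 \<le> D" using doubling_wmeas(2)[OF D nu, of 1] by simp
    then show ?thesis by (simp add: epowr_mult epowr_ennreal)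
  qed
  finally show ?thesis
    using r by (simp add: wnorm_def epowr_le_iff[of "1 / r"])
qed

theorem theorem4p1:
  fixes p q r p' q' :: real
    and K :: "real ^ 'd \<Rightarrow> real ^ 'd \<Rightarrow> complex" and \<omega> :: "real \<Rightarrow> real"
    and D\<^sub>1 D\<^sub>2 D\<^sub>3 :: real
  assumes "1 < q" and "q < p"
    and "1 / r = 1 / q - 1 / p"
    and "1 / p + 1 / p' = 1" and "1 / q + 1 / q' = 1"
    and "CZ_kernel \<omega> K" and "nondegenerate_kernel K"
  shows "\<exists>C::real. C > 0 \<and>
    (\<forall>(b :: real ^ 'd \<Rightarrow> complex) (\<mu> :: real ^ 'd \<Rightarrow> real) (lam :: real ^ 'd \<Rightarrow> real)
       (lam' :: real ^ 'd \<Rightarrow> real) (\<nu> :: real ^ 'd \<Rightarrow> real)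
       (U :: (real ^ 'd \<Rightarrow> complex) \<Rightarrow> (real ^ 'd \<Rightarrow> complex)).
       locally_integrable b \<longrightarrow>
       weight \<mu> \<longrightarrow> weight lam \<longrightarrow> weight lam' \<longrightarrow> weight \<nu> \<longrightarrow>
       (\<forall>x. lam' x = lam x powr (- q' / q)) \<longrightarrow>
       (\<forall>x. \<nu> x powr (1 / p + 1 / q') = \<mu> x powr (1 / p) * lam x powr (- 1 / q)) \<longrightarrow>
       doubling_with D\<^sub>1 \<mu> \<longrightarrow> doubling_with D\<^sub>2 lam' \<longrightarrow> doubling_with D\<^sub>3 \<nu> \<longrightarrow>
       B_const p q' \<mu> lam' \<nu> < \<infinity> \<longrightarrow>
       bounded_linear_Lp p \<mu> q lam U \<longrightarrow>
       off_support_representation b K U \<longrightarrow>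
       wnorm r \<nu> (sharp_maximal \<nu> b)
         \<le> ennreal C * B_const p q' \<mu> lam' \<nu> * epowr (A_inf_const \<mu> \<nu>) (1 / p')
             * epowr (A_inf_const lam' \<nu>) (1 / q) * op_norm p \<mu> q lam U)"
proof -
  obtain C m where C: "0 < C" and osc: "\<forall>c h b U. 0 < h \<longrightarrow> locally_integrable b \<longrightarrow> off_support_representation b K U \<longrightarrow>
    (\<exists>f g f' g'. test_function (cube c h) f \<and> test_function (cube c (2 ^ m * h)) g \<and>
      test_function (cube c h) f' \<and> test_function (cube c (2 ^ m * h)) g' \<and>
      osc b (cube c h) \<le> C * (cmod (LINT x|lebesgue. g x * U f x) + cmod (LINT x|lebesgue. g' x * U f' x)))"
    using oscillation_bound[OF assms(6,7)] by blast
  have "1 / p < 1 / q" using assms(1,2) by (simp add: field_simps)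
  then have "0 < 1 / r" using assms(3) by linarith
  then have r: "0 < r" by simp
  define E where "E = (8 * D\<^sub>3 ^ 4) powr (1 / r) * (2 * C) * (1 + embedding_const D\<^sub>1 p' powr (1 / p'))
    * (1 + D\<^sub>2 ^ m * embedding_const D\<^sub>2 q powr (1 / q))"
  \<comment> \<open>The constant is fixed before any weight is given, so \<open>D\<^sub>3\<close>
    may still be negative; the maximum with 1 guarantees positivity.\<close>
  define C' where "C' = max 1 (2 * D\<^sub>3 * E)"
  show ?thesis
  proof (intro exI[of _ C'] conjI allI impI)
    show "0 < C'" by (simp add: C'_def)
    fix b :: "real ^ 'd \<Rightarrow> complex" and \<mu> lam lam' \<nu> :: "real ^ 'd \<Rightarrow> real"
      and U :: "(real ^ 'd \<Rightarrow> complex) \<Rightarrow> (real ^ 'd \<Rightarrow> complex)"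
    assume b: "locally_integrable b" and w: "weight \<mu>" "weight lam" "weight lam'" "weight \<nu>"
      and lam': "\<forall>x. lam' x = lam x powr (- q' / q)"
      and "\<forall>x. \<nu> x powr (1 / p + 1 / q') = \<mu> x powr (1 / p) * lam x powr (- 1 / q)"
      and D: "doubling_with D\<^sub>1 \<mu>" "doubling_with D\<^sub>2 lam'" "doubling_with D\<^sub>3 \<nu>"
      and B: "B_const p q' \<mu> lam' \<nu> < \<infinity>"
      and U: "bounded_linear_Lp p \<mu> q lam U" "off_support_representation b K U"
    define Z where "Z = B_const p q' \<mu> lam' \<nu> * epowr (A_inf_const \<mu> \<nu>) (1 / p')
             * epowr (A_inf_const lam' \<nu>) (1 / q) * op_norm p \<mu> q lam U"
    have D3: "1 \<le> D\<^sub>3" using doubling_wmeas(2)[OF D(3) w(4), of 1] by simp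
    have "wnorm r \<nu> (sharp_maximal \<nu> b) \<le> ennreal (2 * D\<^sub>3) * (ennreal E * Z)"
    proof (rule sharp_maximal_norm_le[OF w(4) D(3) b r])
      fix F :: "((real ^ 'd) \<times> real) set"
      assume F: "finite F" "\<And>i. i \<in> F \<Longrightarrow> 0 < snd i"
      show "(\<integral>\<^sup>+x. (SUP i\<in>F. ennreal ((osc b (dcube 1 i) / wmeas \<nu> (dcube 1 i)) powr r) * indicator (dcube 1 i) x)
          \<partial>weight_measure \<nu>) \<le> epowr (ennreal E * Z) r"
        using finite_family_bound[OF assms(1-5) w(1-4) _ D B U(1) C _ F, of m b] lam' osc b U(2)
        unfolding E_def Z_def by (simp add: mult.assoc)
    qed
    also have "\<dots> = ennreal (2 * D\<^sub>3 * E) * Z"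
      using D3 by (simp add: ennreal_mult' mult.assoc)
    also have "\<dots> \<le> ennreal C' * Z"
      by (intro mult_right_mono ennreal_leI) (auto simp: C'_def)
    finally show "wnorm r \<nu> (sharp_maximal \<nu> b)
         \<le> ennreal C' * B_const p q' \<mu> lam' \<nu> * epowr (A_inf_const \<mu> \<nu>) (1 / p')
             * epowr (A_inf_const lam' \<nu>) (1 / q) * op_norm p \<mu> q lam U"
      by (simp add: Z_def mult.assoc)
  qed
qed

end
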